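(* Assume that for every $x\in\mathcal X$, $$\eta^2\,\mathrm{Var}[\imath_{P^*,W_1}(x;Y_1)]+(1-\eta)^2\,\mathrm{Var}[\imath_{P^*,W_2}(x;Y_2)]=V,$$ where $Y_k\sim W_k(\cdot|x)$. Then for every $\epsilon\in(0,1/2)$, $$\log M^*_{\mathrm f}(n,\epsilon)=nC-\sqrt{nV}\,Q^{-1}(2\epsilon)+\mathcal O(n^{1/3}\log n)\quad (n\to\infty),$$ i.e., there exist constants $K,n_0$ such that $\big|\log M^*_{\mathrm f}(n,\epsilon)-nC+\sqrt{nV}Q^{-1}(2\epsilon)\big|\le Kn^{1/3}\log n$ for all $n\ge n_0$.
   Context: Setting (CM-DMBC): finite alphabets $\mathcal X=\{1,\dots,N\}$, $\mathcal Y$; transition matrices $W_1,W_2$; given input $x$ the outputs are $(y_1,y_2)$ with probability $W_1(y_1|x)W_2(y_2|x)$, memoryless. For a distribution $P$ on $\mathcal X$: $PW_k(y)=\sum_xP(x)W_k(y|x)$, $\imath_{P,W_k}(x;y)=\log\frac{W_k(y|x)}{PW_k(y)}$ (natural log), $I_k(P)=\sum_xP(x)D(W_k(\cdot|x)\|PW_k)$, $V_k(P)=\sum_xP(x)\mathrm{Var}[\imath_{P,W_k}(x;Y_k)]$ with $Y_k\sim W_k(\cdot|x)$. $C=\max_P\min_kI_k(P)$, $C_k=\max_PI_k(P)$. Standing assumptions: the maximizer $P^*$ of $\min_kI_k$ is unique, $P^*(x)>0$ for all $x$, $V_k:=V_k(P^* )>0$ and $C_k>C$ for $k=1,2$. $P^*_{Y_k}=P^*W_k$;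 for $\mathbf v\in\mathbb R^N$ with entries summing to zero, $\mathrm dI_k(\mathbf v)=\sum_xv_xD(W_k(\cdot|x)\|P^*_{Y_k})$; $\eta\in(0,1)$ is the unique constant with $\eta\,\mathrm dI_1(\mathbf v)+(1-\eta)\mathrm dI_2(\mathbf v)=0$ for all such $\mathbf v$. $V=\eta^2V_1+(1-\eta)^2V_2$. $Q$ is the Gaussian tail function $Q(t)=\int_t^\infty\frac1{\sqrt{2\pi}}e^{-u^2/2}du$. An $(n,M,\epsilon)$-FLF code: encoders $f_i:\{1,\dots,M\}\times\mathcal Y^{i-1}\times\mathcal Y^{i-1}\to\mathcal X$ (possibly randomized), $X_i=f_i(J,Y_1^{i-1},Y_2^{i-1})$ with $J$ uniform on $\{1,\dots,M\}$; decoders $g_k:\mathcal Y^n\to\{1,\dots,M\}$ with $\mathbb P[g_k(Y_k^n)\ne J]\le\epsilon$, $k=1,2$. $M^*_{\mathrm f}(n,\epsilon)$ is the largest $M$ for which an $(n,M,\epsilon)$-FLF code exists. *)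

theory Defs
  imports "HOL-Analysis.Analysis"
begin

text \<open>Input alphabet: a finite type 'x (so N = CARD('x)); output alphabet: a finite type 'y.
  A channel is a transition matrix W :: 'x => 'y => real, W x y = W(y|x).\<close>

definition is_channel :: "('x::finite \<Rightarrow> 'y::finite \<Rightarrow> real) \<Rightarrow> bool" where
  "is_channel W \<longleftrightarrow> (\<forall>x y. 0 \<le> W x y) \<and> (\<forall>x. (\<Sum>y\<in>UNIV. W x y) = 1)"

definition is_dist :: "('a::finite \<Rightarrow> real) \<Rightarrow> bool" where
  "is_dist P \<longleftrightarrow> (\<forall>a. 0 \<le> P a) \<and> (\<Sum>a\<in>UNIV. P a) = 1"

definition outd :: "('x::finite \<Rightarrow> real) \<Rightarrow> ('x \<Rightarrow> 'y \<Rightarrow> real) \<Rightarrow> 'y \<Rightarrow> real" where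
  "outd P W y = (\<Sum>x\<in>UNIV. P x * W x y)"

definition info_dens :: "('x::finite \<Rightarrow> real) \<Rightarrow> ('x \<Rightarrow> 'y \<Rightarrow> real) \<Rightarrow> 'x \<Rightarrow> 'y \<Rightarrow> real" where
  "info_dens P W x y = ln (W x y / outd P W y)"

definition KL :: "('y::finite \<Rightarrow> real) \<Rightarrow> ('y \<Rightarrow> real) \<Rightarrow> real" where
  "KL p q = (\<Sum>y\<in>UNIV. if p y = 0 then 0 else p y * ln (p y / q y))"

definition mutual_info :: "('x::finite \<Rightarrow> real) \<Rightarrow> ('x \<Rightarrow> 'y::finite \<Rightarrow> real) \<Rightarrow> real" where
  "mutual_info P W = (\<Sum>x\<in>UNIV. P x * KL (W x) (outd P W))"

text \<open>Var[i_{P,W}(x;Y)] with Y ~ W(.|x); the mean of i_{P,W}(x;Y) is D(W(.|x)||PW).\<close>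
definition cond_var :: "('x::finite \<Rightarrow> real) \<Rightarrow> ('x \<Rightarrow> 'y::finite \<Rightarrow> real) \<Rightarrow> 'x \<Rightarrow> real" where
  "cond_var P W x = (\<Sum>y\<in>UNIV. if W x y = 0 then 0
       else W x y * (info_dens P W x y - KL (W x) (outd P W))\<^sup>2)"

definition disp :: "('x::finite \<Rightarrow> real) \<Rightarrow> ('x \<Rightarrow> 'y::finite \<Rightarrow> real) \<Rightarrow> real" where
  "disp P W = (\<Sum>x\<in>UNIV. P x * cond_var P W x)"

definition common_cap :: "('x::finite \<Rightarrow> 'y::finite \<Rightarrow> real) \<Rightarrow> ('x \<Rightarrow> 'y \<Rightarrow> real) \<Rightarrow> real" where
  "common_cap W1 W2 = (SUP P\<in>{P. is_dist P}. min (mutual_info P W1) (mutual_info P W2))"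

definition single_cap :: "('x::finite \<Rightarrow> 'y::finite \<Rightarrow> real) \<Rightarrow> real" where
  "single_cap W = (SUP P\<in>{P. is_dist P}. mutual_info P W)"

definition dI :: "('x::finite \<Rightarrow> 'y::finite \<Rightarrow> real) \<Rightarrow> ('x \<Rightarrow> real) \<Rightarrow> ('x \<Rightarrow> real) \<Rightarrow> real" where
  "dI W P v = (\<Sum>x\<in>UNIV. v x * KL (W x) (outd P W))"

definition eta_const :: "('x::finite \<Rightarrow> 'y::finite \<Rightarrow> real) \<Rightarrow> ('x \<Rightarrow> 'y \<Rightarrow> real) \<Rightarrow> ('x \<Rightarrow> real) \<Rightarrow> real" where
  "eta_const W1 W2 P = (THE e. 0 < e \<and> e < 1 \<and>
      (\<forall>v::'x \<Rightarrow> real. (\<Sum>x\<in>UNIV. v x) = 0 \<longrightarrow> e * dI W1 P v + (1 - e) * dI W2 P v = 0))"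

definition Qfun :: "real \<Rightarrow> real" where
  "Qfun t = integral {t..} (\<lambda>u. exp (- (u\<^sup>2) / 2) / sqrt (2 * pi))"

definition Qinv :: "real \<Rightarrow> real" where
  "Qinv p = (THE t. Qfun t = p)"

text \<open>Feedback codes. A (randomized) encoder is
  enc i j ys1 ys2 x = probability that X_{i+1} = x given message j and past outputs
  ys1 = Y_1^i, ys2 = Y_2^i (time index i is 0-based).
  Joint probability of output sequences (ys1, ys2) of length n given message j:\<close>
definition out_prob ::
  "nat \<Rightarrow> (nat \<Rightarrow> nat \<Rightarrow> 'y list \<Rightarrow> 'y list \<Rightarrow> 'x::finite \<Rightarrow> real) \<Rightarrow>
   ('x \<Rightarrow> 'y::finite \<Rightarrow> real) \<Rightarrow> ('x \<Rightarrow> 'y \<Rightarrow> real) \<Rightarrow> nat \<Rightarrow> 'y list \<Rightarrow> 'y list \<Rightarrow> real" where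
  "out_prob n enc W1 W2 j ys1 ys2 =
     (\<Prod>i<n. \<Sum>x\<in>UNIV. enc i j (take i ys1) (take i ys2) x * W1 x (ys1 ! i) * W2 x (ys2 ! i))"

definition valid_encoder :: "(nat \<Rightarrow> nat \<Rightarrow> 'y list \<Rightarrow> 'y list \<Rightarrow> 'x::finite \<Rightarrow> real) \<Rightarrow> bool" where
  "valid_encoder enc \<longleftrightarrow> (\<forall>i j a b x. 0 \<le> enc i j a b x) \<and>
       (\<forall>i j a b. (\<Sum>x\<in>UNIV. enc i j a b x) = 1)"

definition err_prob1 ::
  "nat \<Rightarrow> nat \<Rightarrow> (nat \<Rightarrow> nat \<Rightarrow> 'y list \<Rightarrow> 'y list \<Rightarrow> 'x::finite \<Rightarrow> real) \<Rightarrow>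
   ('x \<Rightarrow> 'y::finite \<Rightarrow> real) \<Rightarrow> ('x \<Rightarrow> 'y \<Rightarrow> real) \<Rightarrow> ('y list \<Rightarrow> nat) \<Rightarrow> real" where
  "err_prob1 n M enc W1 W2 g = (1 / real M) *
     (\<Sum>j\<in>{1..M}. \<Sum>ys1\<in>{ys. length ys = n}. \<Sum>ys2\<in>{ys. length ys = n}.
        if g ys1 \<noteq> j then out_prob n enc W1 W2 j ys1 ys2 else 0)"

definition err_prob2 ::
  "nat \<Rightarrow> nat \<Rightarrow> (nat \<Rightarrow> nat \<Rightarrow> 'y list \<Rightarrow> 'y list \<Rightarrow> 'x::finite \<Rightarrow> real) \<Rightarrow>
   ('x \<Rightarrow> 'y::finite \<Rightarrow> real) \<Rightarrow> ('x \<Rightarrow> 'y \<Rightarrow> real) \<Rightarrow> ('y list \<Rightarrow> nat) \<Rightarrow> real" where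
  "err_prob2 n M enc W1 W2 g = (1 / real M) *
     (\<Sum>j\<in>{1..M}. \<Sum>ys1\<in>{ys. length ys = n}. \<Sum>ys2\<in>{ys. length ys = n}.
        if g ys2 \<noteq> j then out_prob n enc W1 W2 j ys1 ys2 else 0)"

definition FLF_code_exists ::
  "('x::finite \<Rightarrow> 'y::finite \<Rightarrow> real) \<Rightarrow> ('x \<Rightarrow> 'y \<Rightarrow> real) \<Rightarrow> nat \<Rightarrow> nat \<Rightarrow> real \<Rightarrow> bool" where
  "FLF_code_exists W1 W2 n M eps \<longleftrightarrow> 1 \<le> M \<and>
     (\<exists>(enc :: nat \<Rightarrow> nat \<Rightarrow> 'y list \<Rightarrow> 'y list \<Rightarrow> 'x \<Rightarrow> real) (g1 :: 'y list \<Rightarrow> nat) g2.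
        valid_encoder enc \<and> (\<forall>ys. g1 ys \<in> {1..M}) \<and> (\<forall>ys. g2 ys \<in> {1..M}) \<and>
        err_prob1 n M enc W1 W2 g1 \<le> eps \<and> err_prob2 n M enc W1 W2 g2 \<le> eps)"

definition Mstar_f ::
  "('x::finite \<Rightarrow> 'y::finite \<Rightarrow> real) \<Rightarrow> ('x \<Rightarrow> 'y \<Rightarrow> real) \<Rightarrow> nat \<Rightarrow> real \<Rightarrow> nat" where
  "Mstar_f W1 W2 n eps = (GREATEST M. FLF_code_exists W1 W2 n M eps)"

end

theory Submission
  imports Defs "HOL-Probability.Probability" "HOL-Real_Asymp.Real_Asymp"
begin

text \<open>
  Let \<open>S\<close> be the sum over time of \<open>\<eta> i\<^sub>1 + (1 - \<eta>) i\<^sub>2\<close>, where \<open>i\<^sub>k\<close> is the information density of receiver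
  \<open>k\<close> at the optimal input distribution. By the choice of \<open>\<eta>\<close> and the variance assumption each increment
  has conditional mean \<open>C\<close> and conditional variance \<open>V\<close> whatever input the encoder chooses, so \<open>S\<close> is
  asymptotically normal for every feedback code, with an error term obtained by running the heat
  equation backwards along the martingale.

  Converse: replacing \<open>W\<^sub>k\<close> by its output distribution makes the observation of receiver \<open>k\<close> independent of
  the message, so the accumulated density of receiver \<open>k\<close> falls below \<open>ln M\<close> with probability at most about
  \<open>\<epsilon>\<close>. If \<open>S \<le> ln M\<close>, this happens for one of the receivers; hence \<open>S \<le> ln M\<close> has probability at most
  about \<open>2\<epsilon>\<close>.

  Achievability: use i.i.d. codewords for \<open>n - n\<^sup>2\<^sup>/\<^sup>3\<close> steps. If \<open>S\<close> is then large enough, tilt the input distribution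
  during the remaining \<open>B = n\<^sup>2\<^sup>/\<^sup>3\<close> steps along a direction that trades the information of one receiver for that
  of the other, so that both end up with the value \<open>S\<close>; otherwise tilt fully in favour of one receiver,
  chosen by a fair coin, so that each receiver fails only in half of the bad cases. The tilt has size
  \<open>\<sigma> = O(sqrt (n ln n) / B)\<close>, and both its quadratic loss \<open>B \<sigma>\<^sup>2\<close> and the fluctuations of the last \<open>B\<close> steps
  are \<open>O(n\<^sup>1\<^sup>/\<^sup>3 ln n)\<close>. The tilt is implemented by a switching time between two opposite tilts, so a
  decoder can try all of its \<open>B + 1\<close> values at a negligible cost in rate.
\<close>

section \<open>The Gaussian tail function\<close>

text \<open>The exponent 1/3 comes from a balance: with B steering steps the quadratic loss has
  order n ln n / B and the uncorrected fluctuation order sqrt (B ln n); up to logarithms both are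
  n^(1/3) at B = n^(2/3). On the side of probabilities this precision tolerates an error n^(-1/6),
  because n^(-1/6) sqrt n = n^(1/3), so a central limit theorem weaker than Berry-Esseen is enough.
  The obstacle in the direct part is that the switching time depends on both output sequences:
  neither receiver sees it, and the transmitted inputs are not independent of the past outputs. The
  codeword therefore holds in advance the letters for every possible choice. Feedback only selects
  among them, and for each fixed switching time the selected letters are independent with a known
  law. A second obstacle is that one codebook must serve both receivers with average errors close to
  the ensemble means; Markov's inequality would lose a constant factor in \<open>eps\<close>. A
  second-moment bound over independent codewords loses only a vanishing term.\<close>

definition gauss :: "real \<Rightarrow> real" where
  "gauss u = exp (- (u\<^sup>2) / 2) / sqrt (2 * pi)"

lemma gauss_eq_density: "gauss = std_normal_density"
  by (rule ext) (simp add: gauss_def std_normal_density_def)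

lemma gauss_pos: "gauss u > 0"
  by (simp add: gauss_def)

lemma continuous_on_gauss: "continuous_on A gauss"
  unfolding gauss_def by (intro continuous_intros) auto

lemma set_integrable_gauss: "A \<in> sets borel \<Longrightarrow> set_integrable lborel A gauss"
  unfolding set_integrable_def gauss_eq_density
  by (rule integrable_mult_indicator) (auto intro: integrable_normal_density)

text \<open>\<open>Qfun\<close> is a gauge integral over an unbounded set; absolute integrability
  identifies it with a probability, which supplies additivity and the limits at infinity.\<close>

lemma integral_gauss_eq_measure:
  assumes "A \<in> sets borel"
  shows "integral A gauss = measure std_normal_distribution A"
proof -
  have "measure std_normal_distribution A = (LINT x|std_normal_distribution. indicator A x)"
    using assms by simp
  also have "\<dots> = (LINT x|lborel. std_normal_density x * indicator A x)"
    using assms by (subst integral_real_density) (auto)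
  also have "\<dots> = (LINT x:A|lborel. gauss x)"
    unfolding set_lebesgue_integral_def gauss_eq_density by (simp add: mult.commute)
  also have "\<dots> = integral A gauss"
    using set_borel_integral_eq_integral(2)[OF set_integrable_gauss[OF assms]] .
  finally show ?thesis by simp
qed

lemma Qfun_eq_measure: "Qfun t = measure std_normal_distribution {t..}"
  unfolding Qfun_def using integral_gauss_eq_measure[of "{t..}"] unfolding gauss_def[abs_def] by simp

interpretation normal: real_distribution std_normal_distribution
  by (rule real_dist_normal_dist)

lemma Qfun_diff: "a \<le> b \<Longrightarrow> Qfun a = integral {a..b} gauss + Qfun b"
proof -
  assume "a \<le> b"
  have "measure std_normal_distribution {b} = 0"
    using integral_gauss_eq_measure[of "{b}"] by simp
  moreover have "{a..} = {a..b} \<union> {b<..}" "{b..} = {b} \<union> {b<..}" using \<open>a \<le> b\<close> by auto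
  moreover have "measure std_normal_distribution ({a..b} \<union> {b<..}) =
    measure std_normal_distribution {a..b} + measure std_normal_distribution {b<..}"
    by (rule normal.finite_measure_Union) auto
  moreover have "measure std_normal_distribution ({b} \<union> {b<..}) =
    measure std_normal_distribution {b} + measure std_normal_distribution {b<..}"
    by (rule normal.finite_measure_Union) auto
  ultimately show ?thesis
    by (simp add: Qfun_eq_measure integral_gauss_eq_measure)
qed

lemma Qfun_has_derivative: "(Qfun has_real_derivative - gauss t) (at t within S)"
proof -
  \<comment> \<open>The fundamental theorem is applied on a compact window; the rest of the tail is
    the constant \<open>Qfun (t+1)\<close>.\<close>
  have "((\<lambda>x. integral {x..t+1} gauss) has_real_derivative - gauss t) (at t within {t-1..t+1})"
    by (rule integral_has_real_derivative') (auto intro: continuous_on_gauss)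
  then have "((\<lambda>x. integral {x..t+1} gauss + Qfun (t+1)) has_real_derivative - gauss t) (at t within {t-1..t+1})"
    by (auto intro!: derivative_eq_intros)
  then have "((\<lambda>x. integral {x..t+1} gauss + Qfun (t+1)) has_real_derivative - gauss t) (at t)"
    by (subst (asm) at_within_interior) auto
  moreover have ev: "\<forall>\<^sub>F x in nhds t. Qfun x = integral {x..t+1} gauss + Qfun (t+1)"
  proof -
    have "\<forall>\<^sub>F x in nhds t. x \<in> {t-1<..<t+1}" by (rule eventually_nhds_in_open) auto
    then show ?thesis by eventually_elim (rule Qfun_diff, auto)
  qed
  ultimately have "(Qfun has_real_derivative - gauss t) (at t)"
    using DERIV_cong_ev[OF refl ev refl] by simp
  then show ?thesis by (rule has_field_derivative_at_within)
qed

lemma Qfun_eq_cdf: "Qfun t = 1 - cdf std_normal_distribution t"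
proof -
  have "measure std_normal_distribution {t} = 0"
    using integral_gauss_eq_measure[of "{t}"] by simp
  moreover have "measure std_normal_distribution ({t} \<union> {t<..}) =
    measure std_normal_distribution {t} + measure std_normal_distribution {t<..}"
    by (rule normal.finite_measure_Union) auto
  moreover have "measure std_normal_distribution ({..t} \<union> {t<..}) =
    measure std_normal_distribution {..t} + measure std_normal_distribution {t<..}"
    by (rule normal.finite_measure_Union) auto
  moreover have "{..t} \<union> {t<..} = UNIV" "{t..} = {t} \<union> {t<..}" by auto
  moreover have "measure std_normal_distribution UNIV = 1"
    using normal.prob_space by simp
  ultimately show ?thesis by (simp add: Qfun_eq_measure cdf_def2)
qed

lemma Qfun_at_top: "(Qfun \<longlongrightarrow> 0) at_top"
  unfolding Qfun_eq_cdf[abs_def]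
  using tendsto_diff[OF tendsto_const normal.cdf_lim_at_top_prob, of 1] by simp

lemma Qfun_at_bot: "(Qfun \<longlongrightarrow> 1) at_bot"
  unfolding Qfun_eq_cdf[abs_def]
  using tendsto_diff[OF tendsto_const normal.cdf_lim_at_bot, of 1] by simp

lemma Qfun_nonneg: "0 \<le> Qfun t" and Qfun_le_1: "Qfun t \<le> 1"
  by (simp_all add: Qfun_eq_measure)

lemma isCont_Qfun: "isCont Qfun t"
  by (rule DERIV_isCont[OF Qfun_has_derivative])

lemma Qfun_strict_antimono: "a < b \<Longrightarrow> Qfun b < Qfun a"
  by (rule DERIV_neg_imp_decreasing, assumption)
     (metis Qfun_has_derivative gauss_pos neg_less_0_iff_less)

lemma Qfun_antimono: "a \<le> b \<Longrightarrow> Qfun b \<le> Qfun a"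
  using Qfun_strict_antimono[of a b] by (cases "a = b") auto

text \<open>The density is even, so the derivatives of \<open>Qfun t\<close> and
  \<open>Qfun (- t)\<close> cancel and the sum is constant; its value 1 is read off at
  infinity.\<close>

lemma Qfun_minus: "Qfun (- t) = 1 - Qfun t"
proof -
  have gm: "gauss (- x) = gauss x" for x by (simp add: gauss_def)
  have D: "((\<lambda>t. Qfun t + Qfun (- t)) has_real_derivative 0) (at x)" for x
  proof -
    have "((\<lambda>t. Qfun (- t)) has_real_derivative (- gauss (- x)) * (-1)) (at x)"
      by (rule DERIV_chain'[OF _ Qfun_has_derivative]) (auto intro!: derivative_eq_intros)
    then have "((\<lambda>t. Qfun t + Qfun (- t)) has_real_derivative - gauss x + (- gauss (- x)) * (-1)) (at x)"
      by (intro DERIV_add Qfun_has_derivative)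
    then show ?thesis by (simp add: gm)
  qed
  have const: "Qfun x + Qfun (- x) = Qfun t + Qfun (- t)" for x
    by (rule DERIV_isconst_all) (use D in auto)
  have "((\<lambda>x. Qfun x + Qfun (- x)) \<longlongrightarrow> 0 + 1) at_top"
    by (intro tendsto_add Qfun_at_top filterlim_compose[OF Qfun_at_bot] filterlim_uminus_at_bot_at_top)
  moreover have "(\<lambda>x. Qfun x + Qfun (- x)) = (\<lambda>x. Qfun t + Qfun (- t))"
    using const by (intro ext)
  ultimately have "((\<lambda>x::real. Qfun t + Qfun (- t)) \<longlongrightarrow> 1) at_top"
    by simp
  then show ?thesis by (simp add: tendsto_const_iff)
qed

text \<open>All four follow from exp (u^2/2) >= 1 + u^2/2 + u^4/8. These products occur in the
  derivatives of \<open>Qfun\<close> up to third order in space and second order in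
  variance.\<close>

lemma gauss_mult_poly_le:
  "gauss u \<le> 1" "\<bar>u\<bar> * gauss u \<le> 1" "u\<^sup>2 * gauss u \<le> 2" "\<bar>u\<bar>^3 * gauss u \<le> 4"
proof -
  define e where "e = exp (u\<^sup>2 / 2)"
  define s where "s = sqrt (2 * pi)"
  have s: "s \<ge> 1" unfolding s_def using pi_gt3 by (simp add: real_le_rsqrt)
  have e: "1 + u\<^sup>2/2 + (u\<^sup>2/2)\<^sup>2 / 2 \<le> e"
    unfolding e_def by (rule exp_lower_Taylor_quadratic) auto
  have g: "gauss u = 1 / (e * s)" unfolding gauss_def e_def s_def
    by (simp add: exp_minus field_simps)
  have es: "e * s \<ge> e" using mult_left_mono[OF s, of e] by (simp add: e_def)
  have e1: "e \<ge> 1" by (simp add: e_def)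
  have gen: "p * gauss u \<le> c" if "p \<le> c * e" "0 \<le> c" for p c
  proof -
    have "p \<le> c * (e * s)" using that es by (meson mult_left_mono order_trans)
    then show ?thesis using e1 s by (simp add: g pos_divide_le_eq)
  qed
  show "gauss u \<le> 1" using gen[of 1 1] e1 by simp
  have a1: "\<bar>u\<bar> \<le> 1 + u\<^sup>2/2"
    using zero_le_power2[of "\<bar>u\<bar> - 1"] by (simp add: power2_eq_square algebra_simps)
  show "\<bar>u\<bar> * gauss u \<le> 1" using gen[of "\<bar>u\<bar>" 1] e a1 zero_le_power2[of "u\<^sup>2/2"] by linarith
  show "u\<^sup>2 * gauss u \<le> 2" using gen[of "u\<^sup>2" 2] e zero_le_power2[of "u\<^sup>2/2"] by linarith
  have "\<bar>u\<bar>^3 = \<bar>u\<bar> * u\<^sup>2" by (simp add: power3_eq_cube power2_eq_square)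
  also have "\<dots> \<le> (1 + u\<^sup>2/2) * u\<^sup>2" using a1 by (intro mult_right_mono) auto
  also have "\<dots> \<le> 4 * (1 + u\<^sup>2/2 + (u\<^sup>2/2)\<^sup>2 / 2)" by (simp add: power2_eq_square algebra_simps)
  also have "\<dots> \<le> 4 * e" using e by simp
  finally show "\<bar>u\<bar>^3 * gauss u \<le> 4" using gen[of "\<bar>u\<bar>^3" 4] by simp
qed

lemma gauss_has_derivative: "(gauss has_real_derivative - u * gauss u) (at u within S)"
  unfolding gauss_def by (auto intro!: derivative_eq_intros simp: field_simps)

text \<open>The difference \<open>h\<close> of the two sides is nondecreasing by the cubic bound on
  \<open>gauss\<close> and tends to 0, so it is never positive. Quadratic decay is all that the
  smoothing in \<open>martingale_clt\<close> consumes.\<close>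

lemma Qfun_tail:
  assumes "u > 0" shows "Qfun u \<le> 2 / u\<^sup>2"
proof (rule ccontr)
  define h where "h x = Qfun x - 2 / x\<^sup>2" for x
  assume "\<not> Qfun u \<le> 2 / u\<^sup>2"
  then have pos: "h u > 0" by (simp add: h_def)
  have mono: "h u \<le> h x" if "u \<le> x" for x
  proof (rule DERIV_nonneg_imp_nondecreasing[OF that])
    fix y assume y: "u \<le> y"
    then have yp: "y > 0" using assms by simp
    have "(h has_real_derivative - gauss y + 4 / y^3) (at y)"
      unfolding h_def using yp
      by (auto intro!: derivative_eq_intros Qfun_has_derivative simp: power2_eq_square power3_eq_cube field_simps)
    moreover have "- gauss y + 4 / y^3 \<ge> 0"
      using gauss_mult_poly_le(4)[of y] yp by (simp add: field_simps)
    ultimately show "\<exists>z. (h has_real_derivative z) (at y) \<and> 0 \<le> z" by blast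
  qed
  have "((\<lambda>x::real. 2 / x\<^sup>2) \<longlongrightarrow> 0) at_top" by real_asymp
  then have "(h \<longlongrightarrow> 0 - 0) at_top" unfolding h_def by (intro tendsto_diff Qfun_at_top)
  moreover have "\<forall>\<^sub>F x in at_top. h u \<le> h x" using eventually_ge_at_top[of u] by eventually_elim (rule mono)
  ultimately have "h u \<le> 0" using tendsto_lowerbound by fastforce
  with pos show False by simp
qed

lemma Qfun_Qinv:
  assumes "0 < p" "p < 1"
  shows "Qfun (Qinv p) = p"
proof -
  have "\<forall>\<^sub>F x in at_top. Qfun x < p" using order_tendstoD(2)[OF Qfun_at_top] assms by simp
  then obtain b where b: "\<And>x. x \<ge> b \<Longrightarrow> Qfun x < p" by (auto simp: eventually_at_top_linorder)
  have "\<forall>\<^sub>F x in at_bot. Qfun x > p" using order_tendstoD(1)[OF Qfun_at_bot] assms by simp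
  then obtain a where a: "\<And>x. x \<le> a \<Longrightarrow> Qfun x > p" by (auto simp: eventually_at_bot_linorder)
  have "a \<le> b" using a[of a] b[of a] by fastforce
  have "\<exists>x\<ge>a. x \<le> b \<and> Qfun x = p"
    by (rule IVT2) (use a[of a] b[of b] \<open>a \<le> b\<close> isCont_Qfun in auto)
  then obtain x where x: "Qfun x = p" by auto
  show ?thesis unfolding Qinv_def
    by (rule theI[of _ x]) (use x Qfun_strict_antimono in \<open>auto, metis less_irrefl linorder_neqE\<close>)
qed

text \<open>Within distance 1 of the quantile \<open>t\<close> the slope of \<open>Qfun\<close> is
  at least \<open>gauss (\<bar>t\<bar> + 1)\<close> in absolute value. Division by \<open>c\<close>
  thus converts an error in probability into a shift of the quantile.\<close>

lemma Qfun_near_Qinv: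
  assumes "0 < p" "p < 1"
  obtains c where "c > 0"
    "\<And>x. 0 \<le> x \<Longrightarrow> x \<le> 1 \<Longrightarrow> Qfun (Qinv p + x) \<le> p - c * x"
    "\<And>x. 0 \<le> x \<Longrightarrow> x \<le> 1 \<Longrightarrow> Qfun (Qinv p - x) \<ge> p + c * x"
proof -
  define t where "t = Qinv p"
  define m where "m = \<bar>t\<bar> + 1"
  define c where "c = gauss m"
  have cg: "c \<le> gauss u" if "\<bar>u\<bar> \<le> m" for u
  proof -
    have "u\<^sup>2 \<le> m\<^sup>2" using that power_mono[OF that, of 2] by simp
    then show ?thesis unfolding c_def gauss_def by (simp add: divide_right_mono)
  qed
  have slope: "Qfun b \<le> Qfun a - c * (b - a)" if "a \<le> b" "\<bar>a\<bar> \<le> m" "\<bar>b\<bar> \<le> m" for a b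
  proof (cases "a = b")
    case False
    then have "a < b" using that by simp
    obtain z where z: "a < z" "z < b" "Qfun b - Qfun a = (b - a) * (- gauss z)"
      using MVT2[OF \<open>a < b\<close>, of Qfun "\<lambda>z. - gauss z"] Qfun_has_derivative by blast
    have "(b - a) * c \<le> (b - a) * gauss z"
      using z that by (intro mult_left_mono cg) auto
    then show ?thesis using z by (simp add: algebra_simps)
  qed simp
  have Q: "Qfun t = p" unfolding t_def by (rule Qfun_Qinv[OF assms])
  show thesis
  proof (rule that[of c])
    show "c > 0" by (simp add: c_def gauss_pos)
    fix x :: real assume x: "0 \<le> x" "x \<le> 1"
    show "Qfun (Qinv p + x) \<le> p - c * x"
      using slope[of t "t + x"] x Q by (auto simp: t_def m_def)
    show "Qfun (Qinv p - x) \<ge> p + c * x"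
      using slope[of "t - x" t] x Q abs_triangle_ineq4[of t x] by (auto simp: t_def m_def)
  qed
qed

section \<open>Path expectations and the martingale central limit theorem\<close>

text \<open>\<open>k zs\<close> is the law of the next letter after the history \<open>zs\<close>, and \<open>path_exp n k f\<close> the expectation of \<open>f\<close>
  over the resulting paths of length \<open>n\<close>.\<close>
primrec path_exp :: "nat \<Rightarrow> ('z list \<Rightarrow> 'z::finite \<Rightarrow> real) \<Rightarrow> ('z list \<Rightarrow> real) \<Rightarrow> real" where
  "path_exp 0 k f = f []"
| "path_exp (Suc n) k f = path_exp n k (\<lambda>zs. \<Sum>z\<in>UNIV. k zs z * f (zs @ [z]))"

definition stoch_kernel :: "('z list \<Rightarrow> 'z::finite \<Rightarrow> real) \<Rightarrow> bool" where
  "stoch_kernel k \<longleftrightarrow> (\<forall>zs z. 0 \<le> k zs z) \<and> (\<forall>zs. (\<Sum>z\<in>UNIV. k zs z) = 1)"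

text \<open>Handing the past \<open>take i zs\<close> to the increment lets \<open>d\<close> be a
  martingale difference for a history-dependent kernel.\<close>

definition psum :: "('z list \<Rightarrow> 'z \<Rightarrow> real) \<Rightarrow> 'z list \<Rightarrow> real" where
  "psum d zs = (\<Sum>i<length zs. d (take i zs) (zs ! i))"

lemma psum_Nil [simp]: "psum d [] = 0"
  by (simp add: psum_def)

lemma psum_snoc [simp]: "psum d (zs @ [z]) = psum d zs + d zs z"
  by (simp add: psum_def nth_append)

lemma stoch_kernel_nonneg: "stoch_kernel k \<Longrightarrow> 0 \<le> k zs z"
  by (simp add: stoch_kernel_def)

lemma stoch_kernel_sum: "stoch_kernel k \<Longrightarrow> (\<Sum>z\<in>UNIV. k zs z) = 1"
  by (simp add: stoch_kernel_def)

lemma path_exp_cong: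
  assumes "\<And>zs. length zs = n \<Longrightarrow> f zs = g zs"
  shows "path_exp n k f = path_exp n k g"
  using assms
proof (induction n arbitrary: f g)
  case (Suc n)
  show ?case unfolding path_exp.simps
    by (rule Suc.IH) (simp add: Suc.prems)
qed simp

lemma path_exp_mono:
  assumes "\<And>zs z. 0 \<le> k zs z" "\<And>zs. length zs = n \<Longrightarrow> f zs \<le> g zs"
  shows "path_exp n k f \<le> path_exp n k g"
  using assms(2)
proof (induction n arbitrary: f g)
  case (Suc n)
  show ?case unfolding path_exp.simps
    by (rule Suc.IH, intro sum_mono mult_left_mono assms(1)) (simp add: Suc.prems)
qed simp

lemma path_exp_cmult: "path_exp n k (\<lambda>zs. c * f zs) = c * path_exp n k f"
proof (induction n arbitrary: f)
  case (Suc n)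
  have "(\<Sum>z\<in>UNIV. k zs z * (c * f (zs @ [z]))) = c * (\<Sum>z\<in>UNIV. k zs z * f (zs @ [z]))" for zs
    by (simp add: sum_distrib_left mult.left_commute)
  then show ?case using Suc by simp
qed simp

lemma path_exp_add: "path_exp n k (\<lambda>zs. f zs + g zs) = path_exp n k f + path_exp n k g"
  by (induction n arbitrary: f g) (simp_all add: distrib_left sum.distrib)

lemma path_exp_zero [simp]: "path_exp n k (\<lambda>zs. 0) = 0"
  by (induction n) simp_all

lemma path_exp_sum: "path_exp n k (\<lambda>zs. \<Sum>i\<in>I. f i zs) = (\<Sum>i\<in>I. path_exp n k (f i))"
  by (induction I rule: infinite_finite_induct) (simp_all add: path_exp_add)

lemma path_exp_const: "stoch_kernel k \<Longrightarrow> path_exp n k (\<lambda>zs. c) = c"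
  by (induction n) (simp_all flip: sum_distrib_right add: stoch_kernel_sum)

lemma path_exp_take:
  assumes "stoch_kernel k" "m \<le> n"
  shows "path_exp n k (\<lambda>zs. f (take m zs)) = path_exp m k f"
  using assms(2)
proof (induction n)
  case (Suc n)
  show ?case
  proof (cases "m = Suc n")
    case True
    show ?thesis unfolding True by (rule path_exp_cong) simp
  next
    case False
    then have "m \<le> n" using Suc.prems by simp
    have "path_exp (Suc n) k (\<lambda>zs. f (take m zs)) = path_exp n k (\<lambda>zs. f (take m zs))"
      unfolding path_exp.simps
    proof (rule path_exp_cong)
      fix zs :: "'a list" assume "length zs = n"
      then have "(\<Sum>z\<in>UNIV. k zs z * f (take m (zs @ [z]))) = (\<Sum>z\<in>UNIV. k zs z) * f (take m zs)"
        using \<open>m \<le> n\<close> by (simp add: sum_distrib_right)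
      then show "(\<Sum>z\<in>UNIV. k zs z * f (take m (zs @ [z]))) = f (take m zs)"
        by (simp add: stoch_kernel_sum[OF assms(1)])
    qed
    then show ?thesis using Suc.IH[OF \<open>m \<le> n\<close>] by simp
  qed
qed simp

lemma path_exp_indicator_le_1:
  assumes "stoch_kernel k"
  shows "path_exp n k (\<lambda>zs. if P zs then 1 else 0) \<le> 1"
proof -
  have "path_exp n k (\<lambda>zs. if P zs then 1 else 0) \<le> path_exp n k (\<lambda>zs. 1)"
    by (rule path_exp_mono) (auto simp: stoch_kernel_nonneg[OF assms])
  then show ?thesis by (simp add: path_exp_const[OF assms])
qed

text \<open>Paths containing a letter of probability 0 carry no weight. This matters for likelihood
  ratios, which vanish on impossible letters although \<open>info_dens\<close> is 0 there.\<close>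

lemma path_exp_mono_support:
  assumes "\<And>zs z. 0 \<le> k zs z" "\<And>zs z. k zs z \<noteq> 0 \<Longrightarrow> R zs z"
    and "\<And>zs. length zs = n \<Longrightarrow> (\<And>i. i < n \<Longrightarrow> R (take i zs) (zs ! i)) \<Longrightarrow> f zs \<le> g zs"
  shows "path_exp n k f \<le> path_exp n k g"
proof -
  have "path_exp n k f \<le> path_exp n k g"
    if "\<And>zs. length zs = n \<Longrightarrow> (\<And>i. i < n \<Longrightarrow> R (take i zs) (zs ! i)) \<Longrightarrow> f zs \<le> g zs" for f g
    using that
  proof (induction n arbitrary: f g)
    case (Suc n)
    show ?case unfolding path_exp.simps
    proof (rule Suc.IH, rule sum_mono)
      fix zs :: "'a list" and z assume zs: "length zs = n" "\<And>i. i < n \<Longrightarrow> R (take i zs) (zs ! i)"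
      show "k zs z * f (zs @ [z]) \<le> k zs z * g (zs @ [z])"
      proof (cases "k zs z = 0")
        case False
        then have "R zs z" using assms(2) by blast
        then have "f (zs @ [z]) \<le> g (zs @ [z])"
          using zs by (intro Suc.prems) (auto simp: nth_append less_Suc_eq)
        then show ?thesis by (intro mult_left_mono assms(1))
      qed simp
    qed
  qed simp
  then show ?thesis using assms(3) by blast
qed

section \<open>Expansions of the Gaussian tail in position and variance\<close>

lemma DERIV_Qfun_scaled:
  assumes "r > 0"
  shows "((\<lambda>s. Qfun (s / r)) has_real_derivative - gauss (s / r) / r) (at s)"
    "((\<lambda>s. - gauss (s / r) / r) has_real_derivative (s / r) * gauss (s / r) / r\<^sup>2) (at s)"
    "((\<lambda>s. (s / r) * gauss (s / r) / r\<^sup>2) has_real_derivative (1 - (s / r)\<^sup>2) * gauss (s / r) / r^3) (at s)"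
proof -
  have d: "((\<lambda>s. s / r) has_real_derivative 1 / r) (at s)"
    using assms by (auto intro!: derivative_eq_intros)
  show "((\<lambda>s. Qfun (s / r)) has_real_derivative - gauss (s / r) / r) (at s)"
    using DERIV_chain'[OF d Qfun_has_derivative] by simp
  have g: "((\<lambda>s. gauss (s / r)) has_real_derivative - (s / r) * gauss (s / r) * (1 / r)) (at s)"
    using DERIV_chain'[OF d gauss_has_derivative] by simp
  show "((\<lambda>s. - gauss (s / r) / r) has_real_derivative (s / r) * gauss (s / r) / r\<^sup>2) (at s)"
    using assms by (auto intro!: derivative_eq_intros g simp: power2_eq_square field_simps)
  show "((\<lambda>s. (s / r) * gauss (s / r) / r\<^sup>2) has_real_derivative (1 - (s / r)\<^sup>2) * gauss (s / r) / r^3) (at s)"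
    using assms by (auto intro!: derivative_eq_intros g simp: power2_eq_square power3_eq_cube field_simps)
qed

lemma Qfun_scaled_Taylor:
  assumes "r > 0"
  shows "\<bar>Qfun ((a - d) / r) - (Qfun (a / r) + d * (gauss (a / r) / r) + d\<^sup>2 / 2 * ((a / r) * gauss (a / r) / r\<^sup>2))\<bar>
    \<le> \<bar>d\<bar>^3 / (2 * r^3)"
proof (cases "d = 0")
  case False
  define D where "D m s = (if m = 0 then Qfun (s / r) else if m = 1 then - gauss (s / r) / r
    else if m = 2 then (s / r) * gauss (s / r) / r\<^sup>2 else (1 - (s / r)\<^sup>2) * gauss (s / r) / r^3)" for m :: nat and s
  have "\<exists>t. (if a - d < a then a - d < t \<and> t < a else a < t \<and> t < a - d) \<and>
    Qfun ((a - d) / r) = (\<Sum>m<3. (D m a / fact m) * ((a - d) - a)^m) + (D 3 t / fact 3) * ((a - d) - a)^3"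
  proof (rule Taylor[where a = "min a (a - d)" and b = "max a (a - d)"])
    show "D 0 = (\<lambda>s. Qfun (s / r))" by (simp add: D_def fun_eq_iff)
    show "\<forall>m t. m < 3 \<and> min a (a - d) \<le> t \<and> t \<le> max a (a - d) \<longrightarrow> (D m has_real_derivative D (Suc m) t) (at t)"
    proof (intro allI impI)
      fix m :: nat and t assume "m < 3 \<and> min a (a - d) \<le> t \<and> t \<le> max a (a - d)"
      then consider "m = 0" | "m = 1" | "m = 2" by linarith
      then show "(D m has_real_derivative D (Suc m) t) (at t)"
        using DERIV_Qfun_scaled[OF assms, of t] by cases (simp_all add: D_def[abs_def])
    qed
  qed (use False in auto)
  then obtain t where t: "Qfun ((a - d) / r) = (\<Sum>m<3. (D m a / fact m) * (- d)^m) + (D 3 t / fact 3) * (- d)^3"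
    by auto
  have s: "(\<Sum>m<3. (D m a / fact m) * (- d)^m) = Qfun (a / r) + d * (gauss (a / r) / r) + d\<^sup>2 / 2 * ((a / r) * gauss (a / r) / r\<^sup>2)"
    by (simp add: eval_nat_numeral D_def mult_ac)
  \<comment> \<open>Together with the factor 1/6 of the cubic Taylor term, the bound 3 gives the
    constant 1/2 of the claim.\<close>
  have "\<bar>(1 - (t / r)\<^sup>2) * gauss (t / r)\<bar> \<le> 3"
    using gauss_mult_poly_le(1,3)[of "t / r"] gauss_pos[of "t / r"]
      mult_nonneg_nonneg[OF zero_le_power2[of "t/r"], of "gauss (t/r)"]
    unfolding left_diff_distrib abs_le_iff by linarith
  then have "\<bar>(1 - (t / r)\<^sup>2) * gauss (t / r)\<bar> * \<bar>d\<bar>^3 / (6 * r^3) \<le> 3 * \<bar>d\<bar>^3 / (6 * r^3)"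
    using assms by (intro divide_right_mono mult_right_mono) auto
  moreover have "\<bar>(D 3 t / fact 3) * (- d)^3\<bar> = \<bar>(1 - (t / r)\<^sup>2) * gauss (t / r)\<bar> * \<bar>d\<bar>^3 / (6 * r^3)"
    using assms by (simp add: D_def abs_mult power_abs fact_numeral)
  ultimately show ?thesis unfolding t s by simp
qed simp

lemma DERIV_Qfun_variance:
  assumes "\<tau> > 0"
  shows "((\<lambda>\<tau>. Qfun (a / sqrt \<tau>)) has_real_derivative (a / sqrt \<tau>) * gauss (a / sqrt \<tau>) / (2 * \<tau>)) (at \<tau>)"
    "((\<lambda>\<tau>. (a / sqrt \<tau>) * gauss (a / sqrt \<tau>) / (2 * \<tau>)) has_real_derivative
       ((a / sqrt \<tau>)^3 / 4 - 3 / 4 * (a / sqrt \<tau>)) * gauss (a / sqrt \<tau>) / \<tau>\<^sup>2) (at \<tau>)"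
proof -
  have st: "sqrt \<tau> > 0" "sqrt \<tau> * sqrt \<tau> = \<tau>" using assms by auto
  have d: "((\<lambda>\<tau>. a / sqrt \<tau>) has_real_derivative - (a / sqrt \<tau>) / (2 * \<tau>)) (at \<tau>)"
    using assms st by (auto intro!: derivative_eq_intros simp: field_simps)
  show "((\<lambda>\<tau>. Qfun (a / sqrt \<tau>)) has_real_derivative (a / sqrt \<tau>) * gauss (a / sqrt \<tau>) / (2 * \<tau>)) (at \<tau>)"
    using DERIV_chain'[OF d Qfun_has_derivative] by (simp add: mult.commute)
  define u where "u = a / sqrt \<tau>"
  have g: "((\<lambda>\<tau>. gauss (a / sqrt \<tau>)) has_real_derivative - (a / sqrt \<tau>) * gauss (a / sqrt \<tau>) * (- (a / sqrt \<tau>) / (2 * \<tau>))) (at \<tau>)"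
    using DERIV_chain'[OF d gauss_has_derivative] by simp
  have "((\<lambda>\<tau>. (a / sqrt \<tau>) * gauss (a / sqrt \<tau>)) has_real_derivative
     (a / sqrt \<tau>) * (- (a / sqrt \<tau>) * gauss (a / sqrt \<tau>) * (- (a / sqrt \<tau>) / (2 * \<tau>))) +
     (- (a / sqrt \<tau>) / (2 * \<tau>)) * gauss (a / sqrt \<tau>)) (at \<tau>)" (is "(?f has_real_derivative ?f') _")
    by (rule DERIV_mult'[OF d g])
  then have "((\<lambda>\<tau>. ?f \<tau> / (2 * \<tau>)) has_real_derivative (?f' * (2 * \<tau>) - ?f \<tau> * 2) / ((2 * \<tau>) * (2 * \<tau>))) (at \<tau>)"
    using assms by (intro DERIV_divide) (auto intro!: derivative_eq_intros)
  moreover have "(?f' * (2 * \<tau>) - ?f \<tau> * 2) / ((2 * \<tau>) * (2 * \<tau>)) = ((a / sqrt \<tau>)^3 / 4 - 3 / 4 * (a / sqrt \<tau>)) * gauss (a / sqrt \<tau>) / \<tau>\<^sup>2"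
    unfolding u_def[symmetric] using assms by (simp add: field_simps power2_eq_square power3_eq_cube)
  ultimately show "((\<lambda>\<tau>. (a / sqrt \<tau>) * gauss (a / sqrt \<tau>) / (2 * \<tau>)) has_real_derivative
       ((a / sqrt \<tau>)^3 / 4 - 3 / 4 * (a / sqrt \<tau>)) * gauss (a / sqrt \<tau>) / \<tau>\<^sup>2) (at \<tau>)" by simp
qed

lemma Qfun_variance_Taylor:
  assumes "\<tau> > 0" "V > 0"
  shows "\<bar>Qfun (a / sqrt (\<tau> + V)) - (Qfun (a / sqrt \<tau>) + V * ((a / sqrt \<tau>) * gauss (a / sqrt \<tau>) / (2 * \<tau>)))\<bar>
    \<le> V\<^sup>2 / \<tau>\<^sup>2"
proof -
  define D where "D m s = (if m = 0 then Qfun (a / sqrt s) else if m = 1 then (a / sqrt s) * gauss (a / sqrt s) / (2 * s)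
    else ((a / sqrt s)^3 / 4 - 3 / 4 * (a / sqrt s)) * gauss (a / sqrt s) / s\<^sup>2)" for m :: nat and s
  have "\<exists>t>\<tau>. t < \<tau> + V \<and>
    Qfun (a / sqrt (\<tau> + V)) = (\<Sum>m<2. (D m \<tau> / fact m) * ((\<tau> + V) - \<tau>)^m) + (D 2 t / fact 2) * ((\<tau> + V) - \<tau>)^2"
  proof (rule Taylor_up[where a = \<tau>])
    show "D 0 = (\<lambda>s. Qfun (a / sqrt s))" by (simp add: D_def fun_eq_iff)
    show "\<forall>m t. m < 2 \<and> \<tau> \<le> t \<and> t \<le> \<tau> + V \<longrightarrow> (D m has_real_derivative D (Suc m) t) (at t)"
    proof (intro allI impI)
      fix m :: nat and t assume A: "m < 2 \<and> \<tau> \<le> t \<and> t \<le> \<tau> + V"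
      then have "t > 0" using assms by linarith
      from A consider "m = 0" | "m = 1" by linarith
      then show "(D m has_real_derivative D (Suc m) t) (at t)"
        using DERIV_Qfun_variance[OF \<open>t > 0\<close>, of a] by cases (simp_all add: D_def[abs_def])
    qed
  qed (use assms in auto)
  then obtain t where t: "t > \<tau>" "Qfun (a / sqrt (\<tau> + V)) = (\<Sum>m<2. (D m \<tau> / fact m) * V^m) + (D 2 t / fact 2) * V^2"
    by auto
  have s: "(\<Sum>m<2. (D m \<tau> / fact m) * V^m) = Qfun (a / sqrt \<tau>) + V * ((a / sqrt \<tau>) * gauss (a / sqrt \<tau>) / (2 * \<tau>))"
    by (simp add: eval_nat_numeral D_def)
  define u where "u = a / sqrt t"
  have "\<bar>(u^3 / 4 - 3 / 4 * u) * gauss u\<bar> \<le> (\<bar>u\<bar>^3 / 4 + 3 / 4 * \<bar>u\<bar>) * gauss u"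
    unfolding abs_mult using gauss_pos[of u]
    by (intro mult_mono order_trans[OF abs_triangle_ineq4]) (auto simp: abs_mult power_abs)
  also have "\<dots> \<le> 2" using gauss_mult_poly_le(2,4)[of u] by (simp add: algebra_simps)
  finally have u: "\<bar>(u^3 / 4 - 3 / 4 * u) * gauss u\<bar> \<le> 2" .
  have "\<bar>(D 2 t / fact 2) * V^2\<bar> = \<bar>(u^3 / 4 - 3 / 4 * u) * gauss u\<bar> * (V\<^sup>2 / 2) / t\<^sup>2"
    by (simp add: D_def u_def abs_mult)
  also have "\<dots> \<le> 2 * (V\<^sup>2 / 2) / t\<^sup>2" by (intro divide_right_mono mult_right_mono u) auto
  also have "\<dots> \<le> 2 * (V\<^sup>2 / 2) / \<tau>\<^sup>2" using t(1) assms by (intro divide_left_mono power_mono) auto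
  finally show ?thesis unfolding t s by simp
qed

text \<open>\<open>Qfun (a / sqrt \<tau>)\<close> solves the heat equation, so a centred step of variance \<open>V\<close> acts like
  increasing \<open>\<tau>\<close> by \<open>V\<close>; the right-hand side is arranged to telescope.\<close>
lemma heat_step:
  fixes p d :: "'z::finite \<Rightarrow> real"
  assumes p: "\<And>z. 0 \<le> p z" "(\<Sum>z\<in>UNIV. p z) = 1"
    and d: "\<And>z. \<bar>d z\<bar> \<le> b" "(\<Sum>z\<in>UNIV. p z * d z) = 0" "(\<Sum>z\<in>UNIV. p z * (d z)\<^sup>2) = V"
    and V: "V > 0" and \<tau>: "\<tau> \<ge> 1"
  shows "\<bar>(\<Sum>z\<in>UNIV. p z * Qfun ((a - d z) / sqrt \<tau>)) - Qfun (a / sqrt (\<tau> + V))\<bar>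
    \<le> (b^3 / 2 + V\<^sup>2) * (2 * (1 + V) / V) * (1 / sqrt \<tau> - 1 / sqrt (\<tau> + V))"
proof -
  define r where "r = sqrt \<tau>"
  have r: "r \<ge> 1" "r\<^sup>2 = \<tau>" using \<tau> by (auto simp: r_def)
  have b: "b \<ge> 0" using d(1)[of undefined] by linarith
  define A B where "A = gauss (a / r) / r" and "B = (a / r) * gauss (a / r) / r\<^sup>2"
  have "(\<Sum>z\<in>UNIV. p z * (Qfun (a / r) + d z * A + (d z)\<^sup>2 / 2 * B)) =
     (\<Sum>z\<in>UNIV. p z) * Qfun (a / r) + (\<Sum>z\<in>UNIV. p z * d z) * A + (\<Sum>z\<in>UNIV. p z * (d z)\<^sup>2) / 2 * B"
    by (simp add: distrib_left sum.distrib sum_distrib_right sum_divide_distrib mult.assoc)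
  \<comment> \<open>The heat equation: \<open>B / 2\<close> is the derivative of
    \<open>Qfun (a / sqrt \<tau>)\<close> in \<open>\<tau>\<close>, so the second-order term in
    position becomes the first-order term in variance.\<close>
  also have "\<dots> = Qfun (a / r) + V * ((a / sqrt \<tau>) * gauss (a / sqrt \<tau>) / (2 * \<tau>))"
    using p d r by (simp add: B_def r_def field_simps)
  finally have main: "(\<Sum>z\<in>UNIV. p z * (Qfun (a / r) + d z * A + (d z)\<^sup>2 / 2 * B)) =
     Qfun (a / sqrt \<tau>) + V * ((a / sqrt \<tau>) * gauss (a / sqrt \<tau>) / (2 * \<tau>))" by (simp add: r_def)
  have "\<bar>(\<Sum>z\<in>UNIV. p z * Qfun ((a - d z) / r)) - (\<Sum>z\<in>UNIV. p z * (Qfun (a / r) + d z * A + (d z)\<^sup>2 / 2 * B))\<bar>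
    = \<bar>\<Sum>z\<in>UNIV. p z * (Qfun ((a - d z) / r) - (Qfun (a / r) + d z * A + (d z)\<^sup>2 / 2 * B))\<bar>"
    by (simp only: sum_subtractf right_diff_distrib)
  also have "\<dots> \<le> (\<Sum>z\<in>UNIV. p z * (b^3 / (2 * r^3)))"
  proof (rule order_trans[OF sum_abs sum_mono])
    fix z
    have "\<bar>Qfun ((a - d z) / r) - (Qfun (a / r) + d z * A + (d z)\<^sup>2 / 2 * B)\<bar> \<le> \<bar>d z\<bar>^3 / (2 * r^3)"
      unfolding A_def B_def using r by (intro Qfun_scaled_Taylor) auto
    also have "\<dots> \<le> b^3 / (2 * r^3)" using r d(1) by (intro divide_right_mono power_mono) auto
    finally show "\<bar>p z * (Qfun ((a - d z) / r) - (Qfun (a / r) + d z * A + (d z)\<^sup>2 / 2 * B))\<bar> \<le> p z * (b^3 / (2 * r^3))"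
      unfolding abs_mult abs_of_nonneg[OF p(1)] by (rule mult_left_mono[OF _ p(1)])
  qed
  also have "\<dots> = b^3 / 2 / r^3" unfolding sum_distrib_right[symmetric] p by simp
  finally have 1: "\<bar>(\<Sum>z\<in>UNIV. p z * Qfun ((a - d z) / r)) - (\<Sum>z\<in>UNIV. p z * (Qfun (a / r) + d z * A + (d z)\<^sup>2 / 2 * B))\<bar> \<le> b^3 / 2 / r^3" .
  have "V\<^sup>2 / \<tau>\<^sup>2 = V\<^sup>2 / (r^3 * r)" using r(2)[symmetric] by (simp add: power2_eq_square power3_eq_cube)
  also have "\<dots> \<le> V\<^sup>2 / r^3"
    by (rule divide_left_mono) (use r in \<open>auto\<close>)
  finally have 2: "\<bar>Qfun (a / sqrt (\<tau> + V)) - (Qfun (a / sqrt \<tau>) + V * ((a / sqrt \<tau>) * gauss (a / sqrt \<tau>) / (2 * \<tau>)))\<bar> \<le> V\<^sup>2 / r^3"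
    using Qfun_variance_Taylor[of \<tau> V a] V \<tau> by linarith
  have 3: "\<bar>(\<Sum>z\<in>UNIV. p z * Qfun ((a - d z) / sqrt \<tau>)) - Qfun (a / sqrt (\<tau> + V))\<bar> \<le> (b^3 / 2 + V\<^sup>2) * (1 / r^3)"
    using 1 2 unfolding main r_def[symmetric] by (simp add: add_divide_distrib)
  \<comment> \<open>Since s^2 = r^2 + V <= (1 + V) r^2 for r >= 1, the local error 1/r^3 is at most
    a constant times a difference that telescopes over the steps.\<close>
  have 4: "1 / r^3 \<le> (2 * (1 + V) / V) * (1 / sqrt \<tau> - 1 / sqrt (\<tau> + V))"
  proof -
    define s where "s = sqrt (\<tau> + V)"
    have s: "s\<^sup>2 = r\<^sup>2 + V" using \<tau> V r by (simp add: s_def)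
    have rs: "r < s" unfolding r_def s_def using V by simp
    have s0: "s > 0" using rs r by linarith
    have e: "(s - r) * (s + r) = V" using s by (simp add: algebra_simps power2_eq_square)
    have "1 / r - 1 / s = (s - r) / (r * s)" using r s0 by (simp add: field_simps)
    also have "\<dots> = ((s - r) * (s + r)) / (r * s * (s + r))" using r s0 by simp
    also have "\<dots> = V / (r * s * (s + r))" unfolding e ..
    finally have eq: "1 / r - 1 / s = V / (r * s * (s + r))" .
    have "r * s * (s + r) \<le> r * s * (s + s)" using rs r s0 by (intro mult_left_mono) auto
    also have "\<dots> = 2 * r * s\<^sup>2" by (simp add: power2_eq_square)
    also have "\<dots> = 2 * r * (r\<^sup>2 + V)" unfolding s ..
    also have "\<dots> \<le> 2 * r * (r\<^sup>2 + V * r\<^sup>2)" using r V by (intro mult_left_mono add_left_mono) (auto simp: one_le_power)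
    also have "\<dots> = 2 * (1 + V) * r^3" by (simp add: power2_eq_square power3_eq_cube algebra_simps)
    finally have "V / (2 * (1 + V) * r^3) \<le> V / (r * s * (s + r))"
      using V r s0 by (intro divide_left_mono) auto
    then have "(2 * (1 + V) / V) * (V / (2 * (1 + V) * r^3)) \<le> (2 * (1 + V) / V) * (1 / r - 1 / s)"
      unfolding eq using V by (intro mult_left_mono) auto
    moreover have "(A / V) * (V / (A * r^3)) = 1 / r^3" if "A \<noteq> 0" for A
      using V that by simp
    from this[of "2 * (1 + V)"] have "(2 * (1 + V) / V) * (V / (2 * (1 + V) * r^3)) = 1 / r^3"
      using V by simp
    ultimately show ?thesis by (simp add: r_def s_def)
  qed
  have "(b^3 / 2 + V\<^sup>2) * (1 / r^3) \<le> (b^3 / 2 + V\<^sup>2) * ((2 * (1 + V) / V) * (1 / sqrt \<tau> - 1 / sqrt (\<tau> + V)))"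
    using b by (intro mult_left_mono 4) auto
  with 3 show ?thesis by (simp add: mult.assoc)
qed

text \<open>Averaging over the last letter turns the smoothing variance \<open>\<tau>\<close> into
  \<open>\<tau> + V\<close> for the shorter path, hence the induction with \<open>\<tau>\<close>
  free. The errors telescope and stay below a multiple of 1 / sqrt \<tau>, however large
  \<open>n\<close> is.\<close>

lemma path_exp_heat:
  assumes k: "stoch_kernel k"
    and d: "\<And>zs z. length zs < n \<Longrightarrow> \<bar>d zs z\<bar> \<le> b"
      "\<And>zs. length zs < n \<Longrightarrow> (\<Sum>z\<in>UNIV. k zs z * d zs z) = 0"
      "\<And>zs. length zs < n \<Longrightarrow> (\<Sum>z\<in>UNIV. k zs z * (d zs z)\<^sup>2) = V"
    and V: "V > 0" and \<tau>: "\<tau> \<ge> 1"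
  shows "\<bar>path_exp n k (\<lambda>zs. Qfun ((t - psum d zs) / sqrt \<tau>)) - Qfun (t / sqrt (\<tau> + real n * V))\<bar>
    \<le> (b^3 / 2 + V\<^sup>2) * (2 * (1 + V) / V) * (1 / sqrt \<tau> - 1 / sqrt (\<tau> + real n * V))"
  using d \<tau>
proof (induction n arbitrary: \<tau>)
  case (Suc n)
  define K where "K = (b^3 / 2 + V\<^sup>2) * (2 * (1 + V) / V)"
  define F where "F zs = (\<Sum>z\<in>UNIV. k zs z * Qfun ((t - psum d (zs @ [z])) / sqrt \<tau>))" for zs
  define G where "G zs = Qfun ((t - psum d zs) / sqrt (\<tau> + V))" for zs
  define e where "e = K * (1 / sqrt \<tau> - 1 / sqrt (\<tau> + V))"
  have FG: "\<bar>F zs - G zs\<bar> \<le> e" if "length zs = n" for zs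
  proof -
    have "F zs = (\<Sum>z\<in>UNIV. k zs z * Qfun (((t - psum d zs) - d zs z) / sqrt \<tau>))"
      by (simp add: F_def algebra_simps)
    then show ?thesis unfolding G_def e_def K_def
      using that by (simp only:) (rule heat_step, auto simp: Suc.prems stoch_kernel_sum[OF k] stoch_kernel_nonneg[OF k] V)
  qed
  have "path_exp n k F \<le> path_exp n k (\<lambda>zs. G zs + e)" "path_exp n k (\<lambda>zs. G zs + - e) \<le> path_exp n k F"
    by (rule path_exp_mono; use FG in \<open>fastforce simp: stoch_kernel_nonneg[OF k] abs_le_iff\<close>)+
  then have 1: "\<bar>path_exp n k F - path_exp n k G\<bar> \<le> e"
    unfolding path_exp_add path_exp_const[OF k] by linarith
  have 2: "\<bar>path_exp n k G - Qfun (t / sqrt (\<tau> + V + real n * V))\<bar> \<le> K * (1 / sqrt (\<tau> + V) - 1 / sqrt (\<tau> + V + real n * V))"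
    unfolding G_def K_def by (rule Suc.IH) (use Suc.prems V in auto)
  have eq: "\<tau> + real (Suc n) * V = \<tau> + V + real n * V" by (simp add: algebra_simps)
  have "\<bar>path_exp n k F - Qfun (t / sqrt (\<tau> + real (Suc n) * V))\<bar> \<le> K * (1 / sqrt \<tau> - 1 / sqrt (\<tau> + real (Suc n) * V))"
    using 1 2 unfolding e_def eq right_diff_distrib by linarith
  moreover have "path_exp (Suc n) k (\<lambda>zs. Qfun ((t - psum d zs) / sqrt \<tau>)) = path_exp n k F"
    unfolding path_exp.simps F_def ..
  ultimately show ?case unfolding K_def by simp
qed simp

lemma Qfun_lipschitz: "\<bar>Qfun x - Qfun y\<bar> \<le> \<bar>x - y\<bar>"
proof -
  have *: "\<bar>Qfun x - Qfun y\<bar> \<le> \<bar>x - y\<bar>" if "x < y" for x y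
  proof -
    obtain z where "Qfun y - Qfun x = (y - x) * (- gauss z)"
      using MVT2[OF \<open>x < y\<close>, of Qfun "\<lambda>z. - gauss z"] Qfun_has_derivative by blast
    then have "\<bar>Qfun x - Qfun y\<bar> = \<bar>y - x\<bar> * gauss z" using gauss_pos[of z]
      by (simp add: abs_mult abs_minus_commute[of "Qfun x"])
    also have "\<dots> \<le> \<bar>y - x\<bar> * 1" using gauss_mult_poly_le(1)[of z] by (intro mult_left_mono) auto
    finally show ?thesis by (simp add: abs_minus_commute)
  qed
  from *[of x y] *[of y x] show ?thesis by (cases x y rule: linorder_cases) auto
qed

lemma Qfun_variance_lipschitz:
  assumes "\<tau> > 0" "\<tau> < \<tau>'"
  shows "\<bar>Qfun (a / sqrt \<tau>') - Qfun (a / sqrt \<tau>)\<bar> \<le> (\<tau>' - \<tau>) / \<tau>"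
proof -
  obtain z where z: "\<tau> < z" "z < \<tau>'" "Qfun (a / sqrt \<tau>') - Qfun (a / sqrt \<tau>) = (\<tau>' - \<tau>) * ((a / sqrt z) * gauss (a / sqrt z) / (2 * z))"
    using MVT2[OF assms(2), of "\<lambda>\<tau>. Qfun (a / sqrt \<tau>)" "\<lambda>z. (a / sqrt z) * gauss (a / sqrt z) / (2 * z)"]
      DERIV_Qfun_variance(1)[of _ a] assms(1) by (auto simp: less_le_trans)
  have "\<bar>(a / sqrt z) * gauss (a / sqrt z) / (2 * z)\<bar> = \<bar>a / sqrt z\<bar> * gauss (a / sqrt z) / (2 * z)"
    using z assms gauss_pos[of "a / sqrt z"] by (simp add: abs_mult)
  also have "\<dots> \<le> 1 / (2 * z)" using z assms by (intro divide_right_mono gauss_mult_poly_le) auto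
  also have "\<dots> \<le> 1 / \<tau>" using z assms by (intro divide_left_mono) auto
  finally show ?thesis unfolding z(3) abs_mult using assms by (auto simp: mult_left_mono dest: mult_left_mono[of _ _ "\<tau>' - \<tau>"])
qed

text \<open>The indicator of \<open>psum d zs > t\<close> is sandwiched between two
  Gaussian-smoothed versions with thresholds \<open>t - m\<close> and \<open>t + m\<close>, up to
  the tail of the smoothing, and \<open>path_exp_heat\<close> evaluates both.\<close>

lemma martingale_clt:
  assumes V: "V > 0" and n: "n \<ge> 1"
    and k: "stoch_kernel k"
    and d: "\<And>zs z. length zs < n \<Longrightarrow> \<bar>d zs z\<bar> \<le> b"
      "\<And>zs. length zs < n \<Longrightarrow> (\<Sum>z\<in>UNIV. k zs z * d zs z) = 0"
      "\<And>zs. length zs < n \<Longrightarrow> (\<Sum>z\<in>UNIV. k zs z * (d zs z)\<^sup>2) = V"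
  shows "\<bar>path_exp n k (\<lambda>zs. if psum d zs > t then 1 else 0) - Qfun (t / sqrt (real n * V))\<bar>
    \<le> (2 + (b^3 / 2 + V\<^sup>2) * (2 * (1 + V) / V) + 1 / sqrt V + 1 / V) * real n powr (-1/6)"
proof -
  define x where "x = real n"
  have x: "x \<ge> 1" using n by (simp add: x_def)
  define K where "K = (b^3 / 2 + V\<^sup>2) * (2 * (1 + V) / V)"
  \<comment> \<open>With \<tau> = n^(1/2) and m = n^(1/3), the smoothing tail at m / sqrt \<tau> =
    n^(1/12) is at most 2 n^(-1/6), the heat error has order n^(-1/4), the shift of the threshold
    costs m / sqrt (n V), of order n^(-1/6), and the extra variance \<tau> / (n V), of order
    n^(-1/2).\<close>
  define \<tau> where "\<tau> = x powr (1/2)"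
  define m where "m = x powr (1/3)"
  define q where "q = x powr (-1/6)"
  have b: "b \<ge> 0" using d(1)[of "[]" undefined] n by force
  have K: "K \<ge> 0" unfolding K_def using b V by (intro mult_nonneg_nonneg add_nonneg_nonneg) auto
  have \<tau>: "\<tau> \<ge> 1" using x by (simp add: \<tau>_def ge_one_powr_ge_zero)
  have m0: "m > 0" using x by (simp add: m_def)
  have sq\<tau>: "sqrt \<tau> = x powr (1/4)" using x by (simp add: \<tau>_def powr_half_sqrt_powr[symmetric] powr_powr powr_half_sqrt[symmetric])
  have tail: "Qfun (m / sqrt \<tau>) \<le> 2 * q"
  proof -
    have "m / sqrt \<tau> = x powr (1/12)" unfolding m_def sq\<tau> using x by (simp flip: powr_diff)
    moreover have "Qfun (x powr (1/12)) \<le> 2 / (x powr (1/12))\<^sup>2" using x by (intro Qfun_tail) auto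
    moreover have "(x powr (1/12))\<^sup>2 = x powr (1/6)" using x by (simp flip: powr_numeral add: powr_powr)
    moreover have "2 / x powr (1/6) = 2 * q" using x by (simp add: q_def powr_minus_divide)
    ultimately show ?thesis by simp
  qed
  define S where "S = x * V"
  have S: "S > 0" using x V by (simp add: S_def)
  have heat: "\<bar>path_exp n k (\<lambda>zs. Qfun ((s - psum d zs) / sqrt \<tau>)) - Qfun (s / sqrt (\<tau> + S))\<bar> \<le> K * q" for s
  proof -
    have "\<bar>path_exp n k (\<lambda>zs. Qfun ((s - psum d zs) / sqrt \<tau>)) - Qfun (s / sqrt (\<tau> + S))\<bar> \<le> K * (1 / sqrt \<tau> - 1 / sqrt (\<tau> + S))"
      unfolding K_def S_def x_def by (rule path_exp_heat[OF k d V \<tau>])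
    also have "\<dots> \<le> K * q"
    proof (rule mult_left_mono[OF _ K])
      have "1 / sqrt \<tau> - 1 / sqrt (\<tau> + S) \<le> 1 / sqrt \<tau>" using S \<tau> by simp
      also have "\<dots> = x powr (-1/4)" unfolding sq\<tau> by (simp add: powr_minus_divide)
      also have "\<dots> \<le> q" unfolding q_def using x by (intro powr_mono) auto
      finally show "1 / sqrt \<tau> - 1 / sqrt (\<tau> + S) \<le> q" .
    qed
    finally show ?thesis .
  qed
  have shift: "\<bar>Qfun (s / sqrt (\<tau> + S)) - Qfun (t / sqrt S)\<bar> \<le> (1 / sqrt V + 1 / V) * q" if "\<bar>s - t\<bar> = m" for s
  proof -
    have "\<bar>Qfun (s / sqrt (\<tau> + S)) - Qfun (t / sqrt (\<tau> + S))\<bar> \<le> \<bar>s / sqrt (\<tau> + S) - t / sqrt (\<tau> + S)\<bar>"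
      by (rule Qfun_lipschitz)
    also have "\<dots> = m / sqrt (\<tau> + S)" using that S \<tau> by (simp flip: diff_divide_distrib)
    also have "\<dots> \<le> m / sqrt S" using S \<tau> m0 by (intro divide_left_mono) auto
    also have "\<dots> = (1 / sqrt V) * q"
    proof -
      have "m = q * sqrt x" unfolding m_def q_def using x by (simp add: powr_half_sqrt[symmetric] flip: powr_add)
      then show ?thesis using x V by (simp add: S_def real_sqrt_mult)
    qed
    finally have 1: "\<bar>Qfun (s / sqrt (\<tau> + S)) - Qfun (t / sqrt (\<tau> + S))\<bar> \<le> (1 / sqrt V) * q" .
    have "\<bar>Qfun (t / sqrt (\<tau> + S)) - Qfun (t / sqrt S)\<bar> \<le> (\<tau> + S - S) / S"
      by (rule Qfun_variance_lipschitz) (use S \<tau> in auto)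
    also have "\<dots> = (1 / V) * (x powr (1/2) / x powr 1)" using x V by (simp add: S_def \<tau>_def)
    also have "x powr (1/2) / x powr 1 = x powr (-1/2)" unfolding powr_diff[symmetric] by simp
    also have "(1 / V) * x powr (-1/2) \<le> (1 / V) * q" unfolding q_def using x V by (intro mult_left_mono powr_mono) auto
    finally show ?thesis using 1 by (simp add: algebra_simps)
  qed
  define P where "P = path_exp n k (\<lambda>zs. if psum d zs > t then 1 else 0)"
  have "P \<le> path_exp n k (\<lambda>zs. Qfun ((t - m - psum d zs) / sqrt \<tau>) + 2 * q)" unfolding P_def
  proof (rule path_exp_mono)
    fix zs
    have "1 \<le> Qfun ((t - m - psum d zs) / sqrt \<tau>) + 2 * q" if "psum d zs > t"
    proof -
      have "(t - m - psum d zs) / sqrt \<tau> \<le> - (m / sqrt \<tau>)" unfolding minus_divide_left using that \<tau> by (intro divide_right_mono) auto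
      then have "Qfun (- (m / sqrt \<tau>)) \<le> Qfun ((t - m - psum d zs) / sqrt \<tau>)" by (rule Qfun_antimono)
      then show ?thesis using tail by (simp add: Qfun_minus)
    qed
    then show "(if psum d zs > t then 1 else 0) \<le> Qfun ((t - m - psum d zs) / sqrt \<tau>) + 2 * q"
      using Qfun_nonneg by (auto simp: q_def)
  qed (rule stoch_kernel_nonneg[OF k])
  then have up: "P \<le> Qfun (t / sqrt S) + (2 + K + 1 / sqrt V + 1 / V) * q"
    unfolding path_exp_add path_exp_const[OF k] using heat[of "t - m"] shift[of "t - m"] m0
    by (simp add: algebra_simps)
  have "path_exp n k (\<lambda>zs. Qfun ((t + m - psum d zs) / sqrt \<tau>) + - (2 * q)) \<le> P" unfolding P_def
  proof (rule path_exp_mono)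
    fix zs
    have "Qfun ((t + m - psum d zs) / sqrt \<tau>) \<le> 2 * q" if "\<not> psum d zs > t"
    proof -
      have "m / sqrt \<tau> \<le> (t + m - psum d zs) / sqrt \<tau>" using that \<tau> by (intro divide_right_mono) auto
      then show ?thesis using Qfun_antimono tail by (meson order_trans)
    qed
    moreover have "Qfun ((t + m - psum d zs) / sqrt \<tau>) \<le> 1 + 2 * q"
      using Qfun_le_1[of "(t + m - psum d zs) / sqrt \<tau>"] by (simp add: q_def add_increasing2)
    ultimately show "Qfun ((t + m - psum d zs) / sqrt \<tau>) + - (2 * q) \<le> (if psum d zs > t then 1 else 0)"
      by auto
  qed (rule stoch_kernel_nonneg[OF k])
  then have "P \<ge> Qfun (t / sqrt S) - (2 + K + 1 / sqrt V + 1 / V) * q"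
    unfolding path_exp_add path_exp_const[OF k] using heat[of "t + m"] shift[of "t + m"] m0
    by (simp add: algebra_simps)
  with up show ?thesis unfolding P_def K_def S_def x_def q_def by (simp add: abs_le_iff)
qed

section \<open>Exponential concentration of bounded martingales\<close>

lemma exp_le_quadratic:
  fixes x :: real
  assumes "\<bar>x\<bar> \<le> 1" shows "exp x \<le> 1 + x + x\<^sup>2"
proof (cases "x \<ge> 0")
  case True
  then show ?thesis using exp_bound[of x] assms by simp
next
  case False
  define f where "f y = 1 + y + y\<^sup>2 - exp y" for y :: real
  have "f 0 \<le> f x"
  proof (rule DERIV_nonpos_imp_nonincreasing[of x 0 f])
    fix y :: real assume y: "x \<le> y" "y \<le> 0"
    have "(f has_real_derivative 1 + 2 * y - exp y) (at y)"
      unfolding f_def by (auto intro!: derivative_eq_intros)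
    moreover have "1 + 2 * y - exp y \<le> 0" using exp_ge_add_one_self[of y] y by linarith
    ultimately show "\<exists>z. (f has_real_derivative z) (at y) \<and> z \<le> 0" by blast
  qed (use False in auto)
  then show ?thesis by (simp add: f_def)
qed

text \<open>The bound on the increments may depend on time, so that increments vanishing outside one
  phase contribute only the length of that phase. The condition \<open>l * b i \<le> 1\<close> is
  what the quadratic bound on exp requires.\<close>

lemma path_exp_azuma:
  assumes k: "stoch_kernel k"
    and d: "\<And>zs z. length zs < n \<Longrightarrow> \<bar>d zs z\<bar> \<le> b (length zs)"
      "\<And>zs. length zs < n \<Longrightarrow> (\<Sum>z\<in>UNIV. k zs z * d zs z) = 0"
    and l: "0 \<le> l" "\<And>i. i < n \<Longrightarrow> l * b i \<le> 1"
  shows "path_exp n k (\<lambda>zs. exp (l * psum d zs)) \<le> exp (l\<^sup>2 * (\<Sum>i<n. (b i)\<^sup>2))"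
  using d l(2)
proof (induction n)
  case (Suc n)
  have "path_exp (Suc n) k (\<lambda>zs. exp (l * psum d zs)) \<le>
    path_exp n k (\<lambda>zs. exp (l\<^sup>2 * (b n)\<^sup>2) * exp (l * psum d zs))"
    unfolding path_exp.simps
  proof (rule path_exp_mono)
    fix zs :: "'a list" assume zs: "length zs = n"
    have "(\<Sum>z\<in>UNIV. k zs z * exp (l * d zs z)) \<le> (\<Sum>z\<in>UNIV. k zs z * (1 + l * d zs z + l\<^sup>2 * (b n)\<^sup>2))"
    proof (intro sum_mono mult_left_mono stoch_kernel_nonneg[OF k])
      fix z
      have dz: "\<bar>d zs z\<bar> \<le> b n" using Suc.prems(1)[of zs z] zs by simp
      have "\<bar>l * d zs z\<bar> \<le> l * b n" using dz l by (simp add: abs_mult mult_left_mono)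
      also have "\<dots> \<le> 1" using Suc.prems by simp
      finally have "exp (l * d zs z) \<le> 1 + l * d zs z + (l * d zs z)\<^sup>2" by (rule exp_le_quadratic)
      moreover have "(l * d zs z)\<^sup>2 \<le> l\<^sup>2 * (b n)\<^sup>2"
        unfolding power_mult_distrib using power_mono[OF dz, of 2] by (intro mult_left_mono) auto
      ultimately show "exp (l * d zs z) \<le> 1 + l * d zs z + l\<^sup>2 * (b n)\<^sup>2" by simp
    qed
    also have "\<dots> = (\<Sum>z\<in>UNIV. k zs z) * (1 + l\<^sup>2 * (b n)\<^sup>2) + l * (\<Sum>z\<in>UNIV. k zs z * d zs z)"
      by (simp add: sum_distrib_right sum_distrib_left sum.distrib algebra_simps)
    also have "\<dots> = 1 + l\<^sup>2 * (b n)\<^sup>2" using Suc.prems(2)[of zs] zs by (simp add: stoch_kernel_sum[OF k])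
    also have "\<dots> \<le> exp (l\<^sup>2 * (b n)\<^sup>2)" by (rule exp_ge_add_one_self)
    finally have "(\<Sum>z\<in>UNIV. k zs z * exp (l * d zs z)) * exp (l * psum d zs) \<le> exp (l\<^sup>2 * (b n)\<^sup>2) * exp (l * psum d zs)"
      by (intro mult_right_mono) auto
    moreover have "(\<Sum>z\<in>UNIV. k zs z * exp (l * psum d (zs @ [z]))) = (\<Sum>z\<in>UNIV. k zs z * exp (l * d zs z)) * exp (l * psum d zs)"
      by (simp add: distrib_left exp_add sum_distrib_left mult_ac)
    ultimately show "(\<Sum>z\<in>UNIV. k zs z * exp (l * psum d (zs @ [z]))) \<le> exp (l\<^sup>2 * (b n)\<^sup>2) * exp (l * psum d zs)"
      by simp
  qed (rule stoch_kernel_nonneg[OF k])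
  also have "\<dots> = exp (l\<^sup>2 * (b n)\<^sup>2) * path_exp n k (\<lambda>zs. exp (l * psum d zs))"
    by (rule path_exp_cmult)
  also have "\<dots> \<le> exp (l\<^sup>2 * (b n)\<^sup>2) * exp (l\<^sup>2 * (\<Sum>i<n. (b i)\<^sup>2))"
    by (intro mult_left_mono Suc.IH) (use Suc.prems in auto)
  also have "\<dots> = exp (l\<^sup>2 * (\<Sum>i<Suc n. (b i)\<^sup>2))" by (simp add: algebra_simps flip: exp_add)
  finally show ?case .
qed simp

lemma path_exp_azuma_tail:
  assumes k: "stoch_kernel k"
    and d: "\<And>zs z. length zs < n \<Longrightarrow> \<bar>d zs z\<bar> \<le> (if length zs \<in> I then c else 0)"
      "\<And>zs. length zs < n \<Longrightarrow> (\<Sum>z\<in>UNIV. k zs z * d zs z) = 0"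
    and c: "c > 0" and I: "finite I" "real (card I) \<le> N" and q: "q \<ge> 1" "ln q \<le> N" and N: "N > 0"
  shows "path_exp n k (\<lambda>zs. if psum d zs \<ge> 2 * c * sqrt (N * ln q) then 1 else 0) \<le> 1 / q"
proof -
  \<comment> \<open>This \<open>l\<close> makes the variance term at most ln q, while
    \<open>l * a\<close> equals 2 ln q; the condition \<open>ln q \<le> N\<close> keeps
    \<open>l * c\<close> at most 1.\<close>
  define l where "l = sqrt (ln q / N) / c"
  define a where "a = 2 * c * sqrt (N * ln q)"
  define b where "b i = (if i \<in> I then c else 0)" for i :: nat
  have lc: "l * c = sqrt (ln q / N)" using c by (simp add: l_def)
  have l0: "l \<ge> 0" using c q N by (simp add: l_def)
  have "l * c \<le> 1" unfolding lc using q N by simp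
  then have lb: "l * b i \<le> 1" for i by (simp add: b_def)
  have la: "l * a = 2 * ln q"
  proof -
    have "l * a = 2 * (sqrt (ln q / N) * sqrt (N * ln q))" using lc by (simp add: a_def)
    also have "sqrt (ln q / N) * sqrt (N * ln q) = sqrt ((ln q)\<^sup>2)"
      unfolding real_sqrt_mult[symmetric] using N by (simp add: power2_eq_square)
    finally show ?thesis using q by simp
  qed
  have "(\<Sum>i<n. (b i)\<^sup>2) \<le> N * c\<^sup>2"
  proof -
    have "(\<Sum>i<n. (b i)\<^sup>2) = (\<Sum>i\<in>{..<n} \<inter> I. c\<^sup>2)"
      unfolding b_def by (subst sum.inter_restrict) (auto intro!: sum.cong)
    also have "\<dots> = real (card ({..<n} \<inter> I)) * c\<^sup>2" by simp
    also have "\<dots> \<le> real (card I) * c\<^sup>2" using I by (intro mult_right_mono) (auto intro!: card_mono)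
    also have "\<dots> \<le> N * c\<^sup>2" using I by (intro mult_right_mono) auto
    finally show ?thesis .
  qed
  then have "l\<^sup>2 * (\<Sum>i<n. (b i)\<^sup>2) \<le> (l * c)\<^sup>2 * N"
    by (auto simp: power_mult_distrib mult_ac dest: mult_left_mono[of _ _ "l\<^sup>2"])
  also have "\<dots> = ln q" unfolding lc using q N by simp
  finally have e: "exp (l\<^sup>2 * (\<Sum>i<n. (b i)\<^sup>2)) \<le> q" using q by (simp add: ln_ge_iff)
  have "path_exp n k (\<lambda>zs. if psum d zs \<ge> a then 1 else 0) \<le> path_exp n k (\<lambda>zs. exp (- (l * a)) * exp (l * psum d zs))"
  proof (rule path_exp_mono)
    fix zs
    have "1 \<le> exp (- (l * a)) * exp (l * psum d zs)" if "psum d zs \<ge> a"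
      unfolding exp_add[symmetric] using mult_left_mono[OF that l0] by simp
    then show "(if psum d zs \<ge> a then 1 else 0) \<le> exp (- (l * a)) * exp (l * psum d zs)" by simp
  qed (rule stoch_kernel_nonneg[OF k])
  also have "\<dots> = exp (- (l * a)) * path_exp n k (\<lambda>zs. exp (l * psum d zs))" by (rule path_exp_cmult)
  also have "\<dots> \<le> exp (- (l * a)) * exp (l\<^sup>2 * (\<Sum>i<n. (b i)\<^sup>2))"
    by (intro mult_left_mono path_exp_azuma[OF k _ d(2) l0 lb]) (use d(1) in \<open>auto simp: b_def\<close>)
  also have "\<dots> \<le> exp (- (l * a)) * q" by (intro mult_left_mono e) auto
  also have "exp (- (l * a)) = inverse (q\<^sup>2)"
    using q exp_double[of "ln q"] unfolding la by (simp only: exp_minus) simp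
  also have "inverse (q\<^sup>2) * q = 1 / q" using q by (simp add: power2_eq_square field_simps)
  finally show ?thesis unfolding a_def .
qed

section \<open>Information quantities at the optimal input distribution\<close>

lemma KL_eq: "KL p q = (\<Sum>y\<in>UNIV. p y * ln (p y / q y))"
  unfolding KL_def by (intro sum.cong) auto

lemma is_dist_outd: "is_dist P \<Longrightarrow> is_channel W \<Longrightarrow> is_dist (outd P W)"
proof -
  assume P: "is_dist P" and W: "is_channel W"
  have "(\<Sum>y\<in>UNIV. outd P W y) = (\<Sum>x\<in>UNIV. \<Sum>y\<in>UNIV. P x * W x y)"
    unfolding outd_def by (rule sum.swap)
  also have "\<dots> = 1" using P W by (simp flip: sum_distrib_left add: is_channel_def is_dist_def)
  finally show ?thesis using P W by (auto simp: is_dist_def is_channel_def outd_def intro!: sum_nonneg)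
qed

lemma outd_pos:
  assumes "is_channel W" "\<And>x. 0 \<le> P x" "0 < P x" "0 < W x y"
  shows "0 < outd P W y"
proof -
  have "P x * W x y \<le> outd P W y"
    unfolding outd_def using assms by (intro member_le_sum) (auto simp: is_channel_def)
  then show ?thesis using assms by (smt (verit) mult_pos_pos)
qed

lemma KL_nonneg:
  assumes p: "is_dist p" and q: "is_dist q" and pq: "\<And>y. q y = 0 \<Longrightarrow> p y = 0"
  shows "0 \<le> KL p q"
proof -
  have "p y - q y \<le> p y * ln (p y / q y)" for y
  proof (cases "p y = 0")
    case False
    then have pos: "p y > 0" "q y > 0" using p q pq[of y] by (auto simp: is_dist_def order.strict_iff_order)
    have "ln (q y / p y) \<le> q y / p y - 1" using pos by (intro ln_le_minus_one) auto
    then have "p y * ln (q y / p y) \<le> p y * (q y / p y - 1)" using pos by (intro mult_left_mono) auto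
    also have "\<dots> = q y - p y" using pos by (simp add: field_simps)
    finally show ?thesis using pos by (simp add: ln_div right_diff_distrib)
  qed (use q in \<open>auto simp: is_dist_def\<close>)
  then have "(\<Sum>y\<in>UNIV. p y - q y) \<le> KL p q" unfolding KL_eq by (intro sum_mono)
  then show ?thesis using p q by (simp add: sum_subtractf is_dist_def)
qed

text \<open>Bounding ln z by z - 1 at z = p/q leaves (p - q)^2 / q + (p - q), and the linear part
  sums to 0. Hence the output divergence caused by a tilt is quadratic in its size.\<close>

lemma KL_le_chi_square:
  assumes p: "is_dist p" and q: "is_dist q" and pq: "\<And>y. q y = 0 \<Longrightarrow> p y = 0"
  shows "KL p q \<le> (\<Sum>y\<in>UNIV. (p y - q y)\<^sup>2 / q y)"
proof -
  have "p y * ln (p y / q y) \<le> (p y - q y)\<^sup>2 / q y + (p y - q y)" for y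
  proof (cases "q y = 0")
    case False
    then have qp: "q y > 0" using q by (auto simp: is_dist_def order.strict_iff_order)
    have p0: "p y \<ge> 0" using p by (simp add: is_dist_def)
    have "p y * ln (p y / q y) \<le> p y * (p y / q y - 1)"
    proof (cases "p y = 0")
      case False
      then show ?thesis using p0 qp by (intro mult_left_mono ln_le_minus_one) auto
    qed simp
    also have "\<dots> = (p y - q y)\<^sup>2 / q y + (p y - q y)" using qp by (simp add: field_simps power2_eq_square)
    finally show ?thesis .
  qed (use pq in auto)
  then have "KL p q \<le> (\<Sum>y\<in>UNIV. (p y - q y)\<^sup>2 / q y + (p y - q y))"
    unfolding KL_eq by (intro sum_mono)
  then show ?thesis using p q by (simp add: sum.distrib sum_subtractf is_dist_def)
qed

text \<open>Replacing the output law of \<open>P\<close> by that of a fixed \<open>R\<close> leaves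
  an expression linear in \<open>P\<close>; all the nonlinearity sits in one divergence, which can
  be bounded from either side.\<close>

lemma mutual_info_golden_formula:
  assumes W: "is_channel W" and P: "is_dist P" and R: "\<And>x. R x > 0"
  shows "mutual_info P W = (\<Sum>x\<in>UNIV. P x * KL (W x) (outd R W)) - KL (outd P W) (outd R W)"
proof -
  have summand: "P x * (W x y * ln (W x y / outd P W y)) =
     P x * (W x y * ln (W x y / outd R W y)) - P x * W x y * ln (outd P W y / outd R W y)" for x y
  proof (cases "P x = 0 \<or> W x y = 0")
    case False
    then have pos: "P x > 0" "W x y > 0" using P W by (auto simp: is_dist_def is_channel_def order.strict_iff_order)
    have "outd P W y > 0" using outd_pos[of W P x y] W P pos by (auto simp: is_dist_def)
    moreover have "outd R W y > 0" using outd_pos[of W R x y] W R pos by (auto simp: less_imp_le)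
    ultimately show ?thesis using pos by (simp add: ln_div algebra_simps)
  qed auto
  have "mutual_info P W = (\<Sum>x\<in>UNIV. \<Sum>y\<in>UNIV. P x * (W x y * ln (W x y / outd P W y)))"
    by (simp add: mutual_info_def KL_eq sum_distrib_left)
  also have "\<dots> = (\<Sum>x\<in>UNIV. \<Sum>y\<in>UNIV. P x * (W x y * ln (W x y / outd R W y))) -
     (\<Sum>x\<in>UNIV. \<Sum>y\<in>UNIV. P x * W x y * ln (outd P W y / outd R W y))"
    by (simp only: summand sum_subtractf)
  also have "(\<Sum>x\<in>UNIV. \<Sum>y\<in>UNIV. P x * W x y * ln (outd P W y / outd R W y)) = KL (outd P W) (outd R W)"
    by (subst sum.swap) (simp add: KL_eq outd_def flip: sum_distrib_right)
  finally show ?thesis by (simp add: KL_eq sum_distrib_left)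
qed

lemma outd_zero_imp:
  assumes W: "is_channel W" and R: "\<And>x. R x > 0" and "outd R W y = 0"
  shows "W x y = 0"
proof (rule ccontr)
  assume "W x y \<noteq> 0"
  then have "W x y > 0" using W by (auto simp: is_channel_def order.strict_iff_order)
  then have "outd R W y > 0" using outd_pos[of W R x y] W R by (auto simp: less_imp_le)
  then show False using assms by simp
qed

lemma outd_add_scaled: "outd (\<lambda>x. R x + s * v x) W y = outd R W y + s * outd v W y"
  by (simp add: outd_def sum.distrib sum_distrib_left algebra_simps)

lemma mutual_info_quadratic_lower_bound:
  assumes W: "is_channel W" and R: "is_dist R" "\<And>x. R x > 0" and P: "is_dist (\<lambda>x. R x + s * v x)"
  shows "mutual_info (\<lambda>x. R x + s * v x) W \<ge> mutual_info R W + s * dI W R v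
     - s\<^sup>2 * (\<Sum>y\<in>UNIV. (outd v W y)\<^sup>2 / outd R W y)"
proof -
  have "KL (outd (\<lambda>x. R x + s * v x) W) (outd R W) \<le>
      (\<Sum>y\<in>UNIV. (outd (\<lambda>x. R x + s * v x) W y - outd R W y)\<^sup>2 / outd R W y)"
    by (rule KL_le_chi_square[OF is_dist_outd[OF P W] is_dist_outd[OF R(1) W]])
       (simp add: outd_def outd_zero_imp[OF W R(2)])
  also have "\<dots> = s\<^sup>2 * (\<Sum>y\<in>UNIV. (outd v W y)\<^sup>2 / outd R W y)"
    by (simp add: outd_add_scaled power_mult_distrib sum_distrib_left)
  finally have "KL (outd (\<lambda>x. R x + s * v x) W) (outd R W) \<le> s\<^sup>2 * (\<Sum>y\<in>UNIV. (outd v W y)\<^sup>2 / outd R W y)" .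
  moreover have "(\<Sum>x\<in>UNIV. (R x + s * v x) * KL (W x) (outd R W)) = mutual_info R W + s * dI W R v"
    by (simp add: mutual_info_def dI_def sum.distrib sum_distrib_left algebra_simps)
  ultimately show ?thesis using mutual_info_golden_formula[OF W P, of R] R(2) by simp
qed

text \<open>This is the gradient inequality of a concave function: the divergence in the golden
  formula is nonnegative and may be dropped.\<close>

lemma dI_ge_mutual_info_diff:
  assumes W: "is_channel W" and R: "is_dist R" "\<And>x. R x > 0" and P: "is_dist P"
  shows "dI W R (\<lambda>x. P x - R x) \<ge> mutual_info P W - mutual_info R W"
proof -
  have "KL (outd P W) (outd R W) \<ge> 0"
    by (rule KL_nonneg[OF is_dist_outd[OF P W] is_dist_outd[OF R(1) W]])
       (simp add: outd_def outd_zero_imp[OF W R(2)])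
  moreover have "dI W R (\<lambda>x. P x - R x) = (\<Sum>x\<in>UNIV. P x * KL (W x) (outd R W)) - mutual_info R W"
    by (simp add: dI_def mutual_info_def sum_subtractf algebra_simps)
  ultimately show ?thesis using mutual_info_golden_formula[OF W P, of R] R(2) by simp
qed

lemma mean_info_dens: "(\<Sum>y\<in>UNIV. W x y * info_dens P W x y) = KL (W x) (outd P W)"
  by (simp add: KL_eq info_dens_def)

lemma cond_var_eq: "cond_var P W x = (\<Sum>y\<in>UNIV. W x y * (info_dens P W x y - KL (W x) (outd P W))\<^sup>2)"
  unfolding cond_var_def by (intro sum.cong) auto

lemma sum_product_mean:
  fixes w1 a :: "'y::finite \<Rightarrow> real" and w2 b :: "'y \<Rightarrow> real"
  assumes "(\<Sum>y\<in>UNIV. w1 y) = 1" "(\<Sum>y\<in>UNIV. w2 y) = 1"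
  shows "(\<Sum>y1\<in>UNIV. \<Sum>y2\<in>UNIV. w1 y1 * w2 y2 * (a y1 + b y2)) = (\<Sum>y\<in>UNIV. w1 y * a y) + (\<Sum>y\<in>UNIV. w2 y * b y)"
proof -
  have "(\<Sum>y2\<in>UNIV. w1 y1 * w2 y2 * (a y1 + b y2)) = w1 y1 * a y1 + w1 y1 * (\<Sum>y2\<in>UNIV. w2 y2 * b y2)" for y1
  proof -
    have "(\<Sum>y2\<in>UNIV. w1 y1 * w2 y2 * (a y1 + b y2)) = (\<Sum>y2\<in>UNIV. w2 y2) * (w1 y1 * a y1) + w1 y1 * (\<Sum>y2\<in>UNIV. w2 y2 * b y2)"
      unfolding sum_distrib_left sum_distrib_right sum.distrib[symmetric] by (intro sum.cong) (auto simp: algebra_simps)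
    then show ?thesis using assms by simp
  qed
  then show ?thesis using assms by (simp add: sum.distrib flip: sum_distrib_right)
qed

lemma sum_product_variance:
  fixes w1 a :: "'y::finite \<Rightarrow> real" and w2 b :: "'y \<Rightarrow> real"
  assumes w: "(\<Sum>y\<in>UNIV. w1 y) = 1" "(\<Sum>y\<in>UNIV. w2 y) = 1"
    and "(\<Sum>y\<in>UNIV. w1 y * a y) = 0"
  shows "(\<Sum>y1\<in>UNIV. \<Sum>y2\<in>UNIV. w1 y1 * w2 y2 * (a y1 + b y2)\<^sup>2) = (\<Sum>y\<in>UNIV. w1 y * (a y)\<^sup>2) + (\<Sum>y\<in>UNIV. w2 y * (b y)\<^sup>2)"
proof -
  have "(\<Sum>y1\<in>UNIV. \<Sum>y2\<in>UNIV. w1 y1 * w2 y2 * (a y1 + b y2)\<^sup>2) =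
     (\<Sum>y1\<in>UNIV. \<Sum>y2\<in>UNIV. w1 y1 * w2 y2 * ((a y1)\<^sup>2 + (b y2)\<^sup>2) + (w1 y1 * a y1) * (2 * w2 y2 * b y2))"
    by (intro sum.cong) (auto simp: power2_eq_square algebra_simps)
  also have "\<dots> = (\<Sum>y1\<in>UNIV. \<Sum>y2\<in>UNIV. w1 y1 * w2 y2 * ((a y1)\<^sup>2 + (b y2)\<^sup>2)) +
     (\<Sum>y1\<in>UNIV. w1 y1 * a y1) * (\<Sum>y2\<in>UNIV. 2 * w2 y2 * b y2)"
    by (simp add: sum.distrib sum_product)
  finally show ?thesis using assms sum_product_mean[OF w, of "\<lambda>y. (a y)\<^sup>2" "\<lambda>y. (b y)\<^sup>2"] by simp
qed

lemma info_dens_bounded: "\<exists>b>0. \<forall>x y. \<bar>info_dens P W (x::'x::finite) (y::'y::finite)\<bar> \<le> b"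
proof (intro exI conjI allI)
  define b where "b = (\<Sum>x\<in>UNIV. \<Sum>y\<in>UNIV. \<bar>info_dens P W x y\<bar>)"
  have "b \<ge> 0" unfolding b_def by (intro sum_nonneg) auto
  then show "b + 1 > 0" by simp
  fix x y
  have "\<bar>info_dens P W x y\<bar> \<le> (\<Sum>y\<in>UNIV. \<bar>info_dens P W x y\<bar>)" by (rule member_le_sum) auto
  also have "\<dots> \<le> b" unfolding b_def by (rule member_le_sum) (auto intro: sum_nonneg)
  finally show "\<bar>info_dens P W x y\<bar> \<le> b + 1" by simp
qed

text \<open>Output laws within a factor 2 of each other change the logarithm by at most ln 2. One
  bound on the densities thus serves all tilts of the input law; where \<open>W x y = 0\<close> both
  densities are ln 0 = 0.\<close>

lemma info_dens_comparable:
  assumes W: "is_channel W" and R: "\<And>x. R x > 0" and P: "\<And>x. R x / 2 \<le> P x" "\<And>x. P x \<le> 2 * R x"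
  shows "\<bar>info_dens P W x y\<bar> \<le> \<bar>info_dens R W x y\<bar> + 1"
proof (cases "W x y = 0")
  case False
  then have w: "W x y > 0" using W by (auto simp: is_channel_def order.strict_iff_order)
  have r: "outd R W y > 0" using outd_pos[of W R x y] W R w by (auto simp: less_imp_le)
  have W0: "W x y \<ge> 0" for x y using W by (simp add: is_channel_def)
  have 1: "outd R W y / 2 \<le> outd P W y"
    unfolding outd_def sum_divide_distrib using mult_right_mono[OF P(1) W0] by (intro sum_mono) simp
  have 2: "outd P W y \<le> 2 * outd R W y"
    unfolding outd_def sum_distrib_left using mult_right_mono[OF P(2) W0] by (intro sum_mono) (simp add: mult.assoc)
  have p: "outd P W y > 0" using 1 r by linarith
  have l2: "ln 2 \<le> (1::real)" using ln_le_minus_one[of "2::real"] by simp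
  have "ln (outd P W y) \<le> ln (2 * outd R W y)" using 2 p by simp
  then have "ln (outd P W y) \<le> ln 2 + ln (outd R W y)" using r by (simp add: ln_mult)
  moreover have "ln (outd R W y / 2) \<le> ln (outd P W y)" using 1 r p by simp
  then have "ln (outd R W y) - ln 2 \<le> ln (outd P W y)" using r by (simp add: ln_div)
  ultimately show ?thesis using l2 w r p by (simp add: info_dens_def ln_div)
qed (simp add: info_dens_def)

section \<open>First-order optimality at the maximizer and the weight \<eta>\<close>

locale cm_dmbc =
  fixes W1 W2 :: "'x::finite \<Rightarrow> 'y::finite \<Rightarrow> real" and Pstar :: "'x \<Rightarrow> real"
  assumes W1: "is_channel W1" and W2: "is_channel W2"
    and Pstar_dist: "is_dist Pstar"
    and Pstar_max: "\<And>P. is_dist P \<Longrightarrow>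
          min (mutual_info P W1) (mutual_info P W2) \<le> min (mutual_info Pstar W1) (mutual_info Pstar W2)"
    and Pstar_pos: "\<And>x. Pstar x > 0"
    and V1_pos: "disp Pstar W1 > 0" and V2_pos: "disp Pstar W2 > 0"
    and C1_gt: "single_cap W1 > common_cap W1 W2"
    and C2_gt: "single_cap W2 > common_cap W1 W2"
    and var_const: "\<And>x. (eta_const W1 W2 Pstar)\<^sup>2 * cond_var Pstar W1 x
          + (1 - eta_const W1 W2 Pstar)\<^sup>2 * cond_var Pstar W2 x
        = (eta_const W1 W2 Pstar)\<^sup>2 * disp Pstar W1 + (1 - eta_const W1 W2 Pstar)\<^sup>2 * disp Pstar W2"
begin

definition "C = common_cap W1 W2"
definition "\<eta> = eta_const W1 W2 Pstar"
definition "V = \<eta>\<^sup>2 * disp Pstar W1 + (1 - \<eta>)\<^sup>2 * disp Pstar W2"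

lemma C_eq_min: "C = min (mutual_info Pstar W1) (mutual_info Pstar W2)"
  unfolding C_def common_cap_def by (rule cSup_eq_maximum) (use Pstar_dist Pstar_max in auto)

lemma ex_dist_gt:
  fixes W :: "'x \<Rightarrow> 'y \<Rightarrow> real"
  assumes "single_cap W > C"
  shows "\<exists>P. is_dist P \<and> mutual_info P W > C"
proof (rule ccontr)
  assume "\<not> ?thesis"
  then have "single_cap W \<le> C" unfolding single_cap_def
    by (intro cSUP_least) (use Pstar_dist in \<open>auto simp: not_less\<close>)
  then show False using assms by simp
qed

text \<open>For a receiver with slack this is continuity; for a receiver exactly at \<open>C\<close>
  the linear gain along \<open>v\<close> beats the quadratic loss when \<open>t\<close> is
  small.\<close>

lemma eventually_improves:
  assumes W: "is_channel W" and v: "(\<Sum>x\<in>UNIV. v x) = 0"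
    and imp: "mutual_info Pstar W > C \<or> mutual_info Pstar W = C \<and> dI W Pstar v > 0"
  shows "\<forall>\<^sub>F t in at_right 0. is_dist (\<lambda>x. Pstar x + t * v x) \<and> mutual_info (\<lambda>x. Pstar x + t * v x) W > C"
proof -
  have "\<forall>\<^sub>F t in at_right 0. \<forall>x\<in>UNIV. Pstar x + t * v x > 0"
  proof (rule eventually_ball_finite)
    show "\<forall>x\<in>UNIV. \<forall>\<^sub>F t in at_right 0. Pstar x + t * v x > 0"
    proof
      fix x
      have "((\<lambda>t. Pstar x + t * v x) \<longlongrightarrow> Pstar x + 0 * v x) (at_right 0)" by (intro tendsto_intros)
      then show "\<forall>\<^sub>F t in at_right 0. Pstar x + t * v x > 0" by (rule order_tendstoD) (simp add: Pstar_pos)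
    qed
  qed simp
  then have dist: "\<forall>\<^sub>F t in at_right 0. is_dist (\<lambda>x. Pstar x + t * v x)"
    by eventually_elim (use Pstar_dist v in \<open>auto simp: is_dist_def sum.distrib less_imp_le simp flip: sum_distrib_left\<close>)
  define chi2 where "chi2 = (\<Sum>y\<in>UNIV. (outd v W y)\<^sup>2 / outd Pstar W y)"
  have "\<forall>\<^sub>F t in at_right 0. mutual_info Pstar W + t * dI W Pstar v - t\<^sup>2 * chi2 > C"
    using imp
  proof
    assume A: "mutual_info Pstar W > C"
    have "((\<lambda>t. mutual_info Pstar W + t * dI W Pstar v - t\<^sup>2 * chi2) \<longlongrightarrow> mutual_info Pstar W + 0 * dI W Pstar v - 0\<^sup>2 * chi2) (at_right 0)"
      by (intro tendsto_intros)
    then show ?thesis by (rule order_tendstoD) (simp add: A)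
  next
    assume A: "mutual_info Pstar W = C \<and> dI W Pstar v > 0"
    have "((\<lambda>t. dI W Pstar v - t * chi2) \<longlongrightarrow> dI W Pstar v - 0 * chi2) (at_right 0)" by (intro tendsto_intros)
    then have "\<forall>\<^sub>F t in at_right 0. dI W Pstar v - t * chi2 > 0" by (rule order_tendstoD) (simp add: A)
    moreover have "\<forall>\<^sub>F t in at_right (0::real). t > 0" by (rule eventually_at_right_less)
    ultimately show ?thesis
    proof eventually_elim
      case (elim t)
      then have "t * (dI W Pstar v - t * chi2) > 0" by simp
      then show ?case using A by (simp add: algebra_simps power2_eq_square)
    qed
  qed
  with dist show ?thesis
  proof eventually_elim
    case (elim t)
    then show ?case using mutual_info_quadratic_lower_bound[OF W Pstar_dist Pstar_pos, of t v] unfolding chi2_def by linarith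
  qed
qed

lemma no_common_ascent:
  assumes v: "(\<Sum>x\<in>UNIV. v x) = 0"
    and "mutual_info Pstar W1 > C \<or> mutual_info Pstar W1 = C \<and> dI W1 Pstar v > 0"
    and "mutual_info Pstar W2 > C \<or> mutual_info Pstar W2 = C \<and> dI W2 Pstar v > 0"
  shows False
proof -
  have "\<forall>\<^sub>F t in at_right (0::real). False"
    using eventually_improves[OF W1 v assms(2)] eventually_improves[OF W2 v assms(3)]
  proof eventually_elim
    case (elim t)
    then have "min (mutual_info (\<lambda>x. Pstar x + t * v x) W1) (mutual_info (\<lambda>x. Pstar x + t * v x) W2) > C" by simp
    moreover have "min (mutual_info (\<lambda>x. Pstar x + t * v x) W1) (mutual_info (\<lambda>x. Pstar x + t * v x) W2) \<le> C"
      unfolding C_eq_min by (rule Pstar_max) (use elim in auto)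
    ultimately show False by linarith
  qed
  then show False using trivial_limit_at_right_real[of "0::real"] by (simp add: trivial_limit_def)
qed

lemma ex_ascent:
  fixes W :: "'x \<Rightarrow> 'y \<Rightarrow> real"
  assumes W: "is_channel W" and gt: "single_cap W > C" and eq: "mutual_info Pstar W = C"
  shows "\<exists>v. (\<Sum>x\<in>UNIV. v x) = 0 \<and> dI W Pstar v > 0"
proof -
  obtain P where P: "is_dist P" "mutual_info P W > C" using ex_dist_gt[OF gt] by blast
  have "dI W Pstar (\<lambda>x. P x - Pstar x) > 0"
    using dI_ge_mutual_info_diff[OF W Pstar_dist Pstar_pos P(1)] P(2) eq by simp
  moreover have "(\<Sum>x\<in>UNIV. P x - Pstar x) = 0" using P Pstar_dist by (simp add: sum_subtractf is_dist_def)
  ultimately show ?thesis by blast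
qed

text \<open>A receiver strictly above \<open>C\<close> could afford a small move along an ascent
  direction of the other one, which exists because that receiver's own capacity exceeds
  \<open>C\<close>; both would then exceed the maximum.\<close>

lemma mutual_info_Pstar: "mutual_info Pstar W1 = C" "mutual_info Pstar W2 = C"
proof -
  have "mutual_info Pstar W1 \<ge> C" "mutual_info Pstar W2 \<ge> C" by (auto simp: C_eq_min)
  moreover have "mutual_info Pstar W1 = C \<or> mutual_info Pstar W2 = C" by (auto simp: C_eq_min min_def)
  moreover have False if "mutual_info Pstar W1 = C" "mutual_info Pstar W2 > C"
    using ex_ascent[OF W1 C1_gt[folded C_def] that(1)] no_common_ascent that by blast
  moreover have False if "mutual_info Pstar W2 = C" "mutual_info Pstar W1 > C"
    using ex_ascent[OF W2 C2_gt[folded C_def] that(1)] no_common_ascent that by blast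
  ultimately have "mutual_info Pstar W1 = C \<and> mutual_info Pstar W2 = C" by (metis order.order_iff_strict)
  then show "mutual_info Pstar W1 = C" "mutual_info Pstar W2 = C" by auto
qed

lemma dI_linear: "dI W Pstar (\<lambda>x. a * u x + b * v x) = a * dI W Pstar u + b * dI W Pstar v"
  by (simp add: dI_def sum.distrib sum_distrib_left algebra_simps)

lemma not_both_positive:
  assumes "(\<Sum>x\<in>UNIV. v x) = 0" "dI W1 Pstar v > 0" shows "dI W2 Pstar v \<le> 0"
  using no_common_ascent[OF assms(1)] assms(2) mutual_info_Pstar by force

text \<open>Two linear functionals on the zero-sum vectors that each take positive values, but are
  never positive together, must be negative multiples of one another.\<close>

lemma ex_steering_ratio:
  "\<exists>u c. c > 0 \<and> (\<Sum>x\<in>UNIV. u x) = 0 \<and> dI W1 Pstar u > 0 \<and>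
     (\<forall>v. (\<Sum>x\<in>UNIV. v x) = 0 \<longrightarrow> dI W2 Pstar v = - c * dI W1 Pstar v)"
proof -
  obtain u where u: "(\<Sum>x\<in>UNIV. u x) = 0" "dI W1 Pstar u > 0"
    using ex_ascent[OF W1 C1_gt[folded C_def] mutual_info_Pstar(1)] by blast
  obtain w where w: "(\<Sum>x\<in>UNIV. w x) = 0" "dI W2 Pstar w > 0"
    using ex_ascent[OF W2 C2_gt[folded C_def] mutual_info_Pstar(2)] by blast
  have ker: "dI W2 Pstar v \<le> 0" if v: "(\<Sum>x\<in>UNIV. v x) = 0" "dI W1 Pstar v = 0" for v
  proof (rule ccontr)
    assume "\<not> dI W2 Pstar v \<le> 0"
    then have pos: "dI W2 Pstar v > 0" by simp
    \<comment> \<open>Adding this multiple of \<open>v\<close> to \<open>u\<close> keeps the first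
      derivative positive and lifts the second to at least 1, against
      \<open>not_both_positive\<close>.\<close>
    define K where "K = (1 + \<bar>dI W2 Pstar u\<bar>) / dI W2 Pstar v"
    have "dI W2 Pstar (\<lambda>x. 1 * u x + K * v x) > 0"
      unfolding dI_linear using pos by (simp add: K_def)
    moreover have "dI W1 Pstar (\<lambda>x. 1 * u x + K * v x) > 0" unfolding dI_linear using u v by simp
    moreover have "(\<Sum>x\<in>UNIV. 1 * u x + K * v x) = 0" using u v by (simp add: sum.distrib flip: sum_distrib_left)
    ultimately show False using not_both_positive[of "\<lambda>x. 1 * u x + K * v x"] by simp
  qed
  define c where "c = - dI W2 Pstar u / dI W1 Pstar u"
  have ratio: "dI W2 Pstar v = - c * dI W1 Pstar v" if v: "(\<Sum>x\<in>UNIV. v x) = 0" for v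
  proof -
    define a where "a = dI W1 Pstar v / dI W1 Pstar u"
    have a: "dI W1 Pstar v = a * dI W1 Pstar u" using u by (simp add: a_def)
    have "dI W2 Pstar (\<lambda>x. 1 * v x + (- a) * u x) \<le> 0"
    proof (rule ker)
      show "(\<Sum>x\<in>UNIV. 1 * v x + - a * u x) = 0" using u v by (simp add: sum.distrib sum_subtractf flip: sum_distrib_left)
      show "dI W1 Pstar (\<lambda>x. 1 * v x + - a * u x) = 0" unfolding dI_linear using a by simp
    qed
    moreover have "dI W2 Pstar (\<lambda>x. (- 1) * v x + a * u x) \<le> 0"
    proof (rule ker)
      show "(\<Sum>x\<in>UNIV. - 1 * v x + a * u x) = 0" using u v by (simp add: sum.distrib sum_subtractf flip: sum_distrib_left)
      show "dI W1 Pstar (\<lambda>x. - 1 * v x + a * u x) = 0" unfolding dI_linear using a by simp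
    qed
    ultimately have "dI W2 Pstar v = a * dI W2 Pstar u" unfolding dI_linear by linarith
    then show ?thesis using u by (simp add: a_def c_def)
  qed
  have "c \<noteq> 0" using ratio[OF w(1)] w(2) by auto
  moreover have "c \<ge> 0" using not_both_positive[OF u] u by (simp add: c_def divide_nonpos_pos)
  ultimately have "c > 0" by simp
  with u ratio show ?thesis by blast
qed

lemma eta: "0 < \<eta>" "\<eta> < 1"
    "(\<Sum>x\<in>UNIV. v x) = 0 \<Longrightarrow> \<eta> * dI W1 Pstar v + (1 - \<eta>) * dI W2 Pstar v = 0"
proof -
  obtain u c where u: "c > 0" "(\<Sum>x\<in>UNIV. u x) = 0" "dI W1 Pstar u > 0"
     "\<And>v. (\<Sum>x\<in>UNIV. v x) = 0 \<Longrightarrow> dI W2 Pstar v = - c * dI W1 Pstar v"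
    using ex_steering_ratio by blast
  \<comment> \<open>The solution of e = (1 - e) c, forced by the ratio -c of the two
    derivatives.\<close>
  define e where "e = c / (1 + c)"
  let ?P = "\<lambda>e. 0 < e \<and> e < 1 \<and>
      (\<forall>v::'x \<Rightarrow> real. (\<Sum>x\<in>UNIV. v x) = 0 \<longrightarrow> e * dI W1 Pstar v + (1 - e) * dI W2 Pstar v = 0)"
  have e1: "1 - e = 1 / (1 + c)" using u(1) by (simp add: e_def field_simps)
  have "?P (THE e. ?P e)"
  proof (rule theI[of ?P e])
    show "?P e"
    proof (intro conjI allI impI)
      show "0 < e" "e < 1" using u(1) by (auto simp: e_def)
      fix v :: "'x \<Rightarrow> real" assume "(\<Sum>x\<in>UNIV. v x) = 0"
      then show "e * dI W1 Pstar v + (1 - e) * dI W2 Pstar v = 0"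
        using u(1) unfolding e1 by (simp add: e_def u(4))
    qed
  next
    fix e' assume "?P e'"
    then have "e' * dI W1 Pstar u + (1 - e') * (- c * dI W1 Pstar u) = 0" using u(2) u(4)[OF u(2)] by force
    then have "(e' * (1 + c) - c) * dI W1 Pstar u = 0" by (simp add: algebra_simps)
    then have "e' * (1 + c) = c" using u(3) by simp
    then show "e' = e" using u(1) by (simp add: e_def field_simps)
  qed
  then show "0 < \<eta>" "\<eta> < 1"
    "(\<Sum>x\<in>UNIV. v x) = 0 \<Longrightarrow> \<eta> * dI W1 Pstar v + (1 - \<eta>) * dI W2 Pstar v = 0"
    unfolding \<eta>_def eta_const_def by blast+
qed

text \<open>The scaling makes a tilt of size s raise the difference of the two informations by s to
  first order, while their weighted sum stays put.\<close>

lemma ex_steering: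
  "\<exists>v. (\<Sum>x\<in>UNIV. v x) = 0 \<and> dI W1 Pstar v = 1 - \<eta> \<and> dI W2 Pstar v = - \<eta>"
proof -
  obtain u where u: "(\<Sum>x\<in>UNIV. u x) = 0" "dI W1 Pstar u > 0"
    using ex_ascent[OF W1 C1_gt[folded C_def] mutual_info_Pstar(1)] by blast
  define a where "a = (1 - \<eta>) / dI W1 Pstar u"
  define v where "v = (\<lambda>x. a * u x + 0 * u x)"
  have v0: "(\<Sum>x\<in>UNIV. v x) = 0" using u(1) by (simp add: v_def flip: sum_distrib_left)
  have v1: "dI W1 Pstar v = 1 - \<eta>" unfolding v_def dI_linear using u by (simp add: a_def)
  have "(1 - \<eta>) * (\<eta> + dI W2 Pstar v) = \<eta> * (1 - \<eta>) + (1 - \<eta>) * dI W2 Pstar v" by (simp add: algebra_simps)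
  also have "\<dots> = 0" using eta(3)[OF v0] unfolding v1 .
  finally have "(1 - \<eta>) * (\<eta> + dI W2 Pstar v) = 0" .
  then have "dI W2 Pstar v = - \<eta>" unfolding mult_eq_0_iff using eta(2) by linarith
  with v0 v1 show ?thesis by blast
qed

lemma mean_combination: "\<eta> * KL (W1 x) (outd Pstar W1) + (1 - \<eta>) * KL (W2 x) (outd Pstar W2) = C"
proof -
  \<comment> \<open>The direction from \<open>Pstar\<close> to the point mass at \<open>x\<close>;
    it turns the condition on \<open>\<eta>\<close> into an identity for each single letter.\<close>
  define v where "v = (\<lambda>x'. (if x' = x then 1 else 0) - Pstar x')"
  have d: "dI W Pstar v = KL (W x) (outd Pstar W) - mutual_info Pstar W" for W :: "'x \<Rightarrow> 'y \<Rightarrow> real"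
    by (simp add: dI_def v_def mutual_info_def left_diff_distrib sum_subtractf if_distrib[of "\<lambda>c. c * _"] cong: if_cong)
  have "(\<Sum>x\<in>UNIV. v x) = 0" using Pstar_dist by (simp add: v_def sum_subtractf is_dist_def)
  from eta(3)[OF this] show ?thesis unfolding d mutual_info_Pstar by (simp add: algebra_simps)
qed

lemma V_pos: "V > 0"
  unfolding V_def using V1_pos V2_pos eta by (intro add_pos_pos mult_pos_pos) auto

definition "comb x y1 y2 = \<eta> * info_dens Pstar W1 x y1 + (1 - \<eta>) * info_dens Pstar W2 x y2 - C"

lemma W1_sum: "(\<Sum>y\<in>UNIV. W1 x y) = 1" and W2_sum: "(\<Sum>y\<in>UNIV. W2 x y) = 1"
  using W1 W2 by (simp_all add: is_channel_def)

lemma W1_nonneg: "0 \<le> W1 x y" and W2_nonneg: "0 \<le> W2 x y"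
  using W1 W2 by (simp_all add: is_channel_def)

lemma comb_mean: "(\<Sum>y1\<in>UNIV. \<Sum>y2\<in>UNIV. W1 x y1 * W2 x y2 * comb x y1 y2) = 0"
  and comb_variance: "(\<Sum>y1\<in>UNIV. \<Sum>y2\<in>UNIV. W1 x y1 * W2 x y2 * (comb x y1 y2)\<^sup>2) = V"
proof -
  define a where "a y = \<eta> * (info_dens Pstar W1 x y - KL (W1 x) (outd Pstar W1))" for y
  define b where "b y = (1 - \<eta>) * (info_dens Pstar W2 x y - KL (W2 x) (outd Pstar W2))" for y
  have c: "comb x y1 y2 = a y1 + b y2" for y1 y2
    using mean_combination[of x] by (simp add: comb_def a_def b_def algebra_simps)
  have "(\<Sum>y\<in>UNIV. W1 x y * a y) = \<eta> * ((\<Sum>y\<in>UNIV. W1 x y * info_dens Pstar W1 x y) - (\<Sum>y\<in>UNIV. W1 x y) * KL (W1 x) (outd Pstar W1))"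
    by (simp add: a_def sum_distrib_left sum_distrib_right sum_subtractf[symmetric] algebra_simps)
  then have a0: "(\<Sum>y\<in>UNIV. W1 x y * a y) = 0" by (simp add: mean_info_dens W1_sum)
  have "(\<Sum>y\<in>UNIV. W2 x y * b y) = (1 - \<eta>) * ((\<Sum>y\<in>UNIV. W2 x y * info_dens Pstar W2 x y) - (\<Sum>y\<in>UNIV. W2 x y) * KL (W2 x) (outd Pstar W2))"
    unfolding b_def sum_distrib_left sum_distrib_right sum_subtractf[symmetric] by (intro sum.cong) (auto simp: algebra_simps)
  then have b0: "(\<Sum>y\<in>UNIV. W2 x y * b y) = 0" by (simp add: mean_info_dens W2_sum)
  show "(\<Sum>y1\<in>UNIV. \<Sum>y2\<in>UNIV. W1 x y1 * W2 x y2 * comb x y1 y2) = 0"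
    unfolding c sum_product_mean[OF W1_sum W2_sum] a0 b0 by simp
  have a2: "(\<Sum>y\<in>UNIV. W1 x y * (a y)\<^sup>2) = \<eta>\<^sup>2 * cond_var Pstar W1 x"
    by (simp add: a_def cond_var_eq power_mult_distrib sum_distrib_left mult_ac)
  have b2: "(\<Sum>y\<in>UNIV. W2 x y * (b y)\<^sup>2) = (1 - \<eta>)\<^sup>2 * cond_var Pstar W2 x"
    by (simp add: b_def cond_var_eq power_mult_distrib sum_distrib_left mult_ac)
  show "(\<Sum>y1\<in>UNIV. \<Sum>y2\<in>UNIV. W1 x y1 * W2 x y2 * (comb x y1 y2)\<^sup>2) = V"
    unfolding c sum_product_variance[OF W1_sum W2_sum a0] a2 b2 V_def \<eta>_def using var_const[of x] by simp
qed

lemma comb_bounded: "\<exists>b>0. \<forall>x y1 y2. \<bar>comb x y1 y2\<bar> \<le> b"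
proof -
  obtain b1 where b1: "b1 > 0" "\<And>x y. \<bar>info_dens Pstar W1 x y\<bar> \<le> b1" using info_dens_bounded[of Pstar W1] by blast
  obtain b2 where b2: "b2 > 0" "\<And>x y. \<bar>info_dens Pstar W2 x y\<bar> \<le> b2" using info_dens_bounded[of Pstar W2] by blast
  have "\<bar>comb x y1 y2\<bar> \<le> b1 + b2 + \<bar>C\<bar>" for x y1 y2
  proof -
    have "\<bar>\<eta> * info_dens Pstar W1 x y1\<bar> \<le> 1 * b1" unfolding abs_mult using eta b1 by (intro mult_mono) auto
    moreover have "\<bar>(1 - \<eta>) * info_dens Pstar W2 x y2\<bar> \<le> 1 * b2" unfolding abs_mult using eta b2 by (intro mult_mono) auto
    ultimately show ?thesis unfolding comb_def by linarith
  qed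
  moreover have "b1 + b2 + \<bar>C\<bar> > 0" using b1 b2 by linarith
  ultimately show ?thesis by blast
qed

end

section \<open>Converse\<close>

lemma sum_UNIV_triple:
  fixes f :: "'a::finite \<times> 'b::finite \<times> 'c::finite \<Rightarrow> real"
  shows "(\<Sum>z\<in>UNIV. f z) = (\<Sum>x\<in>UNIV. \<Sum>y1\<in>UNIV. \<Sum>y2\<in>UNIV. f (x, y1, y2))"
  by (simp add: sum.cartesian_product flip: UNIV_Times_UNIV)

lemma sum_lists_Suc:
  fixes F :: "'a::finite list \<Rightarrow> real"
  shows "(\<Sum>ys | length ys = Suc n. F ys) = (\<Sum>ys | length ys = n. \<Sum>y\<in>UNIV. F (ys @ [y]))"
proof -
  have "(\<Sum>ys | length ys = n. \<Sum>y\<in>UNIV. F (ys @ [y])) = (\<Sum>(ys, y)\<in>{ys. length ys = n} \<times> UNIV. F (ys @ [y]))"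
    by (simp add: sum.cartesian_product)
  also have "\<dots> = (\<Sum>ys | length ys = Suc n. F ys)"
    by (rule sum.reindex_bij_witness[where i = "\<lambda>ys. (butlast ys, last ys)" and j = "\<lambda>(ys, y). ys @ [y]"])
       (auto simp: snoc_eq_iff_butlast intro: append_butlast_last_id)
  finally show ?thesis ..
qed

abbreviation "outs1 \<equiv> map (\<lambda>z. fst (snd z))"
abbreviation "outs2 \<equiv> map (\<lambda>z. snd (snd z))"

text \<open>The input, which \<open>out_prob\<close> sums out, is kept in the letter so that
  information densities are functions of the path.\<close>

definition code_kernel ::
  "(nat \<Rightarrow> nat \<Rightarrow> 'y list \<Rightarrow> 'y list \<Rightarrow> 'x::finite \<Rightarrow> real) \<Rightarrow> ('x \<Rightarrow> 'y::finite \<Rightarrow> real) \<Rightarrow> ('x \<Rightarrow> 'y \<Rightarrow> real)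
   \<Rightarrow> nat \<Rightarrow> ('x \<times> 'y \<times> 'y) list \<Rightarrow> 'x \<times> 'y \<times> 'y \<Rightarrow> real" where
  "code_kernel enc W1 W2 j zs z = (case z of (x, y1, y2) \<Rightarrow>
     enc (length zs) j (outs1 zs) (outs2 zs) x * W1 x y1 * W2 x y2)"

lemma out_prob_snoc:
  assumes "length ys1 = n" "length ys2 = n"
  shows "out_prob (Suc n) enc W1 W2 j (ys1 @ [y1]) (ys2 @ [y2]) =
    out_prob n enc W1 W2 j ys1 ys2 * (\<Sum>x\<in>UNIV. enc n j ys1 ys2 x * W1 x y1 * W2 x y2)"
  using assms by (simp add: out_prob_def nth_append)

lemma sum_out_prob_Suc:
  "(\<Sum>ys1 | length ys1 = Suc n. \<Sum>ys2 | length ys2 = Suc n. out_prob (Suc n) enc W1 W2 j ys1 ys2 * f ys1 ys2) =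
   (\<Sum>ys1 | length ys1 = n. \<Sum>ys2 | length ys2 = n. out_prob n enc W1 W2 j ys1 ys2 *
      (\<Sum>x\<in>UNIV. \<Sum>y1\<in>UNIV. \<Sum>y2\<in>UNIV. enc n j ys1 ys2 x * W1 x y1 * W2 x y2 * f (ys1 @ [y1]) (ys2 @ [y2])))"
proof -
  have "(\<Sum>ys1 | length ys1 = Suc n. \<Sum>ys2 | length ys2 = Suc n. out_prob (Suc n) enc W1 W2 j ys1 ys2 * f ys1 ys2) =
     (\<Sum>ys1 | length ys1 = n. \<Sum>y1\<in>UNIV. \<Sum>ys2 | length ys2 = n. \<Sum>y2\<in>UNIV.
       out_prob n enc W1 W2 j ys1 ys2 * (\<Sum>x\<in>UNIV. enc n j ys1 ys2 x * W1 x y1 * W2 x y2) * f (ys1 @ [y1]) (ys2 @ [y2]))"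
    unfolding sum_lists_Suc by (intro sum.cong refl) (simp add: out_prob_snoc)
  also have "\<dots> = (\<Sum>ys1 | length ys1 = n. \<Sum>ys2 | length ys2 = n. \<Sum>y1\<in>UNIV. \<Sum>y2\<in>UNIV.
       out_prob n enc W1 W2 j ys1 ys2 * (\<Sum>x\<in>UNIV. enc n j ys1 ys2 x * W1 x y1 * W2 x y2) * f (ys1 @ [y1]) (ys2 @ [y2]))"
    by (intro sum.cong refl sum.swap)
  also have "\<dots> = (\<Sum>ys1 | length ys1 = n. \<Sum>ys2 | length ys2 = n. out_prob n enc W1 W2 j ys1 ys2 * (\<Sum>y1\<in>UNIV. \<Sum>y2\<in>UNIV.
       \<Sum>x\<in>UNIV. enc n j ys1 ys2 x * W1 x y1 * W2 x y2 * f (ys1 @ [y1]) (ys2 @ [y2])))"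
    by (simp only: sum_distrib_left sum_distrib_right mult.assoc)
  also have "\<dots> = (\<Sum>ys1 | length ys1 = n. \<Sum>ys2 | length ys2 = n. out_prob n enc W1 W2 j ys1 ys2 *
      (\<Sum>x\<in>UNIV. \<Sum>y1\<in>UNIV. \<Sum>y2\<in>UNIV. enc n j ys1 ys2 x * W1 x y1 * W2 x y2 * f (ys1 @ [y1]) (ys2 @ [y2])))"
    by (simp only: sum.swap[of _ "UNIV :: 'b set" "UNIV :: 'a set"])
  finally show ?thesis .
qed

lemma sum_out_prob_eq_path_exp:
  "(\<Sum>ys1 | length ys1 = n. \<Sum>ys2 | length ys2 = n. out_prob n enc W1 W2 j ys1 ys2 * f ys1 ys2) =
   path_exp n (code_kernel enc W1 W2 j) (\<lambda>zs. f (outs1 zs) (outs2 zs))"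
proof (induction n arbitrary: f)
  case 0
  show ?case by (simp add: out_prob_def)
next
  case (Suc n)
  show ?case unfolding sum_out_prob_Suc Suc.IH path_exp.simps
    by (rule path_exp_cong) (simp add: sum_UNIV_triple code_kernel_def)
qed

lemma stoch_code_kernel:
  assumes "valid_encoder enc" "is_channel W1" "is_channel W2"
  shows "stoch_kernel (code_kernel enc W1 W2 j)"
  unfolding stoch_kernel_def
proof (intro conjI allI)
  fix zs z
  show "0 \<le> code_kernel enc W1 W2 j zs z"
    using assms by (auto simp: code_kernel_def valid_encoder_def is_channel_def split: prod.split)
  show "(\<Sum>z\<in>UNIV. code_kernel enc W1 W2 j zs z) = 1"
    using assms by (simp add: sum_UNIV_triple code_kernel_def valid_encoder_def is_channel_def flip: sum_distrib_left)
qed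

lemma err_prob_eq_path_exp:
  "err_prob1 n M enc W1 W2 g = (1 / real M) * (\<Sum>j\<in>{1..M}. path_exp n (code_kernel enc W1 W2 j) (\<lambda>zs. if g (outs1 zs) \<noteq> j then 1 else 0))"
  "err_prob2 n M enc W1 W2 g = (1 / real M) * (\<Sum>j\<in>{1..M}. path_exp n (code_kernel enc W1 W2 j) (\<lambda>zs. if g (outs2 zs) \<noteq> j then 1 else 0))"
  unfolding err_prob1_def err_prob2_def sum_out_prob_eq_path_exp[symmetric, where f = "\<lambda>ys1 ys2. if g ys1 \<noteq> _ then 1 else 0"]
    sum_out_prob_eq_path_exp[symmetric, where f = "\<lambda>ys1 ys2. if g ys2 \<noteq> _ then 1 else 0"]
  by (intro arg_cong2[where f = "(*)"] refl sum.cong; simp)+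

text \<open>Assuming domination rather than a density absorbs the convention ln 0 = 0: for letters
  that the channel forbids, the left side is 0 whatever \<open>l\<close> is.\<close>

lemma path_exp_change_of_measure:
  assumes k: "\<And>zs z. 0 \<le> k zs z" and k': "\<And>zs z. k zs z \<le> exp (l zs z) * k' zs z"
    and F: "\<And>zs. 0 \<le> F zs"
  shows "path_exp n k F \<le> path_exp n k' (\<lambda>zs. exp (psum l zs) * F zs)"
  using F
proof (induction n arbitrary: F)
  case (Suc n)
  have k'0: "0 \<le> k' zs z" for zs z
    using order_trans[OF k k'] by (simp add: zero_le_mult_iff)
  have "path_exp n k (\<lambda>zs. \<Sum>z\<in>UNIV. k zs z * F (zs @ [z])) \<le>
    path_exp n k' (\<lambda>zs. exp (psum l zs) * (\<Sum>z\<in>UNIV. k zs z * F (zs @ [z])))"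
    by (rule Suc.IH) (simp add: sum_nonneg k Suc.prems)
  also have "\<dots> \<le> path_exp n k' (\<lambda>zs. \<Sum>z\<in>UNIV. k' zs z * (exp (psum l (zs @ [z])) * F (zs @ [z])))"
  proof (rule path_exp_mono[OF k'0])
    fix zs
    have "exp (psum l zs) * (\<Sum>z\<in>UNIV. k zs z * F (zs @ [z])) \<le> exp (psum l zs) * (\<Sum>z\<in>UNIV. (exp (l zs z) * k' zs z) * F (zs @ [z]))"
      by (intro mult_left_mono sum_mono mult_right_mono k' Suc.prems) auto
    also have "\<dots> = (\<Sum>z\<in>UNIV. k' zs z * (exp (psum l (zs @ [z])) * F (zs @ [z])))"
      by (simp add: exp_add sum_distrib_left mult_ac)
    finally show "exp (psum l zs) * (\<Sum>z\<in>UNIV. k zs z * F (zs @ [z])) \<le> (\<Sum>z\<in>UNIV. k' zs z * (exp (psum l (zs @ [z])) * F (zs @ [z])))" .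
  qed
  finally show ?case by simp
qed simp

lemma path_exp_marginal:
  fixes q :: "'y::finite \<Rightarrow> real"
  assumes "\<And>zs G. (\<Sum>z\<in>UNIV. k zs z * G (h z)) = (\<Sum>y\<in>UNIV. q y * G y)"
  shows "path_exp n k (\<lambda>zs. f (map h zs)) = path_exp n (\<lambda>_. q) f"
proof (induction n arbitrary: f)
  case (Suc n)
  have "path_exp (Suc n) k (\<lambda>zs. f (map h zs)) = path_exp n k (\<lambda>zs. \<Sum>y\<in>UNIV. q y * f (map h zs @ [y]))"
    using assms[of _ "\<lambda>y. f (map h _ @ [y])"] by simp
  also have "\<dots> = path_exp (Suc n) (\<lambda>_. q) f" using Suc by simp
  finally show ?case .
qed simp

text \<open>Under \<open>k'\<close> the decoder's observation is independent of the message, so it guesses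
  correctly with probability \<open>1/M\<close>.\<close>
lemma feedback_meta_converse:
  fixes q :: "'y::finite \<Rightarrow> real" and k k' :: "nat \<Rightarrow> 'z list \<Rightarrow> 'z::finite \<Rightarrow> real"
  assumes k: "\<And>j. stoch_kernel (k j)" and k': "\<And>j zs z. k j zs z \<le> exp (l zs z) * k' j zs z"
    and marg: "\<And>j zs G. (\<Sum>z\<in>UNIV. k' j zs z * G (h z)) = (\<Sum>y\<in>UNIV. q y * G y)"
    and q: "is_dist q" and g: "\<gamma> > 0"
  shows "(\<Sum>j\<in>{1..M}. path_exp n (k j) (\<lambda>zs. if psum l zs \<le> ln \<gamma> then 1 else 0)) \<le>
    (\<Sum>j\<in>{1..M}. path_exp n (k j) (\<lambda>zs. if g (map h zs) \<noteq> j then 1 else 0)) + \<gamma>"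
proof -
  have qk: "stoch_kernel (\<lambda>_::'y list. q)" using q by (simp add: stoch_kernel_def is_dist_def)
  have step: "path_exp n (k j) (\<lambda>zs. if psum l zs \<le> ln \<gamma> then 1 else 0) \<le>
     path_exp n (k j) (\<lambda>zs. if g (map h zs) \<noteq> j then 1 else 0) + \<gamma> * path_exp n (\<lambda>_. q) (\<lambda>ys. if g ys = j then 1 else 0)" for j
  proof -
    define F where "F zs = (if psum l zs \<le> ln \<gamma> \<and> g (map h zs) = j then 1 else 0 :: real)" for zs
    have k0: "0 \<le> k j zs z" for zs z using k by (rule stoch_kernel_nonneg)
    have k'0: "0 \<le> k' j zs z" for zs z using order_trans[OF k0 k'] by (simp add: zero_le_mult_iff)
    have "path_exp n (k j) (\<lambda>zs. if psum l zs \<le> ln \<gamma> then 1 else 0) \<le>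
      path_exp n (k j) (\<lambda>zs. (if g (map h zs) \<noteq> j then 1 else 0) + F zs)"
      by (rule path_exp_mono[OF k0]) (auto simp: F_def)
    also have "\<dots> = path_exp n (k j) (\<lambda>zs. if g (map h zs) \<noteq> j then 1 else 0) + path_exp n (k j) F"
      by (rule path_exp_add)
    also have "path_exp n (k j) F \<le> path_exp n (k' j) (\<lambda>zs. exp (psum l zs) * F zs)"
      by (rule path_exp_change_of_measure[OF k0 k']) (simp add: F_def)
    also have "\<dots> \<le> path_exp n (k' j) (\<lambda>zs. \<gamma> * (if g (map h zs) = j then 1 else 0))"
    proof (rule path_exp_mono[OF k'0])
      fix zs
      have "exp (psum l zs) \<le> \<gamma>" if "psum l zs \<le> ln \<gamma>" using that g by (metis exp_le_cancel_iff exp_ln)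
      then show "exp (psum l zs) * F zs \<le> \<gamma> * (if g (map h zs) = j then 1 else 0)"
        using g by (auto simp: F_def)
    qed
    also have "\<dots> = \<gamma> * path_exp n (\<lambda>_. q) (\<lambda>ys. if g ys = j then 1 else 0)"
      unfolding path_exp_cmult using path_exp_marginal[of "k' j" h q n "\<lambda>ys. if g ys = j then 1 else 0", OF marg] by simp
    finally show ?thesis by simp
  qed
  \<comment> \<open>The law \<open>q\<close> is the same for all messages, so the events that the
    decoder says j are disjoint events of a single experiment.\<close>
  have "(\<Sum>j\<in>{1..M}. path_exp n (\<lambda>_. q) (\<lambda>ys. if g ys = j then 1 else 0)) \<le> 1"
  proof -
    have "(\<Sum>j\<in>{1..M}. path_exp n (\<lambda>_. q) (\<lambda>ys. if g ys = j then 1 else 0)) = path_exp n (\<lambda>_. q) (\<lambda>ys. if g ys \<in> {1..M} then 1 else 0)"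
      unfolding path_exp_sum[symmetric] by (rule path_exp_cong) simp
    also have "\<dots> \<le> 1" by (rule path_exp_indicator_le_1[OF qk])
    finally show ?thesis .
  qed
  then have "\<gamma> * (\<Sum>j\<in>{1..M}. path_exp n (\<lambda>_. q) (\<lambda>ys. if g ys = j then 1 else 0)) \<le> \<gamma> * 1"
    using g by (intro mult_left_mono) auto
  moreover have "(\<Sum>j\<in>{1..M}. path_exp n (k j) (\<lambda>zs. if psum l zs \<le> ln \<gamma> then 1 else 0)) \<le>
    (\<Sum>j\<in>{1..M}. path_exp n (k j) (\<lambda>zs. if g (map h zs) \<noteq> j then 1 else 0) + \<gamma> * path_exp n (\<lambda>_. q) (\<lambda>ys. if g ys = j then 1 else 0))"
    by (rule sum_mono[OF step])
  ultimately show ?thesis by (simp add: sum.distrib sum_distrib_left)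
qed

section \<open>Converse bound for feedback codes\<close>

context cm_dmbc
begin

lemma channel_le_exp_info_dens:
  assumes "is_channel W"
  shows "W x y \<le> exp (info_dens Pstar W x y) * outd Pstar W y"
proof (cases "W x y = 0")
  case True
  then show ?thesis using is_dist_outd[OF Pstar_dist assms] by (simp add: is_dist_def)
next
  case False
  then have w: "W x y > 0" using assms by (auto simp: is_channel_def order.strict_iff_order)
  have "outd Pstar W y > 0" using outd_pos[of W Pstar x y] assms Pstar_pos w by (auto simp: less_imp_le)
  then show ?thesis using w by (simp add: info_dens_def)
qed

lemma psum_comb:
  "psum (\<lambda>_ (x, y1, y2). comb x y1 y2) zs = \<eta> * psum (\<lambda>_ (x, y1, y2). info_dens Pstar W1 x y1) zs
     + (1 - \<eta>) * psum (\<lambda>_ (x, y1, y2). info_dens Pstar W2 x y2) zs - real (length zs) * C"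
  by (simp add: psum_def comb_def split_beta sum_subtractf sum.distrib sum_distrib_left)

lemma code_kernel_comb_moments:
  assumes "valid_encoder enc"
  shows "(\<Sum>z\<in>UNIV. code_kernel enc W1 W2 j zs z * (case z of (x, y1, y2) \<Rightarrow> comb x y1 y2)) = 0"
    "(\<Sum>z\<in>UNIV. code_kernel enc W1 W2 j zs z * (case z of (x, y1, y2) \<Rightarrow> comb x y1 y2)\<^sup>2) = V"
proof -
  define e where "e = enc (length zs) j (outs1 zs) (outs2 zs)"
  have e: "(\<Sum>x\<in>UNIV. e x) = 1" using assms by (simp add: e_def valid_encoder_def)
  have *: "(\<Sum>z\<in>UNIV. code_kernel enc W1 W2 j zs z * (case z of (x, y1, y2) \<Rightarrow> f x y1 y2)) =
    (\<Sum>x\<in>UNIV. e x * (\<Sum>y1\<in>UNIV. \<Sum>y2\<in>UNIV. W1 x y1 * W2 x y2 * f x y1 y2))" for f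
    by (simp add: sum_UNIV_triple code_kernel_def e_def sum_distrib_left mult.assoc)
  show "(\<Sum>z\<in>UNIV. code_kernel enc W1 W2 j zs z * (case z of (x, y1, y2) \<Rightarrow> comb x y1 y2)) = 0"
    unfolding * comb_mean by simp
  have "(\<Sum>z\<in>UNIV. code_kernel enc W1 W2 j zs z * (case z of (x, y1, y2) \<Rightarrow> comb x y1 y2)\<^sup>2) =
    (\<Sum>z\<in>UNIV. code_kernel enc W1 W2 j zs z * (case z of (x, y1, y2) \<Rightarrow> (comb x y1 y2)\<^sup>2))"
    by (intro sum.cong) auto
  also have "\<dots> = V" unfolding * comb_variance using e by (simp flip: sum_distrib_right)
  finally show "(\<Sum>z\<in>UNIV. code_kernel enc W1 W2 j zs z * (case z of (x, y1, y2) \<Rightarrow> comb x y1 y2)\<^sup>2) = V" .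
qed

text \<open>The central limit estimate enters as the assumption \<open>lower\<close>, stated for
  every kernel with the right conditional moments because the code is arbitrary.\<close>

lemma converse_bound:
  assumes code: "FLF_code_exists W1 W2 n M eps" and g: "\<gamma> > 0"
    and lower: "\<And>k::('x \<times> 'y \<times> 'y) list \<Rightarrow> _. stoch_kernel k \<Longrightarrow>
        (\<And>zs. (\<Sum>z\<in>UNIV. k zs z * (case z of (x, y1, y2) \<Rightarrow> comb x y1 y2)) = 0) \<Longrightarrow>
        (\<And>zs. (\<Sum>z\<in>UNIV. k zs z * (case z of (x, y1, y2) \<Rightarrow> comb x y1 y2)\<^sup>2) = V) \<Longrightarrow>
        path_exp n k (\<lambda>zs. if psum (\<lambda>_ (x, y1, y2). comb x y1 y2) zs > ln \<gamma> - real n * C then 1 else 0) \<le> p"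
  shows "1 - p \<le> 2 * eps + 2 * \<gamma> / real M"
proof -
  obtain enc g1 g2 where M: "M \<ge> 1" and enc: "valid_encoder enc"
    and e1: "err_prob1 n M enc W1 W2 g1 \<le> eps" and e2: "err_prob2 n M enc W1 W2 g2 \<le> eps"
    using code unfolding FLF_code_exists_def by blast
  define k where "k = code_kernel enc W1 W2"
  have k: "stoch_kernel (k j)" for j unfolding k_def by (rule stoch_code_kernel[OF enc W1 W2])
  have enc0: "0 \<le> enc i j a b x" for i j a b x using enc by (simp add: valid_encoder_def)
  have enc1: "(\<Sum>x\<in>UNIV. enc i j a b x) = 1" for i j a b using enc by (simp add: valid_encoder_def)
  \<comment> \<open>Only the channel to the receiver in question is replaced. The encoder still
    reacts to both outputs, but the outputs of this receiver become i.i.d. with law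
    \<open>outd Pstar W1\<close>, whatever the message.\<close>
  define k1 where "k1 j zs z = (case z of (x, y1, y2) \<Rightarrow>
     enc (length zs) j (outs1 zs) (outs2 zs) x * outd Pstar W1 y1 * W2 x y2)" for j and zs :: "('x \<times> 'y \<times> 'y) list" and z
  define k2 where "k2 j zs z = (case z of (x, y1, y2) \<Rightarrow>
     enc (length zs) j (outs1 zs) (outs2 zs) x * W1 x y1 * outd Pstar W2 y2)" for j and zs :: "('x \<times> 'y \<times> 'y) list" and z
  define l1 where "l1 = (\<lambda>(_::('x \<times> 'y \<times> 'y) list) (x::'x, y1::'y, y2::'y). info_dens Pstar W1 x y1)"
  define l2 where "l2 = (\<lambda>(_::('x \<times> 'y \<times> 'y) list) (x::'x, y1::'y, y2::'y). info_dens Pstar W2 x y2)"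
  have 1: "(\<Sum>j\<in>{1..M}. path_exp n (k j) (\<lambda>zs. if psum l1 zs \<le> ln \<gamma> then 1 else 0)) \<le>
    (\<Sum>j\<in>{1..M}. path_exp n (k j) (\<lambda>zs. if g1 (outs1 zs) \<noteq> j then 1 else 0)) + \<gamma>"
  proof (rule feedback_meta_converse[OF k _ _ is_dist_outd[OF Pstar_dist W1] g])
    fix j zs z
    show "k j zs z \<le> exp (l1 zs z) * k1 j zs z"
    proof (cases z)
      case (fields x y1 y2)
      have "(enc (length zs) j (outs1 zs) (outs2 zs) x * W2 x y2) * W1 x y1 \<le>
        (enc (length zs) j (outs1 zs) (outs2 zs) x * W2 x y2) * (exp (info_dens Pstar W1 x y1) * outd Pstar W1 y1)"
        by (intro mult_left_mono channel_le_exp_info_dens[OF W1]) (auto simp: enc0 W2_nonneg)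
      then show ?thesis by (simp add: fields k_def k1_def l1_def code_kernel_def mult_ac)
    qed
    fix G
    have "(\<Sum>z\<in>UNIV. k1 j zs z * G (fst (snd z))) =
       (\<Sum>x\<in>UNIV. enc (length zs) j (outs1 zs) (outs2 zs) x * (\<Sum>y1\<in>UNIV. outd Pstar W1 y1 * G y1 * (\<Sum>y2\<in>UNIV. W2 x y2)))"
      unfolding sum_UNIV_triple k1_def sum_distrib_left by (intro sum.cong refl) simp
    then show "(\<Sum>z\<in>UNIV. k1 j zs z * G (fst (snd z))) = (\<Sum>y\<in>UNIV. outd Pstar W1 y * G y)"
      by (simp add: W2_sum enc1 flip: sum_distrib_right)
  qed
  have 2: "(\<Sum>j\<in>{1..M}. path_exp n (k j) (\<lambda>zs. if psum l2 zs \<le> ln \<gamma> then 1 else 0)) \<le>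
    (\<Sum>j\<in>{1..M}. path_exp n (k j) (\<lambda>zs. if g2 (outs2 zs) \<noteq> j then 1 else 0)) + \<gamma>"
  proof (rule feedback_meta_converse[OF k _ _ is_dist_outd[OF Pstar_dist W2] g])
    fix j zs z
    show "k j zs z \<le> exp (l2 zs z) * k2 j zs z"
    proof (cases z)
      case (fields x y1 y2)
      have "(enc (length zs) j (outs1 zs) (outs2 zs) x * W1 x y1) * W2 x y2 \<le>
        (enc (length zs) j (outs1 zs) (outs2 zs) x * W1 x y1) * (exp (info_dens Pstar W2 x y2) * outd Pstar W2 y2)"
        by (intro mult_left_mono channel_le_exp_info_dens[OF W2]) (auto simp: enc0 W1_nonneg)
      then show ?thesis by (simp add: fields k_def k2_def l2_def code_kernel_def mult_ac)
    qed
    fix G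
    have "(\<Sum>z\<in>UNIV. k2 j zs z * G (snd (snd z))) =
       (\<Sum>x\<in>UNIV. enc (length zs) j (outs1 zs) (outs2 zs) x * ((\<Sum>y1\<in>UNIV. W1 x y1) * (\<Sum>y2\<in>UNIV. outd Pstar W2 y2 * G y2)))"
      unfolding sum_UNIV_triple k2_def sum_product unfolding sum_distrib_left by (intro sum.cong refl) simp
    then show "(\<Sum>z\<in>UNIV. k2 j zs z * G (snd (snd z))) = (\<Sum>y\<in>UNIV. outd Pstar W2 y * G y)"
      by (simp add: W1_sum enc1 flip: sum_distrib_right)
  qed
  have E: "(\<Sum>j\<in>{1..M}. path_exp n (k j) (\<lambda>zs. if g1 (outs1 zs) \<noteq> j then 1 else 0)) \<le> real M * eps"
       "(\<Sum>j\<in>{1..M}. path_exp n (k j) (\<lambda>zs. if g2 (outs2 zs) \<noteq> j then 1 else 0)) \<le> real M * eps"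
    using e1 e2 M unfolding err_prob_eq_path_exp k_def by (simp_all add: field_simps)
  define c where "c = (\<lambda>(_::('x \<times> 'y \<times> 'y) list) (x, y1, y2). comb x y1 y2)"
  have one: "1 - p \<le> path_exp n (k j) (\<lambda>zs. if psum l1 zs \<le> ln \<gamma> then 1 else 0) + path_exp n (k j) (\<lambda>zs. if psum l2 zs \<le> ln \<gamma> then 1 else 0)" for j
  proof -
    have "1 = path_exp n (k j) (\<lambda>zs. 1)" by (simp add: path_exp_const[OF k])
    also have "\<dots> \<le> path_exp n (k j) (\<lambda>zs. (if psum c zs > ln \<gamma> - real n * C then 1 else 0) +
       ((if psum l1 zs \<le> ln \<gamma> then 1 else 0) + (if psum l2 zs \<le> ln \<gamma> then 1 else 0)))"
    proof (rule path_exp_mono[OF stoch_kernel_nonneg[OF k]])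
      fix zs :: "('x \<times> 'y \<times> 'y) list" assume len: "length zs = n"
      have "psum c zs > ln \<gamma> - real n * C" if "psum l1 zs > ln \<gamma>" "psum l2 zs > ln \<gamma>"
      proof -
        have "\<eta> * psum l1 zs + (1 - \<eta>) * psum l2 zs > \<eta> * ln \<gamma> + (1 - \<eta>) * ln \<gamma>"
          using that eta(1,2) by (intro add_strict_mono mult_strict_left_mono) auto
        then show ?thesis unfolding c_def psum_comb using len by (simp add: l1_def l2_def algebra_simps)
      qed
      then show "1 \<le> (if psum c zs > ln \<gamma> - real n * C then 1 else 0) +
       ((if psum l1 zs \<le> ln \<gamma> then 1 else 0) + (if psum l2 zs \<le> ln \<gamma> then 1 else 0 :: real))"
        by (auto simp: not_le)
    qed
    also have "\<dots> \<le> p + (path_exp n (k j) (\<lambda>zs. if psum l1 zs \<le> ln \<gamma> then 1 else 0) + path_exp n (k j) (\<lambda>zs. if psum l2 zs \<le> ln \<gamma> then 1 else 0))"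
      unfolding path_exp_add c_def using code_kernel_comb_moments[OF enc] k unfolding k_def by (intro add_right_mono lower) auto
    finally show ?thesis by simp
  qed
  have "(\<Sum>j\<in>{1..M}. 1 - p) \<le> (\<Sum>j\<in>{1..M}. path_exp n (k j) (\<lambda>zs. if psum l1 zs \<le> ln \<gamma> then 1 else 0) + path_exp n (k j) (\<lambda>zs. if psum l2 zs \<le> ln \<gamma> then 1 else 0))"
    by (rule sum_mono) (rule one)
  then have "real M * (1 - p) \<le> real M * (2 * eps) + 2 * \<gamma>" using 1 2 E by (simp add: sum.distrib)
  also have "\<dots> = real M * (2 * eps + 2 * \<gamma> / real M)" using M by (simp add: field_simps)
  finally show ?thesis using M by simp
qed

theorem converse:
  assumes eps: "0 < eps" "eps < 1 / 2"
  shows "\<exists>K n0. \<forall>n\<ge>n0. \<forall>M. FLF_code_exists W1 W2 n M eps \<longrightarrow>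
    ln (real M) \<le> real n * C - sqrt (real n * V) * Qinv (2 * eps) + K * real n powr (1/3) * ln (real n)"
proof -
  obtain b where b: "b > 0" "\<And>x y1 y2. \<bar>comb x y1 y2\<bar> \<le> b" using comb_bounded by blast
  define c where "c = 2 + (b^3 / 2 + V\<^sup>2) * (2 * (1 + V) / V) + 1 / sqrt V + 1 / V"
  have c: "c > 0" unfolding c_def using b V_pos by (intro add_pos_pos mult_pos_pos) auto
  obtain a where a: "a > 0" "\<And>x. 0 \<le> x \<Longrightarrow> x \<le> 1 \<Longrightarrow> Qfun (Qinv (2 * eps) - x) \<ge> 2 * eps + a * x"
    by (rule Qfun_near_Qinv[of "2 * eps"]) (use eps in auto)
  \<comment> \<open>Per unit of \<open>q\<close>: \<open>c\<close> from the central limit theorem, 2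
    from the threshold \<open>M * q\<close>, and 1 for a strict inequality; division by
    \<open>a\<close> turns the total into a quantile shift.\<close>
  define A where "A = (c + 3) / a"
  have A: "A > 0" using a c by (simp add: A_def)
  define K where "K = sqrt V * A + 1"
  have "eventually (\<lambda>x. A * x powr (-1/6) \<le> 1) at_top" by real_asymp
  then have "eventually (\<lambda>n. A * real n powr (-1/6) \<le> 1) sequentially"
    using filterlim_real_sequentially by (rule eventually_compose_filterlim)
  then have "eventually (\<lambda>n. n \<ge> 3 \<and> A * real n powr (-1/6) \<le> 1) sequentially"
    using eventually_ge_at_top[of 3] by eventually_elim simp
  then obtain n0 where n0: "\<And>n. n \<ge> n0 \<Longrightarrow> n \<ge> 3 \<and> A * real n powr (-1/6) \<le> 1"
    unfolding eventually_sequentially by blast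
  show ?thesis
  proof (intro exI allI impI)
    fix n M assume n: "n \<ge> n0" and code: "FLF_code_exists W1 W2 n M eps"
    have n3: "n \<ge> 3" and small: "A * real n powr (-1/6) \<le> 1" using n0[OF n] by auto
    have M: "M \<ge> 1" using code by (simp add: FLF_code_exists_def)
    \<comment> \<open>The information threshold will be \<open>M * q\<close> instead of
      \<open>M\<close>: correct guessing then costs only 2 q in probability, and the rate loses -ln
      q = ln n / 6.\<close>
    define q where "q = real n powr (-1/6)"
    have q: "q > 0" using n3 by (simp add: q_def)
    define t where "t = ln (real M * q) - real n * C"
    have "1 - (Qfun (t / sqrt (real n * V)) + c * q) \<le> 2 * eps + 2 * (real M * q) / real M"
    proof (rule converse_bound[OF code])
      show "real M * q > 0" using M q by simp
      fix k :: "('x \<times> 'y \<times> 'y) list \<Rightarrow> _"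
      assume "stoch_kernel k" "\<And>zs. (\<Sum>z\<in>UNIV. k zs z * (case z of (x, y1, y2) \<Rightarrow> comb x y1 y2)) = 0"
        "\<And>zs. (\<Sum>z\<in>UNIV. k zs z * (case z of (x, y1, y2) \<Rightarrow> comb x y1 y2)\<^sup>2) = V"
      then have "\<bar>path_exp n k (\<lambda>zs. if psum (\<lambda>_ (x, y1, y2). comb x y1 y2) zs > t then 1 else 0) - Qfun (t / sqrt (real n * V))\<bar>
        \<le> c * q" unfolding c_def q_def using n3 b by (intro martingale_clt[OF V_pos]) auto
      then show "path_exp n k (\<lambda>zs. if psum (\<lambda>_ (x, y1, y2). comb x y1 y2) zs > ln (real M * q) - real n * C then 1 else 0) \<le> Qfun (t / sqrt (real n * V)) + c * q"
        unfolding t_def by linarith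
    qed
    then have "Qfun (- (t / sqrt (real n * V))) \<le> 2 * eps + (c + 2) * q"
      unfolding Qfun_minus using M by (simp add: algebra_simps)
    also have "\<dots> < 2 * eps + (c + 3) * q" using q by (simp add: algebra_simps)
    also have "\<dots> = 2 * eps + a * (A * q)" using a(1) by (simp add: A_def)
    also have "\<dots> \<le> Qfun (Qinv (2 * eps) - A * q)" using small A q by (intro a(2)) (auto simp: q_def)
    finally have "\<not> - (t / sqrt (real n * V)) \<le> Qinv (2 * eps) - A * q"
      using Qfun_antimono[of "- (t / sqrt (real n * V))" "Qinv (2 * eps) - A * q"] by linarith
    then have "t / sqrt (real n * V) \<le> A * q - Qinv (2 * eps)" by linarith
    then have "t \<le> (A * q - Qinv (2 * eps)) * sqrt (real n * V)"
      using n3 V_pos by (simp add: pos_divide_le_eq)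
    then have 1: "ln (real M) \<le> real n * C - sqrt (real n * V) * Qinv (2 * eps) + sqrt (real n * V) * (A * q) - ln q"
      using M q by (simp add: t_def ln_mult algebra_simps)
    have "sqrt (real n) * q = real n powr (1/3)"
      using n3 by (simp add: q_def powr_half_sqrt[symmetric] flip: powr_add)
    then have 2: "sqrt (real n * V) * (A * q) = sqrt V * A * real n powr (1/3)"
      by (simp add: real_sqrt_mult algebra_simps)
    have l1: "ln (real n) \<ge> 1"
    proof -
      have "exp 1 \<le> (3::real)" by (rule exp_le)
      also have "3 \<le> real n" using n3 by simp
      finally show ?thesis using n3 by (simp add: ln_ge_iff)
    qed
    have p1: "real n powr (1/3) \<ge> 1" using n3 by (simp add: ge_one_powr_ge_zero)
    have 3: "- ln q \<le> real n powr (1/3) * ln (real n)"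
    proof -
      have "- ln q = ln (real n) / 6" using n3 by (simp add: q_def ln_powr)
      also have "\<dots> \<le> 1 * ln (real n)" using l1 by simp
      also have "\<dots> \<le> real n powr (1/3) * ln (real n)" using p1 l1 by (intro mult_right_mono) auto
      finally show ?thesis .
    qed
    have 4: "sqrt V * A * real n powr (1/3) \<le> sqrt V * A * real n powr (1/3) * ln (real n)"
      using mult_left_mono[OF l1, of "sqrt V * A * real n powr (1/3)"] A V_pos by simp
    show "ln (real M) \<le> real n * C - sqrt (real n * V) * Qinv (2 * eps) + K * real n powr (1/3) * ln (real n)"
      using 1 3 4 unfolding 2 K_def by (simp add: algebra_simps)
  qed
qed

end

section \<open>Random coding with feedback\<close>

text \<open>The expectation over M independent codewords with law \<open>\<mu>\<close> on
  \<open>A\<close>, the last one being averaged first.\<close>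

primrec codebook_exp :: "'w set \<Rightarrow> ('w \<Rightarrow> real) \<Rightarrow> nat \<Rightarrow> ('w list \<Rightarrow> real) \<Rightarrow> real" where
  "codebook_exp A \<mu> 0 f = f []"
| "codebook_exp A \<mu> (Suc M) f = codebook_exp A \<mu> M (\<lambda>cs. \<Sum>w\<in>A. \<mu> w * f (cs @ [w]))"

lemma codebook_exp_add: "codebook_exp A \<mu> M (\<lambda>cs. f cs + g cs) = codebook_exp A \<mu> M f + codebook_exp A \<mu> M g"
  by (induction M arbitrary: f g) (simp_all add: distrib_left sum.distrib)

lemma codebook_exp_cong:
  assumes "\<And>cs. length cs = M \<Longrightarrow> f cs = g cs"
  shows "codebook_exp A \<mu> M f = codebook_exp A \<mu> M g"
  using assms
proof (induction M arbitrary: f g)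
  case (Suc M)
  show ?case unfolding codebook_exp.simps by (rule Suc.IH) (simp add: Suc.prems)
qed simp

lemma codebook_exp_const: "(\<Sum>w\<in>A. \<mu> w) = 1 \<Longrightarrow> codebook_exp A \<mu> M (\<lambda>_. c) = c"
  by (induction M) (simp_all flip: sum_distrib_right)

text \<open>The method of conditional expectations: the first M codewords are fixed for the average
  \<open>F\<close> over the last one, then the last one is chosen.\<close>

lemma ex_codebook_le:
  assumes \<mu>: "\<And>w. w \<in> A \<Longrightarrow> 0 \<le> \<mu> w" "(\<Sum>w\<in>A. \<mu> w) = 1"
  shows "\<exists>cs. length cs = M \<and> f cs \<le> codebook_exp A \<mu> M f"
proof (induction M arbitrary: f)
  case (Suc M)
  define F where "F cs = (\<Sum>w\<in>A. \<mu> w * f (cs @ [w]))" for cs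
  obtain cs where cs: "length cs = M" "F cs \<le> codebook_exp A \<mu> M F" using Suc by blast
  have "\<exists>w\<in>A. f (cs @ [w]) \<le> F cs"
  proof (rule ccontr)
    assume H: "\<not> ?thesis"
    have fin: "finite A" using \<mu>(2) by (metis sum.infinite zero_neq_one)
    have "\<exists>w\<in>A. \<mu> w > 0"
    proof (rule ccontr)
      assume "\<not> ?thesis"
      then have "(\<Sum>w\<in>A. \<mu> w) = 0" using \<mu>(1) by (intro sum.neutral) (force simp: not_less)
      then show False using \<mu>(2) by simp
    qed
    then obtain w0 where w0: "w0 \<in> A" "\<mu> w0 > 0" by blast
    have "(\<Sum>w\<in>A. \<mu> w * F cs) < (\<Sum>w\<in>A. \<mu> w * f (cs @ [w]))"
      using H w0 \<mu>(1) by (intro sum_strict_mono_ex1[OF fin]) (auto intro!: mult_left_mono bexI[of _ w0] simp: not_le less_imp_le)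
    then show False using \<mu>(2) by (simp add: F_def[symmetric] flip: sum_distrib_right)
  qed
  then obtain w where "f (cs @ [w]) \<le> F cs" by blast
  then show ?case using cs by (intro exI[of _ "cs @ [w]"]) (auto simp: F_def[abs_def])
qed simp

lemma codebook_exp_sum:
  assumes "(\<Sum>w\<in>A. \<mu> w) = 1"
  shows "codebook_exp A \<mu> M (\<lambda>cs. \<Sum>i<M. g (cs ! i)) = real M * (\<Sum>w\<in>A. \<mu> w * g w)"
proof (induction M)
  case (Suc M)
  have "codebook_exp A \<mu> (Suc M) (\<lambda>cs. \<Sum>i<Suc M. g (cs ! i)) =
    codebook_exp A \<mu> M (\<lambda>cs. (\<Sum>i<M. g (cs ! i)) + (\<Sum>w\<in>A. \<mu> w * g w))"
    unfolding codebook_exp.simps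
    by (rule codebook_exp_cong) (simp add: nth_append distrib_left sum.distrib assms flip: sum_distrib_right)
  also have "\<dots> = real (Suc M) * (\<Sum>w\<in>A. \<mu> w * g w)"
    unfolding codebook_exp_add codebook_exp_const[OF assms] Suc by (simp add: algebra_simps)
  finally show ?case .
qed simp

lemma codebook_exp_pairs:
  assumes "(\<Sum>w\<in>A. \<mu> w) = 1"
  shows "codebook_exp A \<mu> M (\<lambda>cs. \<Sum>i<M. \<Sum>j<M. if i = j then 0 else h (cs ! i) (cs ! j)) =
    real M * (real M - 1) * (\<Sum>w\<in>A. \<Sum>w'\<in>A. \<mu> w * \<mu> w' * h w w')"
proof (induction M)
  case (Suc M)
  define E where "E = (\<Sum>w\<in>A. \<Sum>w'\<in>A. \<mu> w * \<mu> w' * h w w')"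
  define g where "g c = (\<Sum>w\<in>A. \<mu> w * (h c w + h w c))" for c
  have "codebook_exp A \<mu> (Suc M) (\<lambda>cs. \<Sum>i<Suc M. \<Sum>j<Suc M. if i = j then 0 else h (cs ! i) (cs ! j)) =
    codebook_exp A \<mu> M (\<lambda>cs. (\<Sum>i<M. \<Sum>j<M. if i = j then 0 else h (cs ! i) (cs ! j)) + (\<Sum>i<M. g (cs ! i)))"
    unfolding codebook_exp.simps
  proof (rule codebook_exp_cong)
    fix cs :: "'a list" assume len: "length cs = M"
    define p where "p = (\<Sum>i<M. \<Sum>j<M. if i = j then 0 else h (cs ! i) (cs ! j))"
    have "(\<Sum>i<Suc M. \<Sum>j<Suc M. if i = j then 0 else h ((cs @ [w]) ! i) ((cs @ [w]) ! j)) = p + (\<Sum>i<M. h (cs ! i) w + h w (cs ! i))" for w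
      using len by (simp add: nth_append sum.distrib p_def cong: if_cong sum.cong_simp)
    then have "(\<Sum>w\<in>A. \<mu> w * (\<Sum>i<Suc M. \<Sum>j<Suc M. if i = j then 0 else h ((cs @ [w]) ! i) ((cs @ [w]) ! j)))
      = (\<Sum>w\<in>A. \<mu> w * p) + (\<Sum>w\<in>A. \<Sum>i<M. \<mu> w * (h (cs ! i) w + h w (cs ! i)))"
      by (simp only: distrib_left sum.distrib sum_distrib_left)
    also have "\<dots> = p + (\<Sum>i<M. g (cs ! i))"
      using assms unfolding g_def by (subst sum.swap) (simp flip: sum_distrib_right)
    finally show "(\<Sum>w\<in>A. \<mu> w * (\<Sum>i<Suc M. \<Sum>j<Suc M. if i = j then 0 else h ((cs @ [w]) ! i) ((cs @ [w]) ! j))) =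
      (\<Sum>i<M. \<Sum>j<M. if i = j then 0 else h (cs ! i) (cs ! j)) + (\<Sum>i<M. g (cs ! i))" unfolding p_def .
  qed
  also have "\<dots> = real M * (real M - 1) * E + real M * (\<Sum>w\<in>A. \<mu> w * g w)"
    unfolding codebook_exp_add Suc codebook_exp_sum[OF assms] E_def ..
  also have "(\<Sum>w\<in>A. \<mu> w * g w) = (\<Sum>w\<in>A. \<Sum>w'\<in>A. \<mu> w * \<mu> w' * h w w') + (\<Sum>w\<in>A. \<Sum>w'\<in>A. \<mu> w * \<mu> w' * h w' w)"
    by (simp add: g_def sum_distrib_left distrib_left sum.distrib mult.assoc)
  also have "(\<Sum>w\<in>A. \<Sum>w'\<in>A. \<mu> w * \<mu> w' * h w' w) = E"
    unfolding E_def by (subst sum.swap) (simp add: mult_ac)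
  finally show ?case unfolding E_def[symmetric] by (simp add: algebra_simps)
qed simp

text \<open>Averaging the pair functional below bounds, for a single codebook, the deviations of both error
  averages from their means and both confusion terms simultaneously.\<close>
lemma ex_good_codebook:
  fixes e :: "bool \<Rightarrow> 'w \<Rightarrow> real" and p :: "bool \<Rightarrow> 'w \<Rightarrow> 'w \<Rightarrow> real"
  assumes \<mu>: "\<And>w. w \<in> A \<Longrightarrow> 0 \<le> \<mu> w" "(\<Sum>w\<in>A. \<mu> w) = 1"
    and e: "\<And>k w. 0 \<le> e k w" "\<And>k w. e k w \<le> 1"
    and p: "\<And>k w w'. 0 \<le> p k w w'" "\<And>k. (\<Sum>w\<in>A. \<Sum>w'\<in>A. \<mu> w * \<mu> w' * p k w w') \<le> \<kappa>"
    and M: "M \<ge> 1" and \<theta>: "\<theta> = 2 / real M + 2 * real M * \<kappa>"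
  shows "\<exists>cs. length cs = M \<and> (\<forall>k. (1 / real M) * (\<Sum>i<M. e k (cs ! i) + (\<Sum>j<M. if i = j then 0 else p k (cs ! i) (cs ! j)))
     \<le> (\<Sum>w\<in>A. \<mu> w * e k w) + sqrt \<theta> + \<theta>)"
proof -
  define m where "m k = (\<Sum>w\<in>A. \<mu> w * e k w)" for k
  have m: "0 \<le> m k" "m k \<le> 1" for k
  proof -
    show "0 \<le> m k" unfolding m_def using \<mu> e by (intro sum_nonneg) auto
    have "m k \<le> (\<Sum>w\<in>A. \<mu> w * 1)" unfolding m_def using \<mu> e by (intro sum_mono mult_left_mono) auto
    then show "m k \<le> 1" using \<mu> by simp
  qed
  have \<kappa>: "\<kappa> \<ge> 0" using p(2)[of True] sum_nonneg[of A "\<lambda>w. \<Sum>w'\<in>A. \<mu> w * \<mu> w' * p True w w'"] \<mu>(1) p(1)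
    by (force intro: sum_nonneg)
  \<comment> \<open>The squared deviation of the average error splits into cross terms, put into
    \<open>h\<close> together with the confusion probabilities, and diagonal terms \<open>u\<close>.
    By independence the cross terms average to 0.\<close>
  define h where "h k w w' = (e k w - m k) * (e k w' - m k) / (real M)\<^sup>2 + p k w w' / real M" for k w w'
  define u where "u k w = (e k w - m k)\<^sup>2 / (real M)\<^sup>2" for k w
  define T where "T k cs = (1 / real M) * (\<Sum>i<M. e k (cs ! i))" for k and cs :: "'w list"
  define R where "R k cs = (1 / real M) * (\<Sum>i<M. \<Sum>j<M. if i = j then 0 else p k (cs ! i) (cs ! j))" for k and cs :: "'w list"
  define \<Phi> where "\<Phi> k cs = (\<Sum>i<M. \<Sum>j<M. if i = j then 0 else h k (cs ! i) (cs ! j)) + (\<Sum>i<M. u k (cs ! i))" for k and cs :: "'w list"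
  have \<Phi>: "\<Phi> k cs = (T k cs - m k)\<^sup>2 + R k cs" for k cs
  proof -
    define f where "f i = e k (cs ! i) - m k" for i
    have "(T k cs - m k) = (1 / real M) * (\<Sum>i<M. f i)"
      using M by (simp add: T_def f_def sum_subtractf right_diff_distrib)
    then have "(T k cs - m k)\<^sup>2 = (\<Sum>i<M. \<Sum>j<M. f i * f j / (real M)\<^sup>2)"
      by (simp add: power2_eq_square sum_product sum_divide_distrib)
    also have "\<dots> = (\<Sum>i<M. \<Sum>j<M. (if i = j then 0 else f i * f j / (real M)\<^sup>2) + (if i = j then f i * f j / (real M)\<^sup>2 else 0))"
      by (intro sum.cong) auto
    also have "\<dots> = (\<Sum>i<M. \<Sum>j<M. if i = j then 0 else f i * f j / (real M)\<^sup>2) + (\<Sum>i<M. u k (cs ! i))"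
      unfolding sum.distrib by (simp add: u_def f_def power2_eq_square)
    finally have 1: "(T k cs - m k)\<^sup>2 = (\<Sum>i<M. \<Sum>j<M. if i = j then 0 else f i * f j / (real M)\<^sup>2) + (\<Sum>i<M. u k (cs ! i))" .
    have "(\<Sum>i<M. \<Sum>j<M. if i = j then 0 else h k (cs ! i) (cs ! j)) =
      (\<Sum>i<M. \<Sum>j<M. if i = j then 0 else f i * f j / (real M)\<^sup>2) + R k cs"
      unfolding R_def sum_distrib_left sum.distrib[symmetric] by (intro sum.cong) (auto simp: h_def f_def)
    then show ?thesis unfolding \<Phi>_def 1 by simp
  qed
  have avg: "codebook_exp A \<mu> M (\<Phi> k) \<le> \<theta> / 2" for k
  proof -
    have c0: "(\<Sum>w\<in>A. \<mu> w * (e k w - m k)) = 0"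
      using \<mu>(2) by (simp add: right_diff_distrib sum_subtractf m_def flip: sum_distrib_right)
    have "(\<Sum>w\<in>A. \<Sum>w'\<in>A. \<mu> w * \<mu> w' * h k w w') =
      (\<Sum>w\<in>A. \<mu> w * (e k w - m k)) * (\<Sum>w\<in>A. \<mu> w * (e k w - m k)) / (real M)\<^sup>2 + (\<Sum>w\<in>A. \<Sum>w'\<in>A. \<mu> w * \<mu> w' * p k w w') / real M"
      unfolding sum_product sum_divide_distrib sum.distrib[symmetric] h_def by (intro sum.cong) (auto simp: distrib_left mult_ac)
    also have "\<dots> \<le> \<kappa> / real M" unfolding c0 using p(2) by (simp add: divide_right_mono)
    finally have Eh: "(\<Sum>w\<in>A. \<Sum>w'\<in>A. \<mu> w * \<mu> w' * h k w w') \<le> \<kappa> / real M" .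
    have "(\<Sum>w\<in>A. \<mu> w * u k w) \<le> (\<Sum>w\<in>A. \<mu> w * (1 / (real M)\<^sup>2))"
    proof (intro sum_mono mult_left_mono \<mu>(1))
      fix w
      have "\<bar>e k w - m k\<bar> \<le> 1" using e(1)[of k w] e(2)[of k w] m[of k] by (auto simp: abs_le_iff)
      then have "(e k w - m k)\<^sup>2 \<le> 1" by (simp add: abs_square_le_1)
      then show "u k w \<le> 1 / (real M)\<^sup>2" unfolding u_def by (simp add: divide_right_mono)
    qed
    also have "\<dots> = 1 / (real M)\<^sup>2" using \<mu>(2) by (simp flip: sum_divide_distrib)
    finally have Eu: "(\<Sum>w\<in>A. \<mu> w * u k w) \<le> 1 / (real M)\<^sup>2" .
    have "codebook_exp A \<mu> M (\<Phi> k) = real M * (real M - 1) * (\<Sum>w\<in>A. \<Sum>w'\<in>A. \<mu> w * \<mu> w' * h k w w') + real M * (\<Sum>w\<in>A. \<mu> w * u k w)"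
      unfolding \<Phi>_def codebook_exp_add codebook_exp_pairs[OF \<mu>(2)] codebook_exp_sum[OF \<mu>(2)] ..
    also have "\<dots> \<le> real M * (real M - 1) * (\<kappa> / real M) + real M * (1 / (real M)\<^sup>2)"
      using M by (intro add_mono mult_left_mono Eh Eu) auto
    also have "\<dots> = (real M - 1) * \<kappa> + 1 / real M" using M by (simp add: power2_eq_square)
    also have "\<dots> \<le> real M * \<kappa> + 1 / real M" using \<kappa> by (simp add: algebra_simps)
    finally show ?thesis by (simp add: \<theta>)
  qed
  \<comment> \<open>The functionals of both receivers are nonnegative, so a codebook for which their
    sum is small is good for each of them.\<close>
  obtain cs where cs: "length cs = M" "\<Phi> True cs + \<Phi> False cs \<le> codebook_exp A \<mu> M (\<lambda>cs. \<Phi> True cs + \<Phi> False cs)"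
    using ex_codebook_le[OF \<mu>, of M "\<lambda>cs. \<Phi> True cs + \<Phi> False cs"] by blast
  have R0: "R k cs \<ge> 0" for k unfolding R_def using p(1) by (intro mult_nonneg_nonneg sum_nonneg) auto
  have tot: "\<Phi> True cs + \<Phi> False cs \<le> \<theta>" using cs(2) avg[of True] avg[of False] unfolding codebook_exp_add by linarith
  have \<Phi>0: "\<Phi> k cs \<ge> 0" for k unfolding \<Phi> using R0 by simp
  have \<Phi>\<theta>: "\<Phi> k cs \<le> \<theta>" for k using tot \<Phi>0[of True] \<Phi>0[of False] by (cases k) auto
  have "T k cs + R k cs \<le> m k + sqrt \<theta> + \<theta>" for k
  proof -
    have "(T k cs - m k)\<^sup>2 \<le> \<theta>" using \<Phi>\<theta>[of k] R0[of k] unfolding \<Phi> by simp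
    then have "T k cs - m k \<le> sqrt \<theta>" by (rule real_le_rsqrt)
    moreover have "R k cs \<le> \<theta>" using \<Phi>\<theta>[of k] unfolding \<Phi> using zero_le_power2[of "T k cs - m k"] by linarith
    ultimately show ?thesis by linarith
  qed
  then show ?thesis using cs(1) unfolding m_def T_def R_def
    by (intro exI[of _ cs]) (simp add: sum.distrib distrib_left)
qed

text \<open>The encoder ignores its message index, which is set to 0.\<close>
definition det_exp :: "nat \<Rightarrow> ('x::finite \<Rightarrow> 'y::finite \<Rightarrow> real) \<Rightarrow> ('x \<Rightarrow> 'y \<Rightarrow> real) \<Rightarrow>
    (nat \<Rightarrow> 'y list \<Rightarrow> 'y list \<Rightarrow> 'x) \<Rightarrow> ('y list \<Rightarrow> 'y list \<Rightarrow> real) \<Rightarrow> real" where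
  "det_exp n W1 W2 e f = (\<Sum>ys1 | length ys1 = n. \<Sum>ys2 | length ys2 = n.
     out_prob n (\<lambda>i j a b x. if x = e i a b then 1 else 0) W1 W2 0 ys1 ys2 * f ys1 ys2)"

lemma det_exp_0 [simp]: "det_exp 0 W1 W2 e f = f [] []"
  by (simp add: det_exp_def out_prob_def)

lemma det_exp_Suc:
  "det_exp (Suc n) W1 W2 e f = det_exp n W1 W2 e (\<lambda>ys1 ys2. \<Sum>y1\<in>UNIV. \<Sum>y2\<in>UNIV.
     W1 (e n ys1 ys2) y1 * W2 (e n ys1 ys2) y2 * f (ys1 @ [y1]) (ys2 @ [y2]))"
proof -
  have "(\<Sum>x\<in>UNIV. \<Sum>y1\<in>UNIV. \<Sum>y2\<in>UNIV. (if x = x0 then 1 else 0) * W1 x y1 * W2 x y2 * G y1 y2) =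
    (\<Sum>y1\<in>UNIV. \<Sum>y2\<in>UNIV. W1 x0 y1 * W2 x0 y2 * G y1 y2)" for x0 and G :: "'b \<Rightarrow> 'b \<Rightarrow> real"
  proof -
    have "(\<Sum>x\<in>UNIV. \<Sum>y1\<in>UNIV. \<Sum>y2\<in>UNIV. (if x = x0 then 1 else 0) * W1 x y1 * W2 x y2 * G y1 y2) =
      (\<Sum>x\<in>UNIV. if x = x0 then \<Sum>y1\<in>UNIV. \<Sum>y2\<in>UNIV. W1 x0 y1 * W2 x0 y2 * G y1 y2 else 0)"
      by (intro sum.cong) auto
    then show ?thesis by simp
  qed
  then show ?thesis unfolding det_exp_def sum_out_prob_Suc by simp
qed

lemma det_exp_cong:
  assumes "\<And>i a b. i < n \<Longrightarrow> length a = i \<Longrightarrow> length b = i \<Longrightarrow> e i a b = e' i a b"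
    and "\<And>ys1 ys2. length ys1 = n \<Longrightarrow> length ys2 = n \<Longrightarrow> f ys1 ys2 = g ys1 ys2"
  shows "det_exp n W1 W2 e f = det_exp n W1 W2 e' g"
  unfolding det_exp_def out_prob_def using assms by (intro sum.cong refl arg_cong2[where f = "(*)"] prod.cong) auto

lemma valid_det_encoder: "valid_encoder (\<lambda>i j a b x. if x = e i j a b then 1 else 0)"
  by (auto simp: valid_encoder_def)

lemma det_exp_eq_path_exp:
  "det_exp n W1 W2 e f = path_exp n (code_kernel (\<lambda>i j a b x. if x = e i a b then 1 else 0) W1 W2 0) (\<lambda>zs. f (outs1 zs) (outs2 zs))"
  unfolding det_exp_def by (rule sum_out_prob_eq_path_exp)

lemma det_exp_mono:
  assumes "is_channel W1" "is_channel W2" "\<And>ys1 ys2. length ys1 = n \<Longrightarrow> length ys2 = n \<Longrightarrow> f ys1 ys2 \<le> g ys1 ys2"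
  shows "det_exp n W1 W2 e f \<le> det_exp n W1 W2 e g"
  unfolding det_exp_eq_path_exp
  by (rule path_exp_mono) (auto intro!: assms(3) stoch_kernel_nonneg stoch_code_kernel assms(1,2) valid_det_encoder)

lemma det_exp_const:
  assumes "is_channel W1" "is_channel W2"
  shows "det_exp n W1 W2 e (\<lambda>_ _. c) = c"
  unfolding det_exp_eq_path_exp by (intro path_exp_const stoch_code_kernel assms valid_det_encoder)

lemma det_exp_add: "det_exp n W1 W2 e (\<lambda>a b. f a b + g a b) = det_exp n W1 W2 e f + det_exp n W1 W2 e g"
  unfolding det_exp_eq_path_exp by (rule path_exp_add)

lemma det_exp_cmult: "det_exp n W1 W2 e (\<lambda>a b. c * f a b) = c * det_exp n W1 W2 e f"
  unfolding det_exp_eq_path_exp by (rule path_exp_cmult)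

lemma det_exp_sum: "det_exp n W1 W2 e (\<lambda>a b. \<Sum>i\<in>I. f i a b) = (\<Sum>i\<in>I. det_exp n W1 W2 e (f i))"
  unfolding det_exp_eq_path_exp by (rule path_exp_sum)

text \<open>A competing codeword is independent of the outputs, whatever feedback did for the
  transmitted one, so a bound \<open>\<kappa>\<close> uniform in the output sequence controls
  confusion. An error forces the own codeword to fail the test or another one to pass it.\<close>

theorem random_coding:
  fixes E :: "'w \<Rightarrow> nat \<Rightarrow> 'y::finite list \<Rightarrow> 'y list \<Rightarrow> 'x::finite" and good :: "bool \<Rightarrow> 'w \<Rightarrow> 'y list \<Rightarrow> bool"
  assumes W: "is_channel W1" "is_channel W2"
    and \<mu>: "\<And>w. w \<in> A \<Longrightarrow> 0 \<le> \<mu> w" "(\<Sum>w\<in>A. \<mu> w) = 1"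
    and \<kappa>: "\<And>k ys. (\<Sum>w\<in>A. \<mu> w * (if good k w ys then 1 else 0)) \<le> \<kappa>"
    and M: "M \<ge> 1" and \<theta>: "\<theta> = 2 / real M + 2 * real M * \<kappa>"
    and err: "\<And>k. (\<Sum>w\<in>A. \<mu> w * det_exp n W1 W2 (E w) (\<lambda>ys1 ys2. if good k w (if k then ys1 else ys2) then 0 else 1)) + sqrt \<theta> + \<theta> \<le> eps"
  shows "FLF_code_exists W1 W2 n M eps"
proof -
  define pr where "pr k ys1 ys2 = (if k then ys1 else ys2)" for k and ys1 ys2 :: "'y list"
  define e where "e k w = det_exp n W1 W2 (E w) (\<lambda>ys1 ys2. if good k w (pr k ys1 ys2) then 0 else 1)" for k w
  define p where "p k w w' = det_exp n W1 W2 (E w) (\<lambda>ys1 ys2. if good k w' (pr k ys1 ys2) then 1 else 0)" for k w w'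
  have ge: "0 \<le> det_exp n W1 W2 x f" if "\<And>a b. 0 \<le> f a b" for x f
    using det_exp_mono[OF W, of n "\<lambda>_ _. 0" f x] that det_exp_const[OF W, of n x 0] by simp
  have le: "det_exp n W1 W2 x f \<le> c" if "\<And>a b. f a b \<le> c" for x f c
    using det_exp_mono[OF W, of n f "\<lambda>_ _. c" x] that det_exp_const[OF W, of n x c] by simp
  have "(\<Sum>w\<in>A. \<Sum>w'\<in>A. \<mu> w * \<mu> w' * p k w w') \<le> \<kappa>" for k
  proof -
    have "(\<Sum>w\<in>A. \<Sum>w'\<in>A. \<mu> w * \<mu> w' * p k w w') = (\<Sum>w\<in>A. \<mu> w * det_exp n W1 W2 (E w) (\<lambda>ys1 ys2. \<Sum>w'\<in>A. \<mu> w' * (if good k w' (pr k ys1 ys2) then 1 else 0)))"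
      by (simp add: det_exp_sum det_exp_cmult p_def sum_distrib_left mult.assoc)
    also have "\<dots> \<le> (\<Sum>w\<in>A. \<mu> w * \<kappa>)" by (intro sum_mono mult_left_mono \<mu>(1) le \<kappa>)
    also have "\<dots> = \<kappa>" using \<mu>(2) by (simp flip: sum_distrib_right)
    finally show ?thesis .
  qed
  moreover have "0 \<le> e k w" "e k w \<le> 1" "0 \<le> p k w w'" for k w w'
    unfolding e_def p_def by (auto intro!: ge le)
  ultimately obtain cs where cs: "length cs = M" "\<And>k. (1 / real M) * (\<Sum>i<M. e k (cs ! i) + (\<Sum>j<M. if i = j then 0 else p k (cs ! i) (cs ! j)))
     \<le> (\<Sum>w\<in>A. \<mu> w * e k w) + sqrt \<theta> + \<theta>"
    using ex_good_codebook[OF \<mu> _ _ _ _ M \<theta>, of e p] by blast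
  define enc where "enc i j a b x = (if x = E (cs ! (j - 1)) i a b then 1 else 0 :: real)" for i j a b x
  \<comment> \<open>Messages start at 1 and list positions at 0, hence \<open>j - 1\<close>; the
    default 1 keeps the decoder inside the message set when no codeword passes.\<close>
  define g where "g k ys = (if \<exists>j\<in>{1..M}. good k (cs ! (j - 1)) ys then SOME j. j \<in> {1..M} \<and> good k (cs ! (j - 1)) ys else 1)" for k ys
  have gM: "g k ys \<in> {1..M}" for k ys
  proof (cases "\<exists>j\<in>{1..M}. good k (cs ! (j - 1)) ys")
    case True
    then have "\<exists>j. j \<in> {1..M} \<and> good k (cs ! (j - 1)) ys" by blast
    from someI_ex[OF this] show ?thesis using True by (simp add: g_def)
  qed (use M in \<open>auto simp: g_def\<close>)
  have gg: "good k (cs ! (g k ys - 1)) ys" if "j \<in> {1..M}" "good k (cs ! (j - 1)) ys" for k ys j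
  proof -
    have ex: "\<exists>j. j \<in> {1..M} \<and> good k (cs ! (j - 1)) ys" using that by blast
    from someI_ex[OF this] show ?thesis using that by (auto simp: g_def)
  qed
  have bound: "(1 / real M) * (\<Sum>j\<in>{1..M}. \<Sum>ys1 | length ys1 = n. \<Sum>ys2 | length ys2 = n.
        if g k (pr k ys1 ys2) \<noteq> j then out_prob n enc W1 W2 j ys1 ys2 else 0) \<le> eps" for k
  proof -
    have "(\<Sum>ys1 | length ys1 = n. \<Sum>ys2 | length ys2 = n.
        if g k (pr k ys1 ys2) \<noteq> Suc i then out_prob n enc W1 W2 (Suc i) ys1 ys2 else 0) \<le>
      e k (cs ! i) + (\<Sum>j<M. if i = j then 0 else p k (cs ! i) (cs ! j))" if i: "i < M" for i
    proof -
      have op: "out_prob n enc W1 W2 (Suc i) = out_prob n (\<lambda>i' j a b x. if x = E (cs ! i) i' a b then 1 else 0) W1 W2 0"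
        by (intro ext) (simp add: out_prob_def enc_def)
      have "(\<Sum>ys1 | length ys1 = n. \<Sum>ys2 | length ys2 = n.
        if g k (pr k ys1 ys2) \<noteq> Suc i then out_prob n enc W1 W2 (Suc i) ys1 ys2 else 0) =
        det_exp n W1 W2 (E (cs ! i)) (\<lambda>ys1 ys2. if g k (pr k ys1 ys2) \<noteq> Suc i then 1 else 0)"
        unfolding det_exp_def op by (intro sum.cong) auto
      also have "\<dots> \<le> det_exp n W1 W2 (E (cs ! i)) (\<lambda>ys1 ys2. (if good k (cs ! i) (pr k ys1 ys2) then 0 else 1) +
         (\<Sum>j<M. if i = j then 0 else if good k (cs ! j) (pr k ys1 ys2) then 1 else 0))"
      proof (rule det_exp_mono[OF W])
        fix ys1 ys2
        define y where "y = pr k ys1 ys2"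
        have "1 \<le> (if good k (cs ! i) y then 0 else 1) + (\<Sum>j<M. if i = j then 0 else if good k (cs ! j) y then 1 else 0 :: real)"
          if "g k y \<noteq> Suc i"
        proof (cases "good k (cs ! i) y")
          case True
          then have gd: "good k (cs ! (g k y - 1)) y" using i gg[of "Suc i" k y] by simp
          have "g k y - 1 < M" "g k y - 1 \<noteq> i" using gM[of k y] that by auto
          then have "(if i = g k y - 1 then 0 else if good k (cs ! (g k y - 1)) y then 1 else 0 :: real) \<le> (\<Sum>j<M. if i = j then 0 else if good k (cs ! j) y then 1 else 0)"
            by (intro member_le_sum[of "g k y - 1" "{..<M}" "\<lambda>j. if i = j then 0 else if good k (cs ! j) y then 1 else 0 :: real"]) auto
          then show ?thesis using gd \<open>g k y - 1 \<noteq> i\<close> True by auto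
        next
          case False
          then show ?thesis by (auto intro!: sum_nonneg)
        qed
        moreover have "0 \<le> (if good k (cs ! i) y then 0 else 1) + (\<Sum>j<M. if i = j then 0 else if good k (cs ! j) y then 1 else 0 :: real)"
          by (intro add_nonneg_nonneg sum_nonneg) auto
        ultimately show "(if g k (pr k ys1 ys2) \<noteq> Suc i then 1 else 0) \<le> (if good k (cs ! i) (pr k ys1 ys2) then 0 else 1) +
         (\<Sum>j<M. if i = j then 0 else if good k (cs ! j) (pr k ys1 ys2) then 1 else 0 :: real)"
          unfolding y_def[symmetric] by auto
      qed
      also have "\<dots> = e k (cs ! i) + (\<Sum>j<M. if i = j then 0 else p k (cs ! i) (cs ! j))"
        unfolding det_exp_add det_exp_sum e_def p_def
        by (intro arg_cong2[where f = "(+)"] refl sum.cong) (auto simp: det_exp_const[OF W])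
      finally show ?thesis .
    qed
    then have "(\<Sum>i<M. \<Sum>ys1 | length ys1 = n. \<Sum>ys2 | length ys2 = n.
        if g k (pr k ys1 ys2) \<noteq> Suc i then out_prob n enc W1 W2 (Suc i) ys1 ys2 else 0) \<le>
      (\<Sum>i<M. e k (cs ! i) + (\<Sum>j<M. if i = j then 0 else p k (cs ! i) (cs ! j)))" by (intro sum_mono) auto
    moreover have "(\<Sum>j\<in>{1..M}. H j) = (\<Sum>i<M. H (Suc i))" for H :: "nat \<Rightarrow> real"
      by (simp add: sum.atLeast_Suc_atMost_Suc_shift[symmetric] sum.atLeast1_atMost_eq)
    ultimately have "(1 / real M) * (\<Sum>j\<in>{1..M}. \<Sum>ys1 | length ys1 = n. \<Sum>ys2 | length ys2 = n.
        if g k (pr k ys1 ys2) \<noteq> j then out_prob n enc W1 W2 j ys1 ys2 else 0) \<le>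
      (1 / real M) * (\<Sum>i<M. e k (cs ! i) + (\<Sum>j<M. if i = j then 0 else p k (cs ! i) (cs ! j)))"
      by (simp add: divide_right_mono)
    also have "\<dots> \<le> eps" using cs(2)[of k] err[of k] unfolding e_def pr_def by linarith
    finally show ?thesis .
  qed
  show ?thesis unfolding FLF_code_exists_def
  proof (intro conjI exI allI)
    show "valid_encoder enc" unfolding enc_def by (rule valid_det_encoder)
    show "err_prob1 n M enc W1 W2 (g True) \<le> eps" using bound[of True] unfolding err_prob1_def pr_def by simp
    show "err_prob2 n M enc W1 W2 (g False) \<le> eps" using bound[of False] unfolding err_prob2_def pr_def by simp
  qed (use M gM in auto)
qed

lemma path_exp_iid:
  "path_exp n (\<lambda>_. \<rho>) f = (\<Sum>rs | length rs = n. (\<Prod>i<n. \<rho> (rs ! i)) * f rs)"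
proof (induction n arbitrary: f)
  case (Suc n)
  have "path_exp (Suc n) (\<lambda>_. \<rho>) f = (\<Sum>rs | length rs = n. (\<Prod>i<n. \<rho> (rs ! i)) * (\<Sum>r\<in>UNIV. \<rho> r * f (rs @ [r])))"
    using Suc by simp
  also have "\<dots> = (\<Sum>rs | length rs = Suc n. (\<Prod>i<Suc n. \<rho> (rs ! i)) * f rs)"
    unfolding sum_lists_Suc by (intro sum.cong refl) (simp add: nth_append sum_distrib_left mult.assoc)
  finally show ?case .
qed simp

lemma path_exp_iid_prod:
  "path_exp n (\<lambda>_. \<rho>) (\<lambda>rs. \<Prod>i<n. F i (rs ! i)) = (\<Prod>i<n. \<Sum>r\<in>UNIV. \<rho> r * F i r)"
proof (induction n)
  case (Suc n)
  have "path_exp (Suc n) (\<lambda>_. \<rho>) (\<lambda>rs. \<Prod>i<Suc n. F i (rs ! i)) =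
     path_exp n (\<lambda>_. \<rho>) (\<lambda>rs. (\<Sum>r\<in>UNIV. \<rho> r * F n r) * (\<Prod>i<n. F i (rs ! i)))"
    unfolding path_exp.simps by (rule path_exp_cong) (simp add: nth_append sum_distrib_left sum_distrib_right mult_ac)
  then show ?case unfolding path_exp_cmult Suc by simp
qed simp

text \<open>Revealing the letters of a random codeword one at a time turns the codebook average of the
  output laws into a single path law.\<close>
lemma path_exp_codeword:
  "path_exp n (\<lambda>_. \<rho>) (\<lambda>rs. det_exp n W1 W2 (\<lambda>i a b. inp (take i rs) (rs ! i) a b) (f rs)) =
   path_exp n (\<lambda>zs (r, y1, y2). \<rho> r * W1 (inp (map fst zs) r (outs1 zs) (outs2 zs)) y1 * W2 (inp (map fst zs) r (outs1 zs) (outs2 zs)) y2)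
     (\<lambda>zs. f (map fst zs) (outs1 zs) (outs2 zs))"
proof (induction n arbitrary: f)
  case (Suc n)
  define K where "K zs z = (case z of (r, y1, y2) \<Rightarrow> \<rho> r * W1 (inp (map fst zs) r (outs1 zs) (outs2 zs)) y1 * W2 (inp (map fst zs) r (outs1 zs) (outs2 zs)) y2)" for zs z
  define F where "F rs ys1 ys2 = (\<Sum>r\<in>UNIV. \<Sum>y1\<in>UNIV. \<Sum>y2\<in>UNIV. \<rho> r * W1 (inp rs r ys1 ys2) y1 * W2 (inp rs r ys1 ys2) y2 * f (rs @ [r]) (ys1 @ [y1]) (ys2 @ [y2]))" for rs ys1 ys2
  have "path_exp (Suc n) (\<lambda>_. \<rho>) (\<lambda>rs. det_exp (Suc n) W1 W2 (\<lambda>i a b. inp (take i rs) (rs ! i) a b) (f rs)) =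
     path_exp n (\<lambda>_. \<rho>) (\<lambda>rs. det_exp n W1 W2 (\<lambda>i a b. inp (take i rs) (rs ! i) a b) (F rs))"
    unfolding path_exp.simps
  proof (rule path_exp_cong)
    fix rs :: "'a list" assume len: "length rs = n"
    define G where "G r ys1 ys2 = (\<Sum>y1\<in>UNIV. \<Sum>y2\<in>UNIV.
        W1 (inp rs r ys1 ys2) y1 * W2 (inp rs r ys1 ys2) y2 * f (rs @ [r]) (ys1 @ [y1]) (ys2 @ [y2]))" for r ys1 ys2
    have FG: "F rs = (\<lambda>ys1 ys2. \<Sum>r\<in>UNIV. \<rho> r * G r ys1 ys2)"
      unfolding F_def G_def by (simp add: sum_distrib_left mult.assoc)
    have "det_exp (Suc n) W1 W2 (\<lambda>i a b. inp (take i (rs @ [r])) ((rs @ [r]) ! i) a b) (f (rs @ [r])) =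
      det_exp n W1 W2 (\<lambda>i a b. inp (take i rs) (rs ! i) a b) (G r)" for r
      unfolding det_exp_Suc by (rule det_exp_cong) (use len in \<open>auto simp: nth_append G_def\<close>)
    then show "(\<Sum>r\<in>UNIV. \<rho> r * det_exp (Suc n) W1 W2 (\<lambda>i a b. inp (take i (rs @ [r])) ((rs @ [r]) ! i) a b) (f (rs @ [r]))) =
      det_exp n W1 W2 (\<lambda>i a b. inp (take i rs) (rs ! i) a b) (F rs)"
      unfolding FG det_exp_sum det_exp_cmult by simp
  qed
  also have "\<dots> = path_exp n K (\<lambda>zs. F (map fst zs) (outs1 zs) (outs2 zs))"
    unfolding Suc K_def ..
  also have "\<dots> = path_exp (Suc n) K (\<lambda>zs. f (map fst zs) (outs1 zs) (outs2 zs))"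
    unfolding path_exp.simps by (rule path_exp_cong) (simp add: F_def sum_UNIV_triple K_def)
  finally show ?case unfolding K_def .
qed simp

section \<open>The steering scheme\<close>

text \<open>These are the requirements at a fixed \<open>n\<close>. Each first-phase deviation is
  below 2 (2b + 2) sqrt (n ln n) except with probability at most 1/n. \<open>D_range\<close> lets
  the second phase undo an imbalance of that size, and \<open>t_range\<close> lets a full tilt lift
  the favoured receiver to \<open>t\<close> even if weighted sum and imbalance are both that
  unfavourable. \<open>\<sigma>_small\<close> keeps the tilted laws within a factor 2 of
  \<open>Pstar\<close>.\<close>

locale steering_scheme = cm_dmbc W1 W2 Pstar
  for W1 W2 :: "'x::finite \<Rightarrow> 'y::finite \<Rightarrow> real" and Pstar :: "'x \<Rightarrow> real" +
  fixes v :: "'x \<Rightarrow> real" and n B :: nat and \<sigma> t b :: real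
  assumes v_sum: "(\<Sum>x\<in>UNIV. v x) = 0"
    and dI_v: "dI W1 Pstar v = 1 - \<eta>" "dI W2 Pstar v = - \<eta>"
    and B_le: "B \<le> n" and B_ge: "ln (real n) \<le> real B" "1 \<le> B"
    and \<sigma>_pos: "\<sigma> > 0" and \<sigma>_small: "\<And>x. \<sigma> * \<bar>v x\<bar> \<le> Pstar x / 2"
    and b_pos: "b > 0" and b_bound: "\<And>x y. \<bar>info_dens Pstar W1 x y\<bar> \<le> b" "\<And>x y. \<bar>info_dens Pstar W2 x y\<bar> \<le> b"
      "\<And>x y1 y2. \<bar>comb x y1 y2\<bar> \<le> b"
    and D_range: "2 * (2 * b + 2) * sqrt (real n * ln (real n)) \<le> real B * \<sigma>"
    and t_range: "t \<le> real B * \<sigma> * \<eta> - 2 * (2 * (2 * b + 2) * sqrt (real n * ln (real n)))"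
      "t \<le> real B * \<sigma> * (1 - \<eta>) - 2 * (2 * (2 * b + 2) * sqrt (real n * ln (real n)))"
begin

definition "n1 = n - B"
text \<open>A deviation \<open>a1\<close> only has to be within reach of the tilt, whereas
  \<open>a2\<close>, the deviation of the second phase, can no longer be corrected and is paid for
  in \<open>target\<close>.\<close>

definition "a1 = 2 * (2 * b + 2) * sqrt (real n * ln (real n))"
definition "a2 = 2 * (2 * b + 2) * sqrt (real B * ln (real n))"
definition "Wc k = (if k then W1 else W2)"
definition "chi k = (\<Sum>y\<in>UNIV. (outd v (Wc k) y)\<^sup>2 / outd Pstar (Wc k) y)"
definition "tilt s x = Pstar x + s * v x"
definition "dst i \<tau> = (if i < n1 then Pstar else if i < n1 + \<tau> then tilt \<sigma> else tilt (- \<sigma>))"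
text \<open>A codeword letter is a triple: its input for the first phase and its inputs for the two opposite
  tilts of the second phase, which switches from the first to the second tilt after \<open>\<tau>\<close> steps.\<close>
definition sel :: "nat \<Rightarrow> nat \<Rightarrow> 'x \<times> 'x \<times> 'x \<Rightarrow> 'x" where
  "sel i \<tau> r = (if i < n1 then fst r else if i < n1 + \<tau> then fst (snd r) else snd (snd r))"
definition \<rho> :: "'x \<times> 'x \<times> 'x \<Rightarrow> real" where
  "\<rho> r = Pstar (fst r) * tilt \<sigma> (fst (snd r)) * tilt (- \<sigma>) (snd (snd r))"
definition acc :: "bool \<Rightarrow> ('x \<times> 'x \<times> 'x) list \<Rightarrow> 'y list \<Rightarrow> real" where
  "acc k rs ys = (\<Sum>i<n1. info_dens Pstar (Wc k) (fst (rs ! i)) (ys ! i))"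
text \<open>The switching time: if the weighted information exceeds the target, it balances the two receivers;
  otherwise all of the second phase is spent on the receiver favoured by the coin \<open>c\<close>.\<close>
definition tau :: "bool \<Rightarrow> ('x \<times> 'x \<times> 'x) list \<Rightarrow> 'y list \<Rightarrow> 'y list \<Rightarrow> nat" where
  "tau c rs ys1 ys2 =
    (if \<eta> * acc True rs ys1 + (1 - \<eta>) * acc False rs ys2 - real n1 * C > t
     then min B (nat \<lfloor>(real B - (acc True rs ys1 - acc False rs ys2) / \<sigma>) / 2\<rfloor>)
     else if c then B else 0)"
definition inp :: "bool \<Rightarrow> ('x \<times> 'x \<times> 'x) list \<Rightarrow> 'x \<times> 'x \<times> 'x \<Rightarrow> 'y list \<Rightarrow> 'y list \<Rightarrow> 'x" where
  "inp c rs r ys1 ys2 = sel (length rs) (tau c rs ys1 ys2) r"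
definition K :: "bool \<Rightarrow> (('x \<times> 'x \<times> 'x) \<times> 'y \<times> 'y) list \<Rightarrow> ('x \<times> 'x \<times> 'x) \<times> 'y \<times> 'y \<Rightarrow> real" where
  "K c = (\<lambda>zs (r, y1, y2). \<rho> r * W1 (inp c (map fst zs) r (outs1 zs) (outs2 zs)) y1
      * W2 (inp c (map fst zs) r (outs1 zs) (outs2 zs)) y2)"
text \<open>Decoding uses likelihood ratios, because \<open>info_dens\<close> is 0 instead of minus infinity where \<open>W x y = 0\<close>.\<close>
definition ratio :: "bool \<Rightarrow> nat \<Rightarrow> ('x \<times> 'x \<times> 'x) list \<Rightarrow> 'y list \<Rightarrow> real" where
  "ratio k \<tau> rs ys = (\<Prod>i<n. Wc k (sel i \<tau> (rs ! i)) (ys ! i) / outd (dst i \<tau>) (Wc k) (ys ! i))"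
text \<open>The deductions are 2 \<sigma> for rounding the switching time to an integer, the
  quadratic loss of the tilts, and the deviation of the second phase. Adding both \<open>chi\<close>
  makes the target common to the two receivers.\<close>

definition "target = real n * C + t - 2 * \<sigma> - real B * \<sigma>\<^sup>2 * (chi True + chi False) - a2"
definition good :: "bool \<Rightarrow> bool \<times> ('x \<times> 'x \<times> 'x) list \<Rightarrow> 'y list \<Rightarrow> bool" where
  "good k w ys = (\<exists>\<tau>\<le>B. ratio k \<tau> (snd w) ys > exp target)"
definition obs :: "bool \<Rightarrow> ('x \<times> 'x \<times> 'x) \<times> 'y \<times> 'y \<Rightarrow> 'y" where
  "obs k z = (if k then fst (snd z) else snd (snd z))"
definition "tz c zs = tau c (map fst zs) (outs1 zs) (outs2 zs)"
definition "Ssum zs = psum (\<lambda>_ (r, y1, y2). comb (fst r) y1 y2) (take n1 zs)"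
definition "Dsum zs = psum (\<lambda>_ (r, y1, y2). info_dens Pstar W1 (fst r) y1 - info_dens Pstar W2 (fst r) y2) (take n1 zs)"

section \<open>Single-letter laws of the steered inputs\<close>

lemma channel_Wc: "is_channel (Wc k)"
  using W1 W2 by (simp add: Wc_def)

lemma tilt_bounds:
  assumes "\<bar>s\<bar> \<le> \<sigma>"
  shows "Pstar x / 2 \<le> tilt s x" "tilt s x \<le> 2 * Pstar x"
proof -
  have "\<bar>s * v x\<bar> \<le> \<sigma> * \<bar>v x\<bar>" unfolding abs_mult using assms by (intro mult_right_mono) auto
  then have "\<bar>s * v x\<bar> \<le> Pstar x / 2" using \<sigma>_small[of x] by linarith
  then show "Pstar x / 2 \<le> tilt s x" "tilt s x \<le> 2 * Pstar x"
    unfolding tilt_def using Pstar_pos[of x] by linarith+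
qed

lemma dist_tilt:
  assumes "\<bar>s\<bar> \<le> \<sigma>" shows "is_dist (tilt s)"
proof -
  have "0 \<le> tilt s x" for x using tilt_bounds(1)[OF assms, of x] Pstar_pos[of x] by linarith
  moreover have "(\<Sum>x\<in>UNIV. tilt s x) = 1"
    using Pstar_dist v_sum by (simp add: is_dist_def tilt_def sum.distrib flip: sum_distrib_left)
  ultimately show ?thesis by (simp add: is_dist_def)
qed

lemma dst_bounds: "Pstar x / 2 \<le> dst i \<tau> x" "dst i \<tau> x \<le> 2 * Pstar x"
  using tilt_bounds[of \<sigma> x] tilt_bounds[of "- \<sigma>" x] \<sigma>_pos Pstar_pos[of x] by (auto simp: dst_def)

lemma dst_pos: "dst i \<tau> x > 0"
  using dst_bounds(1)[of x i \<tau>] Pstar_pos[of x] by linarith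

lemma dist_dst: "is_dist (dst i \<tau>)"
  using dist_tilt[of \<sigma>] dist_tilt[of "- \<sigma>"] \<sigma>_pos Pstar_dist by (auto simp: dst_def)

text \<open>The components of a letter are independent, so the two that are not selected integrate
  to 1.\<close>

lemma sum_rho_sel: "(\<Sum>r\<in>UNIV. \<rho> r * G (sel i \<tau> r)) = (\<Sum>x\<in>UNIV. dst i \<tau> x * G x)"
proof -
  have one: "(\<Sum>x\<in>UNIV. tilt \<sigma> x) = 1" "(\<Sum>x\<in>UNIV. tilt (- \<sigma>) x) = 1" "(\<Sum>x\<in>UNIV. Pstar x) = 1"
    using dist_tilt[of \<sigma>] dist_tilt[of "- \<sigma>"] \<sigma>_pos Pstar_dist by (auto simp: is_dist_def)
  have fac: "(\<Sum>x\<in>UNIV. \<Sum>y\<in>UNIV. \<Sum>z\<in>UNIV. f x * g y * h z) = (\<Sum>x\<in>UNIV. f x) * (\<Sum>y\<in>UNIV. g y) * (\<Sum>z\<in>UNIV. h z)"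
    for f g h :: "'x \<Rightarrow> real"
    by (simp flip: sum_distrib_left sum_distrib_right)
  consider "i < n1" | "\<not> i < n1" "i < n1 + \<tau>" | "\<not> i < n1" "\<not> i < n1 + \<tau>" by blast
  then show ?thesis
  proof cases
    case 1
    then have "(\<Sum>r\<in>UNIV. \<rho> r * G (sel i \<tau> r)) = (\<Sum>x\<in>UNIV. \<Sum>y\<in>UNIV. \<Sum>z\<in>UNIV. (Pstar x * G x) * tilt \<sigma> y * tilt (- \<sigma>) z)"
      by (simp add: sum_UNIV_triple \<rho>_def sel_def mult_ac)
    then show ?thesis using 1 unfolding fac one by (simp add: dst_def)
  next
    case 2
    then have "(\<Sum>r\<in>UNIV. \<rho> r * G (sel i \<tau> r)) = (\<Sum>x\<in>UNIV. \<Sum>y\<in>UNIV. \<Sum>z\<in>UNIV. Pstar x * (tilt \<sigma> y * G y) * tilt (- \<sigma>) z)"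
      by (simp add: sum_UNIV_triple \<rho>_def sel_def mult_ac)
    then show ?thesis using 2 unfolding fac one by (simp add: dst_def)
  next
    case 3
    then have "(\<Sum>r\<in>UNIV. \<rho> r * G (sel i \<tau> r)) = (\<Sum>x\<in>UNIV. \<Sum>y\<in>UNIV. \<Sum>z\<in>UNIV. Pstar x * tilt \<sigma> y * (tilt (- \<sigma>) z * G z))"
      by (simp add: sum_UNIV_triple \<rho>_def sel_def mult_ac)
    then show ?thesis using 3 unfolding fac one by (simp add: dst_def)
  qed
qed

lemma rho_nonneg: "0 \<le> \<rho> r"
  unfolding \<rho>_def using dist_tilt[of \<sigma>] dist_tilt[of "- \<sigma>"] \<sigma>_pos Pstar_dist by (auto simp: is_dist_def)

lemma rho_sum: "(\<Sum>r\<in>UNIV. \<rho> r) = 1"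
  using sum_rho_sel[of "\<lambda>_. 1" 0 0] dist_dst[of 0 0] by (simp add: is_dist_def)

lemma stoch_rho: "stoch_kernel (\<lambda>_. \<rho>)"
  by (simp add: stoch_kernel_def rho_nonneg rho_sum)

text \<open>The switching time is a function of the past and the fresh letter is independent of the
  past, so conditionally the selection acts as with a fixed time.\<close>

lemma sum_K:
  "(\<Sum>z\<in>UNIV. K c zs z * F (sel (length zs) (tz c zs) (fst z)) (fst (snd z)) (snd (snd z))) =
   (\<Sum>x\<in>UNIV. dst (length zs) (tz c zs) x * (\<Sum>y1\<in>UNIV. \<Sum>y2\<in>UNIV. W1 x y1 * W2 x y2 * F x y1 y2))"
  unfolding sum_rho_sel[symmetric]
  by (simp add: sum_UNIV_triple K_def inp_def tz_def sum_distrib_left mult.assoc)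

lemma stoch_K: "stoch_kernel (K c)"
  unfolding stoch_kernel_def
proof (intro conjI allI)
  fix zs z
  show "0 \<le> K c zs z" by (auto simp: K_def rho_nonneg W1_nonneg W2_nonneg split: prod.split)
  show "(\<Sum>z\<in>UNIV. K c zs z) = 1"
    using sum_K[of c zs "\<lambda>_ _ _. 1"] dist_dst by (simp add: W1_sum W2_sum is_dist_def flip: sum_distrib_left)
qed

lemma sum_K_obs:
  "(\<Sum>z\<in>UNIV. K c zs z * F (sel (length zs) (tz c zs) (fst z)) (obs k z)) =
   (\<Sum>x\<in>UNIV. dst (length zs) (tz c zs) x * (\<Sum>y\<in>UNIV. Wc k x y * F x y))"
proof (cases k)
  case True
  have "(\<Sum>z\<in>UNIV. K c zs z * F (sel (length zs) (tz c zs) (fst z)) (obs k z)) =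
    (\<Sum>x\<in>UNIV. dst (length zs) (tz c zs) x * (\<Sum>y1\<in>UNIV. \<Sum>y2\<in>UNIV. W1 x y1 * W2 x y2 * (F x y1 + 0)))"
    using sum_K[of c zs "\<lambda>x y1 y2. F x y1"] True by (simp add: obs_def)
  then show ?thesis unfolding sum_product_mean[OF W1_sum W2_sum] using True by (simp add: Wc_def)
next
  case False
  have "(\<Sum>z\<in>UNIV. K c zs z * F (sel (length zs) (tz c zs) (fst z)) (obs k z)) =
    (\<Sum>x\<in>UNIV. dst (length zs) (tz c zs) x * (\<Sum>y1\<in>UNIV. \<Sum>y2\<in>UNIV. W1 x y1 * W2 x y2 * (0 + F x y2)))"
    using sum_K[of c zs "\<lambda>x y1 y2. F x y2"] False by (simp add: obs_def)
  then show ?thesis unfolding sum_product_mean[OF W1_sum W2_sum] using False by (simp add: Wc_def)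
qed

lemma mutual_info_as_mean: "mutual_info P W = (\<Sum>x\<in>UNIV. P x * (\<Sum>y\<in>UNIV. W x y * info_dens P W x y))"
  by (simp add: mutual_info_def mean_info_dens)

lemma info_dens_dst_bound: "\<bar>info_dens (dst i \<tau>) (Wc k) x y\<bar> \<le> b + 1"
proof -
  have "\<bar>info_dens (dst i \<tau>) (Wc k) x y\<bar> \<le> \<bar>info_dens Pstar (Wc k) x y\<bar> + 1"
    by (rule info_dens_comparable[where R = Pstar, OF channel_Wc Pstar_pos dst_bounds])
  also have "\<bar>info_dens Pstar (Wc k) x y\<bar> \<le> b" using b_bound by (simp add: Wc_def)
  finally show ?thesis by simp
qed

lemma mutual_info_dst_bound: "\<bar>mutual_info (dst i \<tau>) (Wc k)\<bar> \<le> b + 1"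
proof -
  have W: "(\<Sum>y\<in>UNIV. Wc k x y) = 1" "0 \<le> Wc k x y" for x y using channel_Wc[of k] by (auto simp: is_channel_def)
  have d: "(\<Sum>x\<in>UNIV. dst i \<tau> x) = 1" "0 \<le> dst i \<tau> x" for x using dist_dst[of i \<tau>] by (auto simp: is_dist_def)
  have "\<bar>mutual_info (dst i \<tau>) (Wc k)\<bar> \<le> (\<Sum>x\<in>UNIV. dst i \<tau> x * (\<Sum>y\<in>UNIV. Wc k x y * (b + 1)))"
    unfolding mutual_info_as_mean
  proof (rule order_trans[OF sum_abs sum_mono])
    fix x
    have "\<bar>\<Sum>y\<in>UNIV. Wc k x y * info_dens (dst i \<tau>) (Wc k) x y\<bar> \<le> (\<Sum>y\<in>UNIV. Wc k x y * (b + 1))"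
      by (rule order_trans[OF sum_abs sum_mono]) (auto simp: abs_mult W intro!: mult_left_mono info_dens_dst_bound)
    then show "\<bar>dst i \<tau> x * (\<Sum>y\<in>UNIV. Wc k x y * info_dens (dst i \<tau>) (Wc k) x y)\<bar> \<le> dst i \<tau> x * (\<Sum>y\<in>UNIV. Wc k x y * (b + 1))"
      by (simp add: abs_mult d mult_left_mono)
  qed
  also have "\<dots> = b + 1" by (simp add: W d flip: sum_distrib_right)
  finally show ?thesis .
qed

text \<open>For fixed outputs and a fixed switching time the likelihood ratio of an independent
  codeword has mean at most 1; Markov's inequality and a union over the B + 1 switching times do the
  rest.\<close>

lemma confusion_bound:
  "path_exp n (\<lambda>_. \<rho>) (\<lambda>rs. if good k (c, rs) ys then 1 else 0) \<le> (real B + 1) / exp target"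
proof -
  have W0: "0 \<le> Wc k x y" for x y using channel_Wc[of k] by (simp add: is_channel_def)
  have o0: "0 \<le> outd (dst i \<tau>) (Wc k) y" for i \<tau> y
    using is_dist_outd[OF dist_dst channel_Wc] by (simp add: is_dist_def)
  have ratio0: "0 \<le> ratio k \<tau> rs ys" for \<tau> rs unfolding ratio_def by (intro prod_nonneg ballI divide_nonneg_nonneg W0 o0)
  have mean: "path_exp n (\<lambda>_. \<rho>) (\<lambda>rs. ratio k \<tau> rs ys) \<le> 1" for \<tau>
  proof -
    have "path_exp n (\<lambda>_. \<rho>) (\<lambda>rs. ratio k \<tau> rs ys) =
      (\<Prod>i<n. \<Sum>r\<in>UNIV. \<rho> r * (Wc k (sel i \<tau> r) (ys ! i) / outd (dst i \<tau>) (Wc k) (ys ! i)))"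
      unfolding ratio_def by (rule path_exp_iid_prod)
    also have "\<dots> = (\<Prod>i<n. \<Sum>x\<in>UNIV. dst i \<tau> x * (Wc k x (ys ! i) / outd (dst i \<tau>) (Wc k) (ys ! i)))"
      by (simp only: sum_rho_sel[where G = "\<lambda>x. Wc k x _ / _"])
    also have "\<dots> = (\<Prod>i<n. outd (dst i \<tau>) (Wc k) (ys ! i) / outd (dst i \<tau>) (Wc k) (ys ! i))"
    proof -
      have "(\<Sum>x\<in>UNIV. dst i \<tau> x * (Wc k x y / q)) = outd (dst i \<tau>) (Wc k) y / q" for i y q
        by (simp add: outd_def sum_divide_distrib)
      then show ?thesis by simp
    qed
    \<comment> \<open>Each factor is 1, or 0 by division by zero when the output is
      impossible.\<close>
    also have "\<dots> \<le> 1" by (rule prod_le_1) auto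
    finally show ?thesis .
  qed
  have "path_exp n (\<lambda>_. \<rho>) (\<lambda>rs. if good k (c, rs) ys then 1 else 0) \<le>
    path_exp n (\<lambda>_. \<rho>) (\<lambda>rs. \<Sum>\<tau>\<in>{..B}. 1 / exp target * ratio k \<tau> rs ys)"
  proof (rule path_exp_mono[OF rho_nonneg])
    fix rs
    have "1 \<le> (\<Sum>\<tau>\<in>{..B}. 1 / exp target * ratio k \<tau> rs ys)" if gd: "good k (c, rs) ys"
    proof -
      obtain \<tau> where \<tau>: "\<tau> \<le> B" "ratio k \<tau> rs ys > exp target" using gd unfolding good_def by auto
      have "1 \<le> 1 / exp target * ratio k \<tau> rs ys" using \<tau>(2) by simp
      also have "\<dots> \<le> (\<Sum>\<tau>\<in>{..B}. 1 / exp target * ratio k \<tau> rs ys)"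
        using \<tau>(1) ratio0 by (intro member_le_sum[of \<tau> "{..B}" "\<lambda>\<tau>. 1 / exp target * ratio k \<tau> rs ys"]) auto
      finally show ?thesis .
    qed
    then show "(if good k (c, rs) ys then 1 else 0) \<le> (\<Sum>\<tau>\<in>{..B}. 1 / exp target * ratio k \<tau> rs ys)"
      using ratio0 by (auto intro!: sum_nonneg)
  qed
  also have "\<dots> = (\<Sum>\<tau>\<in>{..B}. 1 / exp target * path_exp n (\<lambda>_. \<rho>) (\<lambda>rs. ratio k \<tau> rs ys))"
    unfolding path_exp_sum path_exp_cmult ..
  also have "\<dots> \<le> (\<Sum>\<tau>\<in>{..B}. 1 / exp target * 1)" by (intro sum_mono mult_left_mono mean) auto
  also have "\<dots> = (real B + 1) / exp target" by simp
  finally show ?thesis .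
qed

section \<open>Decomposition and concentration of the accumulated information\<close>

lemma acc_take:
  assumes "n1 \<le> i" "i \<le> length zs"
  shows "acc k (map fst (take i zs)) (map f (take i zs)) = acc k (map fst zs) (map f zs)"
  unfolding acc_def using assms by (intro sum.cong) auto

lemma tz_take:
  assumes "n1 \<le> i" "i \<le> length zs"
  shows "tz c (take i zs) = tz c zs"
  unfolding tz_def tau_def using acc_take[OF assms] by simp

text \<open>During the first phase \<open>tau\<close> is evaluated on lists that are too short and
  its value is meaningless, but there \<open>sel\<close> ignores it; from time \<open>n1\<close> on
  it no longer changes.\<close>

lemma sel_tz_take: "i < length zs \<Longrightarrow> sel i (tz c (take i zs)) = sel i (tz c zs)"
  using tz_take[of i zs c] by (cases "i < n1") (auto simp: sel_def fun_eq_iff)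

lemma dst_tz_take: "i < length zs \<Longrightarrow> dst i (tz c (take i zs)) = dst i (tz c zs)"
  using tz_take[of i zs c] by (cases "i < n1") (auto simp: dst_def fun_eq_iff)

lemma tau_le: "tau c rs ys1 ys2 \<le> B"
  by (auto simp: tau_def)

lemma Ssum_eq:
  assumes "length zs = n"
  shows "Ssum zs = \<eta> * acc True (map fst zs) (outs1 zs) + (1 - \<eta>) * acc False (map fst zs) (outs2 zs) - real n1 * C"
  using assms by (simp add: Ssum_def psum_def acc_def comb_def Wc_def n1_def split_beta sum_subtractf sum.distrib sum_distrib_left)

lemma Dsum_eq:
  assumes "length zs = n"
  shows "Dsum zs = acc True (map fst zs) (outs1 zs) - acc False (map fst zs) (outs2 zs)"
  using assms by (simp add: Dsum_def psum_def acc_def Wc_def n1_def split_beta sum_subtractf)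

text \<open>The shortfall of information, mean minus density, so that an upper tail bound applies.
  It is 0 in the first phase, whose fluctuations are handled by steering; only B increments then
  enter the concentration inequality.\<close>

definition "dev k c zs z = (if length zs < n1 then 0 else
   mutual_info (dst (length zs) (tz c zs)) (Wc k) - info_dens (dst (length zs) (tz c zs)) (Wc k) (sel (length zs) (tz c zs) (fst z)) (obs k z))"

definition "info k \<tau> zs = (\<Sum>i<n. info_dens (dst i \<tau>) (Wc k) (sel i \<tau> (fst (zs ! i))) (obs k (zs ! i)))"

lemma dev_mean: "(\<Sum>z\<in>UNIV. K c zs z * dev k c zs z) = 0"
proof (cases "length zs < n1")
  case False
  define d where "d = dst (length zs) (tz c zs)"
  have "(\<Sum>z\<in>UNIV. K c zs z * dev k c zs z) = (\<Sum>z\<in>UNIV. K c zs z) * mutual_info d (Wc k)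
     - (\<Sum>z\<in>UNIV. K c zs z * info_dens d (Wc k) (sel (length zs) (tz c zs) (fst z)) (obs k z))"
    using False by (simp add: dev_def d_def right_diff_distrib sum_subtractf sum_distrib_right)
  also have "\<dots> = 0"
    using sum_K_obs[of c zs "info_dens d (Wc k)" k] by (simp add: stoch_kernel_sum[OF stoch_K] mutual_info_as_mean d_def)
  finally show ?thesis .
qed (simp add: dev_def)

lemma dev_bound: "length zs < n \<Longrightarrow> \<bar>dev k c zs z\<bar> \<le> (if length zs \<in> {n1..<n} then 2 * b + 2 else 0)"
  using mutual_info_dst_bound[of "length zs" "tz c zs" k] info_dens_dst_bound[of "length zs" "tz c zs" k "sel (length zs) (tz c zs) (fst z)" "obs k z"]
  by (auto simp: dev_def)

lemma tail_dev: "path_exp n (K c) (\<lambda>zs. if psum (dev k c) zs \<ge> a2 then 1 else 0) \<le> 1 / real n"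
  unfolding a2_def
  by (rule path_exp_azuma_tail[OF stoch_K dev_bound dev_mean]) (use b_pos B_ge B_le in \<open>auto simp: n1_def\<close>)

lemma phase1_mean:
  assumes "length zs < n1" "\<And>x. (\<Sum>y1\<in>UNIV. \<Sum>y2\<in>UNIV. W1 x y1 * W2 x y2 * F x y1 y2) = m x"
  shows "(\<Sum>z\<in>UNIV. K c zs z * (case z of (r, y1, y2) \<Rightarrow> F (fst r) y1 y2)) = (\<Sum>x\<in>UNIV. Pstar x * m x)"
proof -
  have "(\<Sum>z\<in>UNIV. K c zs z * (case z of (r, y1, y2) \<Rightarrow> F (fst r) y1 y2)) =
    (\<Sum>z\<in>UNIV. K c zs z * F (sel (length zs) (tz c zs) (fst z)) (fst (snd z)) (snd (snd z)))"
    using assms(1) by (intro sum.cong) (auto simp: sel_def)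
  also have "\<dots> = (\<Sum>x\<in>UNIV. Pstar x * m x)" unfolding sum_K assms(2) using assms(1) by (simp add: dst_def)
  finally show ?thesis .
qed

lemma n1_le: "n1 \<le> n" by (simp add: n1_def)

text \<open>First-phase inputs are i.i.d., so it suffices that the means given the input average to
  0 under \<open>Pstar\<close>. The difference of the two densities needs this form, as its mean
  given \<open>x\<close> need not vanish.\<close>

lemma azuma_phase1:
  assumes F: "\<And>x y1 y2. \<bar>F x y1 y2\<bar> \<le> 2 * b + 2"
    and m: "\<And>x. (\<Sum>y1\<in>UNIV. \<Sum>y2\<in>UNIV. W1 x y1 * W2 x y2 * F x y1 y2) = m x" "(\<Sum>x\<in>UNIV. Pstar x * m x) = 0"
  shows "path_exp n (K c) (\<lambda>zs. if psum (\<lambda>_ (r, y1, y2). F (fst r) y1 y2) (take n1 zs) \<ge> a1 then 1 else 0) \<le> 1 / real n"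
proof -
  have n: "n \<ge> 1" using B_ge B_le by linarith
  have "path_exp n (K c) (\<lambda>zs. if psum (\<lambda>_ (r, y1, y2). F (fst r) y1 y2) (take n1 zs) \<ge> a1 then 1 else 0) =
    path_exp n1 (K c) (\<lambda>zs. if psum (\<lambda>_ (r, y1, y2). F (fst r) y1 y2) zs \<ge> a1 then 1 else 0)"
    by (rule path_exp_take[OF stoch_K n1_le])
  also have "\<dots> \<le> 1 / real n" unfolding a1_def
  proof (rule path_exp_azuma_tail[OF stoch_K, where I = "{..<n1}"])
    fix zs :: "(('x \<times> 'x \<times> 'x) \<times> 'y \<times> 'y) list" assume zs: "length zs < n1"
    show "(\<Sum>z\<in>UNIV. K c zs z * (case z of (r, y1, y2) \<Rightarrow> F (fst r) y1 y2)) = 0"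
      using phase1_mean[OF zs m(1)] m(2) by simp
    fix z show "\<bar>case z of (r, y1, y2) \<Rightarrow> F (fst r) y1 y2\<bar> \<le> (if length zs \<in> {..<n1} then 2 * b + 2 else 0)"
      using zs F by (auto split: prod.split)
  next
    show "ln (real n) \<le> real n" using n ln_le_minus_one[of "real n"] by simp
  qed (use b_pos n n1_le in auto)
  finally show ?thesis .
qed

lemma tail_Ssum: "path_exp n (K c) (\<lambda>zs. if - Ssum zs \<ge> a1 then 1 else 0) \<le> 1 / real n"
proof -
  have "path_exp n (K c) (\<lambda>zs. if psum (\<lambda>_ (r, y1, y2). - comb (fst r) y1 y2) (take n1 zs) \<ge> a1 then 1 else 0) \<le> 1 / real n"
  proof (rule azuma_phase1[where m = "\<lambda>_. 0"])
    show "\<bar>- comb x y1 y2\<bar> \<le> 2 * b + 2" for x y1 y2 using b_bound(3)[of x y1 y2] b_pos by simp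
    show "(\<Sum>y1\<in>UNIV. \<Sum>y2\<in>UNIV. W1 x y1 * W2 x y2 * - comb x y1 y2) = 0" for x
      using comb_mean[of x] by (simp add: sum_negf)
  qed simp
  moreover have "psum (\<lambda>_ (r, y1, y2). - comb (fst r) y1 y2) (take n1 zs) = - Ssum zs" for zs :: "(('x \<times> 'x \<times> 'x) \<times> 'y \<times> 'y) list"
    by (simp add: psum_def Ssum_def split_beta sum_negf)
  ultimately show ?thesis by simp
qed

lemma tail_Dsum:
  assumes "s = 1 \<or> s = - 1"
  shows "path_exp n (K c) (\<lambda>zs. if s * Dsum zs \<ge> a1 then 1 else 0) \<le> 1 / real n"
proof -
  define F where "F x y1 y2 = s * info_dens Pstar W1 x y1 + (- s) * info_dens Pstar W2 x y2" for x y1 y2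
  define m where "m x = s * KL (W1 x) (outd Pstar W1) + (- s) * KL (W2 x) (outd Pstar W2)" for x
  have "path_exp n (K c) (\<lambda>zs. if psum (\<lambda>_ (r, y1, y2). F (fst r) y1 y2) (take n1 zs) \<ge> a1 then 1 else 0) \<le> 1 / real n"
  proof (rule azuma_phase1[where m = m])
    show "\<bar>F x y1 y2\<bar> \<le> 2 * b + 2" for x y1 y2 using b_bound(1)[of x y1] b_bound(2)[of x y2] assms by (auto simp: F_def)
    have mm: "(\<Sum>y\<in>UNIV. W x y * (q * info_dens Pstar W x y)) = q * KL (W x) (outd Pstar W)" for W :: "'x \<Rightarrow> 'y \<Rightarrow> real" and x q
      unfolding mean_info_dens[symmetric] sum_distrib_left by (simp add: mult.left_commute)
    show "(\<Sum>y1\<in>UNIV. \<Sum>y2\<in>UNIV. W1 x y1 * W2 x y2 * F x y1 y2) = m x" for x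
      unfolding F_def m_def sum_product_mean[OF W1_sum W2_sum] mm ..
    have "(\<Sum>x\<in>UNIV. Pstar x * m x) = s * mutual_info Pstar W1 - s * mutual_info Pstar W2"
      by (simp add: m_def mutual_info_def sum_distrib_left sum_subtractf[symmetric] right_diff_distrib mult_ac)
    then show "(\<Sum>x\<in>UNIV. Pstar x * m x) = 0" by (simp add: mutual_info_Pstar)
  qed
  moreover have "psum (\<lambda>_ (r, y1, y2). F (fst r) y1 y2) (take n1 zs) = s * Dsum zs" for zs :: "(('x \<times> 'x \<times> 'x) \<times> 'y \<times> 'y) list"
    by (simp add: psum_def Dsum_def F_def split_beta sum_distrib_left right_diff_distrib)
  ultimately show ?thesis by simp
qed

lemma clt_Ssum:
  assumes "n1 \<ge> 1"
  shows "path_exp n (K c) (\<lambda>zs. if Ssum zs \<le> t then 1 else 0) \<le> 1 - Qfun (t / sqrt (real n1 * V)) +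
    (2 + (b^3 / 2 + V\<^sup>2) * (2 * (1 + V) / V) + 1 / sqrt V + 1 / V) * real n1 powr (-1/6)"
proof -
  let ?d = "\<lambda>_ (r, y1, y2). comb (fst r) y1 y2"
  have "path_exp n (K c) (\<lambda>zs. if Ssum zs \<le> t then 1 else 0) = path_exp n1 (K c) (\<lambda>zs. if psum ?d zs \<le> t then 1 else 0)"
    unfolding Ssum_def by (rule path_exp_take[OF stoch_K n1_le])
  also have "\<dots> = path_exp n1 (K c) (\<lambda>zs. 1 + (- 1) * (if psum ?d zs > t then 1 else 0))"
    by (rule path_exp_cong) auto
  also have "\<dots> = 1 - path_exp n1 (K c) (\<lambda>zs. if psum ?d zs > t then 1 else 0)"
    unfolding path_exp_add path_exp_cmult path_exp_const[OF stoch_K] by simp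
  finally have *: "path_exp n (K c) (\<lambda>zs. if Ssum zs \<le> t then 1 else 0) = 1 - path_exp n1 (K c) (\<lambda>zs. if psum ?d zs > t then 1 else 0)" .
  have "\<bar>path_exp n1 (K c) (\<lambda>zs. if psum ?d zs > t then 1 else 0) - Qfun (t / sqrt (real n1 * V))\<bar> \<le>
     (2 + (b^3 / 2 + V\<^sup>2) * (2 * (1 + V) / V) + 1 / sqrt V + 1 / V) * real n1 powr (-1/6)"
  proof (rule martingale_clt[OF V_pos assms stoch_K])
    fix zs :: "(('x \<times> 'x \<times> 'x) \<times> 'y \<times> 'y) list" assume zs: "length zs < n1"
    show "\<bar>case z of (r, y1, y2) \<Rightarrow> comb (fst r) y1 y2\<bar> \<le> b" for z :: "('x \<times> 'x \<times> 'x) \<times> 'y \<times> 'y"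
      using b_bound(3) by (auto split: prod.split)
    show "(\<Sum>z\<in>UNIV. K c zs z * (case z of (r, y1, y2) \<Rightarrow> comb (fst r) y1 y2)) = 0"
      unfolding phase1_mean[OF zs comb_mean] by simp
    have "(\<Sum>z\<in>UNIV. K c zs z * (case z of (r, y1, y2) \<Rightarrow> comb (fst r) y1 y2)\<^sup>2) =
      (\<Sum>z\<in>UNIV. K c zs z * (case z of (r, y1, y2) \<Rightarrow> (comb (fst r) y1 y2)\<^sup>2))" by (intro sum.cong) auto
    also have "\<dots> = V" unfolding phase1_mean[OF zs comb_variance, of c] using Pstar_dist by (simp add: is_dist_def flip: sum_distrib_right)
    finally show "(\<Sum>z\<in>UNIV. K c zs z * (case z of (r, y1, y2) \<Rightarrow> comb (fst r) y1 y2)\<^sup>2) = V" .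
  qed
  then show ?thesis unfolding * by linarith
qed

lemma info_split:
  assumes len: "length zs = n"
  shows "info k (tz c zs) zs = acc k (map fst zs) (map (obs k) zs)
     + real (tz c zs) * mutual_info (tilt \<sigma>) (Wc k) + (real B - real (tz c zs)) * mutual_info (tilt (- \<sigma>)) (Wc k) - psum (dev k c) zs"
proof -
  define \<tau> where "\<tau> = tz c zs"
  have \<tau>: "\<tau> \<le> B" unfolding \<tau>_def tz_def by (rule tau_le)
  define l where "l i = info_dens (dst i \<tau>) (Wc k) (sel i \<tau> (fst (zs ! i))) (obs k (zs ! i))" for i
  define I where "I i = mutual_info (dst i \<tau>) (Wc k)" for i
  have split: "(\<Sum>i<n. f i) = (\<Sum>i<n1. f i) + (\<Sum>i\<in>{n1..<n}. f i)" for f :: "nat \<Rightarrow> real"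
    using n1_le by (metis ivl_disj_un_one(2) finite_lessThan finite_atLeastLessThan ivl_disj_int_one(2) sum.union_disjoint)
  have "psum (dev k c) zs = (\<Sum>i<n. if i < n1 then 0 else I i - l i)"
    unfolding psum_def len
    by (intro sum.cong) (auto simp: dev_def len I_def l_def sel_tz_take dst_tz_take \<tau>_def)
  also have "\<dots> = (\<Sum>i\<in>{n1..<n}. I i) - (\<Sum>i\<in>{n1..<n}. l i)" unfolding split by (simp add: sum_subtractf)
  finally have dev: "psum (dev k c) zs = (\<Sum>i\<in>{n1..<n}. I i) - (\<Sum>i\<in>{n1..<n}. l i)" .
  have nB: "n = n1 + B" using B_le by (simp add: n1_def)
  have "(\<Sum>i\<in>{n1..<n}. I i) = (\<Sum>i\<in>{n1..<n1+\<tau>}. I i) + (\<Sum>i\<in>{n1+\<tau>..<n}. I i)"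
    using \<tau> nB by (intro sum.atLeastLessThan_concat[symmetric]) auto
  also have "(\<Sum>i\<in>{n1..<n1+\<tau>}. I i) = (\<Sum>i\<in>{n1..<n1+\<tau>}. mutual_info (tilt \<sigma>) (Wc k))"
    by (intro sum.cong) (auto simp: I_def dst_def)
  also have "(\<Sum>i\<in>{n1+\<tau>..<n}. I i) = (\<Sum>i\<in>{n1+\<tau>..<n}. mutual_info (tilt (- \<sigma>)) (Wc k))"
    by (intro sum.cong) (auto simp: I_def dst_def)
  finally have I: "(\<Sum>i\<in>{n1..<n}. I i) = real \<tau> * mutual_info (tilt \<sigma>) (Wc k) + (real B - real \<tau>) * mutual_info (tilt (- \<sigma>)) (Wc k)"
    using \<tau> nB by (simp add: of_nat_diff)
  have "(\<Sum>i<n1. l i) = acc k (map fst zs) (map (obs k) zs)"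
    unfolding acc_def using len n1_le by (intro sum.cong) (auto simp: l_def dst_def sel_def)
  moreover have "info k \<tau> zs = (\<Sum>i<n1. l i) + (\<Sum>i\<in>{n1..<n}. l i)" unfolding info_def l_def[symmetric] split ..
  ultimately show ?thesis using dev I unfolding \<tau>_def by linarith
qed

text \<open>This number has two roles: the derivative of the information of receiver
  \<open>k\<close> along \<open>v\<close>, and the coefficient of \<open>Dsum\<close> when the
  first-phase information of receiver \<open>k\<close> is expressed by \<open>Ssum\<close> and
  \<open>Dsum\<close>. Cancelling \<open>Dsum\<close> therefore works for both receivers at
  once.\<close>

definition "slope k = (if k then 1 - \<eta> else - \<eta>)"

lemma info_lower:
  assumes len: "length zs = n" and dv: "psum (dev k c) zs < a2"
  shows "info k (tz c zs) zs > acc k (map fst zs) (map (obs k) zs) + real B * C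
     + (2 * real (tz c zs) - real B) * \<sigma> * slope k - real B * \<sigma>\<^sup>2 * (chi True + chi False) - a2"
proof -
  define \<tau> where "\<tau> = real (tz c zs)"
  have \<tau>: "0 \<le> \<tau>" "\<tau> \<le> real B" unfolding \<tau>_def tz_def using tau_le by auto
  have sl: "dI (Wc k) Pstar v = slope k" by (simp add: Wc_def slope_def dI_v)
  have mC: "mutual_info Pstar (Wc k) = C" by (simp add: Wc_def mutual_info_Pstar)
  have chi0: "chi k \<ge> 0" for k unfolding chi_def
    using is_dist_outd[OF Pstar_dist channel_Wc[of k]] by (intro sum_nonneg) (auto simp: is_dist_def)
  have t0: "(\<lambda>x. Pstar x + s * v x) = tilt s" for s by (simp add: tilt_def fun_eq_iff)
  have "mutual_info (tilt s) (Wc k) \<ge> C + s * slope k - s\<^sup>2 * chi k" if "\<bar>s\<bar> \<le> \<sigma>" for s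
    using mutual_info_quadratic_lower_bound[OF channel_Wc Pstar_dist Pstar_pos, of s v k] dist_tilt[OF that]
    unfolding t0 sl mC chi_def by simp
  from this[of \<sigma>] this[of "- \<sigma>"] have
    m: "mutual_info (tilt \<sigma>) (Wc k) \<ge> C + \<sigma> * slope k - \<sigma>\<^sup>2 * chi k" "mutual_info (tilt (- \<sigma>)) (Wc k) \<ge> C - \<sigma> * slope k - \<sigma>\<^sup>2 * chi k"
    using \<sigma>_pos by auto
  have "\<tau> * mutual_info (tilt \<sigma>) (Wc k) + (real B - \<tau>) * mutual_info (tilt (- \<sigma>)) (Wc k) \<ge>
     \<tau> * (C + \<sigma> * slope k - \<sigma>\<^sup>2 * chi k) + (real B - \<tau>) * (C - \<sigma> * slope k - \<sigma>\<^sup>2 * chi k)"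
    using \<tau> by (intro add_mono mult_left_mono m) auto
  also have "\<tau> * (C + \<sigma> * slope k - \<sigma>\<^sup>2 * chi k) + (real B - \<tau>) * (C - \<sigma> * slope k - \<sigma>\<^sup>2 * chi k) =
    real B * C + (2 * \<tau> - real B) * \<sigma> * slope k - real B * \<sigma>\<^sup>2 * chi k" by (simp add: algebra_simps)
  finally have 1: "\<tau> * mutual_info (tilt \<sigma>) (Wc k) + (real B - \<tau>) * mutual_info (tilt (- \<sigma>)) (Wc k) \<ge>
    real B * C + (2 * \<tau> - real B) * \<sigma> * slope k - real B * \<sigma>\<^sup>2 * chi k" .
  have "chi k \<le> chi True + chi False" using chi0 by (cases k) auto
  then have "real B * \<sigma>\<^sup>2 * chi k \<le> real B * \<sigma>\<^sup>2 * (chi True + chi False)" by (intro mult_left_mono) auto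
  then show ?thesis using 1 dv unfolding info_split[OF len, of k c] \<tau>_def by linarith
qed

lemma info_gt_target:
  assumes len: "length zs = n" and dv: "psum (dev k c) zs < a2"
    and D: "\<bar>Dsum zs\<bar> < a1" and S: "Ssum zs > - a1" and ok: "Ssum zs > t \<or> c = k"
  shows "info k (tz c zs) zs > target"
proof -
  define \<tau> where "\<tau> = real (tz c zs)"
  have obs_map: "map (obs k) zs = (if k then outs1 zs else outs2 zs)" by (simp add: obs_def)
  have A: "acc k (map fst zs) (map (obs k) zs) = real n1 * C + Ssum zs + slope k * Dsum zs"
    unfolding obs_map Ssum_eq[OF len] Dsum_eq[OF len] by (cases k) (simp_all add: slope_def algebra_simps)
  have nC: "real n * C = real n1 * C + real B * C" using B_le by (simp add: n1_def of_nat_diff algebra_simps)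
  have tz: "tz c zs = (if Ssum zs > t then min B (nat \<lfloor>(real B - Dsum zs / \<sigma>) / 2\<rfloor>) else if c then B else 0)"
    unfolding tz_def tau_def Ssum_eq[OF len] Dsum_eq[OF len] ..
  have sl: "\<bar>slope k\<bar> \<le> 1" using eta by (cases k) (auto simp: slope_def)
  have "Ssum zs + slope k * (Dsum zs + (2 * \<tau> - real B) * \<sigma>) \<ge> t - 2 * \<sigma>"
  proof (cases "Ssum zs > t")
    case True
    \<comment> \<open>The real solution of \<open>Dsum zs + (2 * q - real B) * \<sigma> = 0\<close>.
      It lies between 0 and B by \<open>D_range\<close>, and rounding it down costs at most 2
      \<sigma>.\<close>
    define q where "q = (real B - Dsum zs / \<sigma>) / 2"
    have "\<bar>Dsum zs\<bar> \<le> real B * \<sigma>" using D D_range unfolding a1_def by linarith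
    then have "\<bar>Dsum zs / \<sigma>\<bar> \<le> real B" using \<sigma>_pos by (simp add: abs_divide pos_divide_le_eq)
    then have "Dsum zs / \<sigma> \<le> real B" "- (Dsum zs / \<sigma>) \<le> real B" by (simp_all only: abs_le_iff)
    then have q: "0 \<le> q" "q \<le> real B" by (simp_all add: q_def)
    have "nat \<lfloor>q\<rfloor> \<le> B" using q(2) by (simp add: floor_le_iff nat_le_iff)
    then have "tz c zs = nat \<lfloor>q\<rfloor>" using True unfolding tz q_def by simp
    then have \<tau>: "\<tau> \<le> q" "q < \<tau> + 1" unfolding \<tau>_def using q(1) by (auto simp: le_floor_iff)
    have Dq: "Dsum zs = (real B - 2 * q) * \<sigma>" using \<sigma>_pos by (simp add: q_def field_simps)
    have "Dsum zs + (2 * \<tau> - real B) * \<sigma> = 2 * \<sigma> * (\<tau> - q)" unfolding Dq by (simp add: algebra_simps)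
    moreover have "\<bar>2 * \<sigma> * (\<tau> - q)\<bar> \<le> 2 * \<sigma>"
      unfolding abs_mult using \<tau> \<sigma>_pos by (simp add: mult_left_le abs_le_iff)
    ultimately have "\<bar>slope k * (Dsum zs + (2 * \<tau> - real B) * \<sigma>)\<bar> \<le> 1 * (2 * \<sigma>)"
      unfolding abs_mult[of "slope k"] using sl by (intro mult_mono) auto
    then show ?thesis using True by linarith
  next
    case False
    then have ck: "c = k" using ok by blast
    have "\<bar>slope k * Dsum zs\<bar> \<le> 1 * a1" unfolding abs_mult using sl D by (intro mult_mono) auto
    \<comment> \<open>The full tilt towards receiver \<open>k\<close>; of the surplus 2
      \<open>a1\<close>, one half covers \<open>Dsum\<close> and the other half
      \<open>Ssum\<close>.\<close>
    moreover have "slope k * ((2 * \<tau> - real B) * \<sigma>) \<ge> t + 2 * a1"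
    proof -
      have "\<tau> = (if k then real B else 0)" using False ck unfolding \<tau>_def tz by simp
      then show ?thesis using t_range unfolding a1_def[symmetric] by (cases k) (auto simp: slope_def algebra_simps)
    qed
    ultimately show ?thesis using S \<sigma>_pos unfolding distrib_left by linarith
  qed
  moreover have "slope k * (Dsum zs + (2 * \<tau> - real B) * \<sigma>) = slope k * Dsum zs + (2 * \<tau> - real B) * \<sigma> * slope k"
    by (simp add: algebra_simps)
  ultimately show ?thesis using info_lower[OF len dv] unfolding A target_def nC \<tau>_def by linarith
qed

lemma good_if_info_gt:
  assumes len: "length zs = n" and gt: "info k (tz c zs) zs > target"
    and pos: "\<And>i. i < n \<Longrightarrow> Wc k (sel i (tz c zs) (fst (zs ! i))) (obs k (zs ! i)) \<noteq> 0"
  shows "good k (c, map fst zs) (map (obs k) zs)"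
proof -
  define \<tau> where "\<tau> = tz c zs"
  define W where "W i = Wc k (sel i \<tau> (fst (zs ! i))) (obs k (zs ! i))" for i
  define O' where "O' i = outd (dst i \<tau>) (Wc k) (obs k (zs ! i))" for i
  have Wp: "W i > 0" if "i < n" for i
    using pos[OF that] channel_Wc[of k] unfolding W_def \<tau>_def by (auto simp: is_channel_def order.strict_iff_order)
  have Op: "O' i > 0" if "i < n" for i
    unfolding O'_def by (rule outd_pos[OF channel_Wc _ dst_pos]) (use Wp[OF that] in \<open>auto simp: W_def less_imp_le[OF dst_pos]\<close>)
  have "ratio k \<tau> (map fst zs) (map (obs k) zs) = (\<Prod>i<n. W i / O' i)"
    unfolding ratio_def using len by (intro prod.cong) (auto simp: W_def O'_def)
  also have "\<dots> = exp (\<Sum>i<n. ln (W i / O' i))"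
    unfolding exp_sum[OF finite_lessThan] using Wp Op by (intro prod.cong) auto
  also have "(\<Sum>i<n. ln (W i / O' i)) = info k \<tau> zs"
    by (simp add: info_def info_dens_def W_def O'_def)
  finally have "ratio k \<tau> (map fst zs) (map (obs k) zs) > exp target" using gt by (simp add: \<tau>_def)
  moreover have "\<tau> \<le> B" unfolding \<tau>_def tz_def by (rule tau_le)
  ultimately show ?thesis unfolding good_def by auto
qed

text \<open>The four terms 1/n are the tails of \<open>dev\<close>, of \<open>Ssum\<close> from
  below and of \<open>Dsum\<close> on both sides. Outside them decoding can fail only if the
  weighted sum is small and the coin favours the other receiver.\<close>

lemma failure_bound:
  "path_exp n (K c) (\<lambda>zs. if good k (c, map fst zs) (map (obs k) zs) then 0 else 1) \<le>
    (if c = k then 0 else path_exp n (K c) (\<lambda>zs. if Ssum zs \<le> t then 1 else 0)) + 4 / real n"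
proof -
  have "path_exp n (K c) (\<lambda>zs. if good k (c, map fst zs) (map (obs k) zs) then 0 else 1) \<le>
    path_exp n (K c) (\<lambda>zs. (if c = k then 0 else 1) * (if Ssum zs \<le> t then 1 else 0) +
      ((if psum (dev k c) zs \<ge> a2 then 1 else 0) + ((if - Ssum zs \<ge> a1 then 1 else 0) +
      ((if 1 * Dsum zs \<ge> a1 then 1 else 0) + (if (- 1) * Dsum zs \<ge> a1 then 1 else 0)))))"
  proof (rule path_exp_mono_support[OF stoch_kernel_nonneg[OF stoch_K],
      where R = "\<lambda>zs z. Wc k (sel (length zs) (tz c zs) (fst z)) (obs k z) \<noteq> 0"])
    fix zs :: "(('x \<times> 'x \<times> 'x) \<times> 'y \<times> 'y) list" and z assume "K c zs z \<noteq> 0"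
    then show "Wc k (sel (length zs) (tz c zs) (fst z)) (obs k z) \<noteq> 0"
      by (cases z) (auto simp: K_def Wc_def obs_def inp_def tz_def)
  next
    fix zs :: "(('x \<times> 'x \<times> 'x) \<times> 'y \<times> 'y) list" assume len: "length zs = n"
      and supp: "\<And>i. i < n \<Longrightarrow> Wc k (sel (length (take i zs)) (tz c (take i zs)) (fst (zs ! i))) (obs k (zs ! i)) \<noteq> 0"
    have pos: "Wc k (sel i (tz c zs) (fst (zs ! i))) (obs k (zs ! i)) \<noteq> 0" if "i < n" for i
      using supp[OF that] that len by (simp add: sel_tz_take)
    have "good k (c, map fst zs) (map (obs k) zs)"
      if "psum (dev k c) zs < a2" "- Ssum zs < a1" "Dsum zs < a1" "- Dsum zs < a1" "Ssum zs > t \<or> c = k"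
      by (rule good_if_info_gt[OF len info_gt_target[OF len] pos]) (use that in auto)
    then show "(if good k (c, map fst zs) (map (obs k) zs) then 0 else 1 :: real) \<le> (if c = k then 0 else 1) * (if Ssum zs \<le> t then 1 else 0) +
      ((if psum (dev k c) zs \<ge> a2 then 1 else 0) + ((if - Ssum zs \<ge> a1 then 1 else 0) +
      ((if 1 * Dsum zs \<ge> a1 then 1 else 0) + (if (- 1) * Dsum zs \<ge> a1 then 1 else 0))))"
      by (auto simp: not_le)
  qed
  also have "\<dots> \<le> (if c = k then 0 else 1) * path_exp n (K c) (\<lambda>zs. if Ssum zs \<le> t then 1 else 0) +
     (1 / real n + (1 / real n + (1 / real n + 1 / real n)))"
    unfolding path_exp_add path_exp_cmult[of n "K c" "if c = k then 0 else 1"]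
    by (intro add_mono order_refl tail_dev tail_Ssum tail_Dsum) auto
  finally show ?thesis by (cases "c = k") simp_all
qed

theorem steering_code:
  assumes n1: "n1 \<ge> 1" and M: "M \<ge> 1"
    and \<theta>: "\<theta> = 2 / real M + 2 * real M * ((real B + 1) / exp target)"
    and eps: "(1 - Qfun (t / sqrt (real n1 * V)) +
      (2 + (b^3 / 2 + V\<^sup>2) * (2 * (1 + V) / V) + 1 / sqrt V + 1 / V) * real n1 powr (-1/6)) / 2
      + 4 / real n + sqrt \<theta> + \<theta> \<le> eps"
  shows "FLF_code_exists W1 W2 n M eps"
proof -
  define A where "A = (UNIV :: bool set) \<times> {rs :: ('x \<times> 'x \<times> 'x) list. length rs = n}"
  \<comment> \<open>The fair coin is drawn with the codeword and becomes fixed with the codebook, so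
    the encoder of the final code is deterministic. Averaging over it gives the factor 1/2 in front
    of the central limit probability.\<close>
  define \<mu> where "\<mu> w = 1 / 2 * (\<Prod>i<n. \<rho> (snd w ! i))" for w :: "bool \<times> ('x \<times> 'x \<times> 'x) list"
  define E where "E w i ys1 ys2 = inp (fst w) (take i (snd w)) (snd w ! i) ys1 ys2" for w i ys1 ys2
  have avg: "(\<Sum>w\<in>A. \<mu> w * f w) = (path_exp n (\<lambda>_. \<rho>) (\<lambda>rs. f (True, rs)) + path_exp n (\<lambda>_. \<rho>) (\<lambda>rs. f (False, rs))) / 2" for f
  proof -
    have "(\<Sum>w\<in>A. \<mu> w * f w) = (\<Sum>c\<in>UNIV. \<Sum>rs | length rs = n. \<mu> (c, rs) * f (c, rs))"
      unfolding A_def by (simp add: sum.cartesian_product split_beta)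
    also have "\<dots> = (\<Sum>c\<in>UNIV. path_exp n (\<lambda>_. \<rho>) (\<lambda>rs. f (c, rs)) / 2)"
      unfolding path_exp_iid \<mu>_def by (simp add: sum_divide_distrib)
    finally show ?thesis by (simp add: UNIV_bool add_divide_distrib)
  qed
  define P where "P = 1 - Qfun (t / sqrt (real n1 * V)) +
      (2 + (b^3 / 2 + V\<^sup>2) * (2 * (1 + V) / V) + 1 / sqrt V + 1 / V) * real n1 powr (-1/6)"
  have half: "x \<le> q \<Longrightarrow> y \<le> q \<Longrightarrow> (x + y) / 2 \<le> q" for x y q :: real by simp
  show ?thesis
  proof (rule random_coding[OF W1 W2, of A \<mu> good _ M \<theta>])
    show "0 \<le> \<mu> w" if "w \<in> A" for w by (simp add: \<mu>_def prod_nonneg rho_nonneg)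
    show "(\<Sum>w\<in>A. \<mu> w) = 1" using avg[of "\<lambda>_. 1"] by (simp add: path_exp_const[OF stoch_rho])
    show "(\<Sum>w\<in>A. \<mu> w * (if good k w ys then 1 else 0)) \<le> (real B + 1) / exp target" for k ys
      unfolding avg by (rule half[OF confusion_bound confusion_bound])
    fix k
    have f: "path_exp n (\<lambda>_. \<rho>) (\<lambda>rs. det_exp n W1 W2 (E (c, rs)) (\<lambda>ys1 ys2. if good k (c, rs) (if k then ys1 else ys2) then 0 else 1)) \<le> (if c = k then 0 else P) + 4 / real n" for c
    proof -
      have "path_exp n (\<lambda>_. \<rho>) (\<lambda>rs. det_exp n W1 W2 (E (c, rs)) (\<lambda>ys1 ys2. if good k (c, rs) (if k then ys1 else ys2) then 0 else 1)) =
        path_exp n (K c) (\<lambda>zs. if good k (c, map fst zs) (if k then outs1 zs else outs2 zs) then 0 else 1)"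
        unfolding E_def K_def fst_conv snd_conv by (rule path_exp_codeword)
      also have "(\<lambda>zs. if good k (c, map fst zs) (if k then outs1 zs else outs2 zs) then 0 else 1 :: real) =
        (\<lambda>zs. if good k (c, map fst zs) (map (obs k) zs) then 0 else 1)"
        by (cases k) (simp_all add: obs_def[abs_def])
      also have "path_exp n (K c) \<dots> \<le> (if c = k then 0 else path_exp n (K c) (\<lambda>zs. if Ssum zs \<le> t then 1 else 0)) + 4 / real n"
        by (rule failure_bound)
      also have "\<dots> \<le> (if c = k then 0 else P) + 4 / real n"
        using clt_Ssum[OF n1, of c] unfolding P_def[symmetric] by (cases "c = k") simp_all
      finally show ?thesis .
    qed
    have "(\<Sum>w\<in>A. \<mu> w * det_exp n W1 W2 (E w) (\<lambda>ys1 ys2. if good k w (if k then ys1 else ys2) then 0 else 1)) \<le> P / 2 + 4 / real n"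
      unfolding avg using f[of True] f[of False] by (cases k) (auto simp: field_simps)
    then show "(\<Sum>w\<in>A. \<mu> w * det_exp n W1 W2 (E w) (\<lambda>ys1 ys2. if good k w (if k then ys1 else ys2) then 0 else 1)) + sqrt \<theta> + \<theta> \<le> eps"
      using eps unfolding P_def by linarith
  qed (use M \<theta> in auto)
qed

end

section \<open>Second-order expansion\<close>

text \<open>After division by x the lower-order terms tend to 0. The right-hand side is the size of
  \<open>target\<close> at which the codebook has at least n codewords.\<close>

lemma linear_dominates:
  fixes c p k :: real
  assumes "c > 0" "p > 0" "k > 0"
  shows "eventually (\<lambda>x::real. x * c - p * sqrt x - k * x powr (1/3) * ln x \<ge> 3 * ln x + 1) at_top"
proof -
  have "((\<lambda>x::real. p * (sqrt x / x) + k * (x powr (1/3) * ln x / x) + (3 * ln x + 1) / x) \<longlongrightarrow> p * 0 + k * 0 + 0) at_top"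
    by (intro tendsto_add tendsto_mult tendsto_const; real_asymp)
  then have "eventually (\<lambda>x::real. p * (sqrt x / x) + k * (x powr (1/3) * ln x / x) + (3 * ln x + 1) / x < c) at_top"
    using assms(1) by (intro order_tendstoD(2)) auto
  then show ?thesis using eventually_gt_at_top[of 0]
  proof eventually_elim
    case (elim x)
    have "p * (sqrt x / x) + k * (x powr (1/3) * ln x / x) + (3 * ln x + 1) / x =
        (p * sqrt x + k * x powr (1/3) * ln x + (3 * ln x + 1)) / x"
      by (simp add: add_divide_distrib)
    with elim have "p * sqrt x + k * x powr (1/3) * ln x + (3 * ln x + 1) < c * x"
      by (simp add: pos_divide_less_eq)
    then show ?case by (simp add: mult.commute)
  qed
qed

section \<open>Choice of parameters and the final expansion\<close>

context cm_dmbc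
begin

text \<open>If \<open>C\<close> were 0, all divergences from the optimal output law of the first
  receiver would vanish, and with them its derivative in every direction, which leaves no ascent
  direction.\<close>

lemma C_pos: "C > 0"
proof -
  have KL0: "0 \<le> KL (W1 x) (outd Pstar W1)" for x
    by (rule KL_nonneg[OF _ is_dist_outd[OF Pstar_dist W1]])
       (use W1 in \<open>auto simp: is_dist_def is_channel_def outd_zero_imp[OF W1 Pstar_pos]\<close>)
  have term0: "0 \<le> Pstar x * KL (W1 x) (outd Pstar W1)" for x
    using KL0 Pstar_pos[of x] by simp
  have "C \<ge> 0" unfolding mutual_info_Pstar(1)[symmetric] mutual_info_def by (intro sum_nonneg term0)
  moreover have "C \<noteq> 0"
  proof
    assume "C = 0"
    then have "(\<Sum>x\<in>UNIV. Pstar x * KL (W1 x) (outd Pstar W1)) = 0"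
      unfolding mutual_info_Pstar(1)[symmetric] mutual_info_def .
    then have "Pstar x * KL (W1 x) (outd Pstar W1) = 0" for x
      by (subst (asm) sum_nonneg_eq_0_iff) (auto simp: term0)
    then have "KL (W1 x) (outd Pstar W1) = 0" for x using Pstar_pos[of x] by (metis mult_eq_0_iff less_irrefl)
    then have "dI W1 Pstar u = 0" for u by (simp add: dI_def)
    then show False using ex_ascent[OF W1 C1_gt[folded C_def] mutual_info_Pstar(1)] by simp
  qed
  ultimately show ?thesis by simp
qed

lemma common_bound:
  "\<exists>b>0. (\<forall>x y. \<bar>info_dens Pstar W1 x y\<bar> \<le> b) \<and> (\<forall>x y. \<bar>info_dens Pstar W2 x y\<bar> \<le> b) \<and> (\<forall>x y1 y2. \<bar>comb x y1 y2\<bar> \<le> b)"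
proof -
  obtain b1 where b1: "b1 > 0" "\<And>x y. \<bar>info_dens Pstar W1 x y\<bar> \<le> b1" using info_dens_bounded[of Pstar W1] by blast
  obtain b2 where b2: "b2 > 0" "\<And>x y. \<bar>info_dens Pstar W2 x y\<bar> \<le> b2" using info_dens_bounded[of Pstar W2] by blast
  obtain b3 where b3: "b3 > 0" "\<And>x y1 y2. \<bar>comb x y1 y2\<bar> \<le> b3" using comb_bounded by blast
  have "\<bar>info_dens Pstar W1 x y\<bar> \<le> b1 + b2 + b3" "\<bar>info_dens Pstar W2 x y\<bar> \<le> b1 + b2 + b3"
    "\<bar>comb x y1 y2\<bar> \<le> b1 + b2 + b3" for x y y1 y2
    using b1(1) b1(2)[of x y] b2(1) b2(2)[of x y] b3(1) b3(2)[of x y1 y2] by linarith+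
  moreover have "b1 + b2 + b3 > 0" using b1 b2 b3 by linarith
  ultimately show ?thesis by blast
qed

lemma ex_uniform_scale: "\<exists>\<delta>>0. \<delta> \<le> 1 \<and> (\<forall>x. \<delta> * \<bar>v x\<bar> \<le> Pstar x / 2)" for v :: "'x \<Rightarrow> real"
proof -
  define m where "m = Min (range Pstar)"
  have m: "m > 0" "\<And>x. m \<le> Pstar x" unfolding m_def using Pstar_pos by auto
  define s where "s = (\<Sum>x\<in>UNIV. \<bar>v x\<bar>)"
  have s: "0 \<le> s" "\<And>x. \<bar>v x\<bar> \<le> s" unfolding s_def by (auto intro!: sum_nonneg member_le_sum)
  define \<delta> where "\<delta> = min 1 (m / (2 * (s + 1)))"
  have \<delta>: "\<delta> > 0" "\<delta> \<le> 1" unfolding \<delta>_def using m s by auto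
  moreover have "\<delta> * \<bar>v x\<bar> \<le> Pstar x / 2" for x
  proof -
    have "\<delta> * \<bar>v x\<bar> \<le> m / (2 * (s + 1)) * (s + 1)" using m s s(2)[of x] \<delta> by (intro mult_mono) (auto simp: \<delta>_def intro: add_increasing2)
    also have "\<dots> = m / 2" using s by (simp add: field_simps)
    finally show ?thesis using m(2)[of x] by linarith
  qed
  ultimately show ?thesis by blast
qed

theorem achievability:
  assumes eps: "0 < eps" "eps < 1 / 2"
  shows "\<exists>K n0. \<forall>n\<ge>n0. \<exists>M. FLF_code_exists W1 W2 n M eps \<and>
    ln (real M) \<ge> real n * C - sqrt (real n * V) * Qinv (2 * eps) - K * real n powr (1/3) * ln (real n)"
proof -
  obtain v where v: "(\<Sum>x\<in>UNIV. v x) = 0" "dI W1 Pstar v = 1 - \<eta>" "dI W2 Pstar v = - \<eta>"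
    using ex_steering by blast
  obtain b where b: "b > 0" "\<And>x y. \<bar>info_dens Pstar W1 x y\<bar> \<le> b" "\<And>x y. \<bar>info_dens Pstar W2 x y\<bar> \<le> b" "\<And>x y1 y2. \<bar>comb x y1 y2\<bar> \<le> b"
    using common_bound by blast
  obtain \<delta> where \<delta>: "\<delta> > 0" "\<delta> \<le> 1" "\<And>x. \<delta> * \<bar>v x\<bar> \<le> Pstar x / 2" using ex_uniform_scale[of v] by blast
  define q0 where "q0 = Qinv (2 * eps)"
  obtain a where a: "a > 0" "\<And>x. 0 \<le> x \<Longrightarrow> x \<le> 1 \<Longrightarrow> Qfun (q0 + x) \<le> 2 * eps - a * x"
    unfolding q0_def by (rule Qfun_near_Qinv[of "2 * eps"]) (use eps in auto)
  define c0 where "c0 = 2 + (b^3 / 2 + V\<^sup>2) * (2 * (1 + V) / V) + 1 / sqrt V + 1 / V"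
  have c0: "c0 > 0" unfolding c0_def using b V_pos by (intro add_pos_pos mult_pos_pos) auto
  \<comment> \<open>Here \<open>2 * c0\<close> absorbs the central limit error, since n1^(-1/6) <= 2
    q; after halving, 20 leaves 10 q, spent as 4 q on 4/n, 2 q on sqrt \<theta> and 4 q on
    \<theta>.\<close>
  define A where "A = (2 * c0 + 20) / a"
  have A: "A > 0" using a c0 by (simp add: A_def)
  \<comment> \<open>In units of sqrt (n ln n): twice the first-phase deviation plus a bound on
    \<open>t\<close>. Division by \<open>\<eta> * (1 - \<eta>)\<close> in \<open>s0\<close> makes
    the tilt strong enough in favour of either receiver.\<close>
  define s1 where "s1 = 4 * (2 * b + 2) + sqrt V * \<bar>q0\<bar>"
  have s1: "s1 > 0" unfolding s1_def using b V_pos by (intro add_pos_nonneg) auto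
  define s0 where "s0 = s1 / (\<eta> * (1 - \<eta>))"
  have s0\<eta>: "s1 \<le> s0 * \<eta>" "s1 \<le> s0 * (1 - \<eta>)"   proof -
    have "s0 * \<eta> = s1 / (1 - \<eta>)" "s0 * (1 - \<eta>) = s1 / \<eta>" unfolding s0_def using eta(1,2) by auto
    moreover have "s1 \<le> s1 / (1 - \<eta>)" "s1 \<le> s1 / \<eta>" using eta(1,2) s1 by (simp_all add: pos_le_divide_eq)
    ultimately show "s1 \<le> s0 * \<eta>" "s1 \<le> s0 * (1 - \<eta>)" by simp_all
  qed
  have s0: "s0 > 0" unfolding s0_def using eta(1,2) s1 by simp
  have s01: "s1 \<le> s0" using s0\<eta>(1) mult_left_mono[of \<eta> 1 s0] eta(2) s0 by linarith
  define \<chi>' where "\<chi>' = (\<Sum>y\<in>UNIV. (outd v W1 y)\<^sup>2 / outd Pstar W1 y) + (\<Sum>y\<in>UNIV. (outd v W2 y)\<^sup>2 / outd Pstar W2 y)"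
  have chi0: "\<chi>' \<ge> 0" unfolding \<chi>'_def
    using is_dist_outd[OF Pstar_dist W1] is_dist_outd[OF Pstar_dist W2]
    by (intro add_nonneg_nonneg sum_nonneg) (auto simp: is_dist_def)
  \<comment> \<open>The summands collect the losses \<open>e1\<close> to \<open>e4\<close> below:
    the change of the quantile term, the rounding, the quadratic loss and the second-phase
    deviation.\<close>
  define K1 where "K1 = 2 * \<bar>q0\<bar> * sqrt V + sqrt V * A + 2 + s0\<^sup>2 * \<chi>' + 4 * (2 * b + 2)"
  have K1: "K1 > 0" unfolding K1_def using V_pos A chi0 b
    by (intro add_nonneg_pos add_nonneg_nonneg mult_nonneg_nonneg) auto
  define P1 where "P1 = sqrt V * \<bar>q0\<bar> + 1"
  have P1: "P1 > 0" unfolding P1_def using V_pos by (intro add_nonneg_pos) auto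
  have P1_bound: "sqrt (x * V) * q0 \<le> P1 * sqrt x" if "x \<ge> 0" for x
  proof -
    have "sqrt (x * V) * q0 \<le> sqrt (x * V) * \<bar>q0\<bar>" using that V_pos by (intro mult_left_mono) auto
    also have "\<dots> = sqrt V * \<bar>q0\<bar> * sqrt x" by (simp add: real_sqrt_mult)
    also have "\<dots> \<le> P1 * sqrt x" unfolding P1_def using that by (intro mult_right_mono) auto
    finally show ?thesis .
  qed
  have ev: "eventually (\<lambda>x::real. x powr (2/3) + 2 \<le> x / 2) at_top"
     "eventually (\<lambda>x::real. ln x \<le> x powr (2/3)) at_top"
     "eventually (\<lambda>x::real. s0 * sqrt (x * ln x) \<le> \<delta> * x powr (2/3)) at_top"
     "eventually (\<lambda>x::real. A * x powr (-1/6) \<le> 1) at_top"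
     "eventually (\<lambda>x::real. x * C - P1 * sqrt x - K1 * x powr (1/3) * ln x \<ge> 3 * ln x + 1) at_top"
    subgoal by real_asymp
    subgoal by real_asymp
    subgoal using \<delta>(1) by real_asymp
    subgoal by real_asymp
    subgoal using linear_dominates[OF C_pos P1 K1] .
    done
  note ev' = this[THEN eventually_compose_filterlim[OF _ filterlim_real_sequentially]]
  have "eventually (\<lambda>n. 3 \<le> n \<and> real n powr (2/3) + 2 \<le> real n / 2 \<and> ln (real n) \<le> real n powr (2/3) \<and>
     s0 * sqrt (real n * ln (real n)) \<le> \<delta> * real n powr (2/3) \<and> A * real n powr (-1/6) \<le> 1 \<and>
     real n * C - P1 * sqrt (real n) - K1 * real n powr (1/3) * ln (real n) \<ge> 3 * ln (real n) + 1) sequentially"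
    using ev' eventually_ge_at_top[of 3] by eventually_elim simp
  then obtain n0 where n0: "\<And>n. n \<ge> n0 \<Longrightarrow> 3 \<le> n \<and> real n powr (2/3) + 2 \<le> real n / 2 \<and> ln (real n) \<le> real n powr (2/3) \<and>
     s0 * sqrt (real n * ln (real n)) \<le> \<delta> * real n powr (2/3) \<and> A * real n powr (-1/6) \<le> 1 \<and>
     real n * C - P1 * sqrt (real n) - K1 * real n powr (1/3) * ln (real n) \<ge> 3 * ln (real n) + 1"
    unfolding eventually_sequentially by blast
  show ?thesis
  proof (rule exI, rule exI, intro allI impI)
    fix n assume "n \<ge> n0"
    note N = n0[OF this]
    define x where "x = real n"
    define L where "L = ln x"
    have x: "x \<ge> 3" "x > 0" using N by (auto simp: x_def)
    have L: "L \<ge> 1"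
    proof -
      have "exp 1 \<le> (3::real)" by (rule exp_le)
      then show ?thesis unfolding L_def using x by (simp add: ln_ge_iff)
    qed
    define B where "B = nat \<lceil>x powr (2/3)\<rceil>"
    have p23: "x powr (2/3) \<ge> 1" using x by (simp add: ge_one_powr_ge_zero)
    have B: "x powr (2/3) \<le> real B" "real B \<le> x powr (2/3) + 1" unfolding B_def using p23 by linarith+
    have B2: "real B \<le> 2 * x powr (2/3)" using B p23 by linarith
    have Bn: "real B + 1 \<le> x / 2" using B N by (simp add: x_def)
    have B0: "real B > 0" using B p23 by linarith
    define r where "r = sqrt (x * L)"
    have r: "r > 0" using x L by (simp add: r_def)
    define \<sigma> where "\<sigma> = s0 * r / real B"
    have \<sigma>: "\<sigma> > 0" using s0 r B0 by (simp add: \<sigma>_def)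
    have B\<sigma>: "real B * \<sigma> = s0 * r" using B0 by (simp add: \<sigma>_def)
    have "s0 * r \<le> \<delta> * x powr (2/3)" using N by (simp add: r_def L_def x_def)
    also have "\<dots> \<le> \<delta> * real B" using B \<delta> by (intro mult_left_mono) auto
    finally have \<sigma>\<delta>: "\<sigma> \<le> \<delta>" using B0 by (simp add: \<sigma>_def pos_divide_le_eq)
    define q where "q = x powr (-1/6)"
    have q: "q > 0" using x by (simp add: q_def)
    have Aq: "A * q \<le> 1" using N by (simp add: q_def x_def)
    define n1 where "n1 = n - B"
    have BN: "B \<le> n" using Bn x by (simp add: x_def)
    have n1x: "real n1 = x - real B" unfolding n1_def x_def using BN by (simp add: of_nat_diff)
    have n1: "real n1 \<ge> x / 2" "real n1 \<le> x" using n1x Bn by auto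
    have n10: "n1 \<ge> 1" using n1(1) x by (cases n1) auto
    \<comment> \<open>The quantile is taken at length \<open>n1\<close>, where the central limit
      theorem is applied, and moved by \<open>A * q\<close> to pay for the errors.\<close>
    define t where "t = - (sqrt (real n1 * V) * (q0 + A * q))"
    have sqn1: "sqrt (real n1) \<le> sqrt x" using n1 by simp
    have rx: "sqrt x \<le> r" unfolding r_def using L x by (simp add: mult_le_cancel_left1)
    have tr: "t \<le> sqrt V * \<bar>q0\<bar> * r"
    proof -
      have "- (q0 + A * q) \<le> \<bar>q0\<bar>" using A q by (smt (verit) mult_pos_pos)
      then have "sqrt (real n1 * V) * (- (q0 + A * q)) \<le> sqrt (real n1 * V) * \<bar>q0\<bar>" using V_pos by (intro mult_left_mono) auto
      also have "\<dots> = sqrt V * \<bar>q0\<bar> * sqrt (real n1)" by (simp add: real_sqrt_mult)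
      also have "\<dots> \<le> sqrt V * \<bar>q0\<bar> * r" using order_trans[OF sqn1 rx] V_pos by (intro mult_left_mono) auto
      finally show ?thesis unfolding t_def mult_minus_right .
    qed
    have tr2: "t \<le> s1 * r - 2 * (2 * (2 * b + 2) * r)" using tr by (simp add: s1_def algebra_simps)
    interpret S: steering_scheme W1 W2 Pstar v n B \<sigma> t b
    proof unfold_locales
      show "ln (real n) \<le> real B" using N B by (simp add: x_def)
      show "1 \<le> B" using B0 by simp
      show "\<sigma> * \<bar>v x\<bar> \<le> Pstar x / 2" for x using \<delta>(3)[of x] mult_right_mono[OF \<sigma>\<delta>, of "\<bar>v x\<bar>"] by linarith
      have rr: "sqrt (real n * ln (real n)) = r" by (simp add: r_def L_def x_def)
      have "2 * (2 * b + 2) * r \<le> s0 * r" using s01 b V_pos r by (intro mult_right_mono) (auto simp: s1_def intro: order_trans[rotated])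
      then show "2 * (2 * b + 2) * sqrt (real n * ln (real n)) \<le> real B * \<sigma>" unfolding rr B\<sigma> .
      show "t \<le> real B * \<sigma> * \<eta> - 2 * (2 * (2 * b + 2) * sqrt (real n * ln (real n)))"
      proof -
        have "s1 * r \<le> s0 * r * \<eta>" using mult_left_mono[OF s0\<eta>(1), of r] r by (simp add: mult_ac)
        then show ?thesis unfolding rr B\<sigma> using tr2 by linarith
      qed
      show "t \<le> real B * \<sigma> * (1 - \<eta>) - 2 * (2 * (2 * b + 2) * sqrt (real n * ln (real n)))"
      proof -
        have "s1 * r \<le> s0 * r * (1 - \<eta>)" using mult_left_mono[OF s0\<eta>(2), of r] r by (simp add: mult_ac)
        then show ?thesis unfolding rr B\<sigma> using tr2 by linarith
      qed
    qed (use v b BN \<sigma> in auto)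
    define T where "T = S.target"
    have p13: "x powr (1/3) \<ge> 1" using x by (simp add: ge_one_powr_ge_zero)
    define Z where "Z = x powr (1/3) * L"
    have Z: "Z \<ge> 1" "x powr (1/3) \<le> Z" "L \<le> Z"
      unfolding Z_def using p13 L mult_mono[OF p13 L] by (auto simp: mult_le_cancel_left1 mult_le_cancel_right1)
    have Tlow: "T \<ge> x * C - sqrt (x * V) * q0 - K1 * Z"
    proof -
      have T: "T = x * C + t - 2 * \<sigma> - real B * \<sigma>\<^sup>2 * \<chi>' - 2 * (2 * b + 2) * sqrt (real B * L)"
        unfolding T_def S.target_def S.chi_def S.a2_def S.Wc_def \<chi>'_def by (simp add: x_def L_def)
      have x23: "x powr (2/3) = x powr (1/3) * x powr (1/3)" by (simp flip: powr_add)
      have e1: "t \<ge> - (sqrt (x * V) * q0) - (2 * \<bar>q0\<bar> * sqrt V + sqrt V * A) * Z"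
      proof -
        have "sqrt x - sqrt (real n1) \<le> 2 * Z"
        proof -
          have "(sqrt x - sqrt (real n1)) * sqrt x \<le> (sqrt x - sqrt (real n1)) * (sqrt x + sqrt (real n1))"
            using sqn1 by (intro mult_left_mono) auto
          also have "\<dots> = x - real n1" using x by (simp add: algebra_simps)
          also have "\<dots> \<le> 2 * x powr (2/3)" using n1x B2 by simp
          also have "\<dots> = (2 * x powr (1/6)) * sqrt x" using x by (simp add: powr_half_sqrt[symmetric] flip: powr_add)
          finally have "sqrt x - sqrt (real n1) \<le> 2 * x powr (1/6)" using x by simp
          also have "\<dots> \<le> 2 * x powr (1/3)" using x by (simp add: powr_mono)
          finally show ?thesis using Z by linarith
        qed
        then have "\<bar>q0\<bar> * sqrt V * (sqrt x - sqrt (real n1)) \<le> \<bar>q0\<bar> * sqrt V * (2 * Z)" using V_pos by (intro mult_left_mono) auto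
        moreover have "(sqrt V * q0) * (sqrt (real n1) - sqrt x) \<le> \<bar>q0\<bar> * sqrt V * (sqrt x - sqrt (real n1))"
        proof -
          have "(sqrt V * q0) * (sqrt (real n1) - sqrt x) = (- q0) * (sqrt V * (sqrt x - sqrt (real n1)))" by (simp add: algebra_simps)
          also have "\<dots> \<le> \<bar>q0\<bar> * (sqrt V * (sqrt x - sqrt (real n1)))" using sqn1 V_pos by (intro mult_right_mono) auto
          finally show ?thesis by simp
        qed
        moreover have "sqrt (real n1) * (sqrt V * (A * q)) \<le> sqrt V * A * Z"
        proof -
          have "sqrt (real n1) * (sqrt V * (A * q)) \<le> sqrt x * (sqrt V * (A * q))" using sqn1 V_pos A q by (intro mult_right_mono) auto
          also have "\<dots> = sqrt V * A * (sqrt x * q)" by simp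
          also have "sqrt x * q = x powr (1/3)" unfolding q_def using x by (simp add: powr_half_sqrt[symmetric] flip: powr_add)
          also have "sqrt V * A * x powr (1/3) \<le> sqrt V * A * Z" using Z V_pos A by (intro mult_left_mono) auto
          finally show ?thesis .
        qed
        ultimately show ?thesis unfolding t_def real_sqrt_mult by (simp add: algebra_simps)
      qed
      have e2: "2 * \<sigma> \<le> 2 * Z" using \<sigma>\<delta> \<delta>(2) Z by linarith
      have e3: "real B * \<sigma>\<^sup>2 * \<chi>' \<le> s0\<^sup>2 * \<chi>' * Z"
      proof -
        have "real B * \<sigma>\<^sup>2 = s0\<^sup>2 * (r\<^sup>2 / real B)" using B0 by (simp add: \<sigma>_def power2_eq_square)
        also have "r\<^sup>2 / real B \<le> Z"
        proof -
          have "r\<^sup>2 = x * L" using x L by (simp add: r_def)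
          also have "x = x powr (1/3) * x powr (2/3)" using x by (simp flip: powr_add)
          also have "x powr (1/3) * x powr (2/3) * L \<le> x powr (1/3) * real B * L" using B L by (intro mult_right_mono mult_left_mono) auto
          finally show ?thesis using B0 by (simp add: Z_def pos_divide_le_eq mult_ac)
        qed
        finally have "real B * \<sigma>\<^sup>2 \<le> s0\<^sup>2 * Z" by (simp add: mult_left_mono)
        from mult_right_mono[OF this chi0] show ?thesis by (simp add: mult_ac)
      qed
      have e4: "2 * (2 * b + 2) * sqrt (real B * L) \<le> 4 * (2 * b + 2) * Z"
      proof -
        have "real B * L \<le> (2 * Z)\<^sup>2"
        proof -
          have "real B * L \<le> (2 * x powr (2/3)) * L" using B2 L by (intro mult_right_mono) auto
          also have "\<dots> \<le> (4 * x powr (2/3)) * (L * L)" using L by (intro mult_mono) (auto simp: mult_le_cancel_left1)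
          also have "\<dots> = (2 * Z)\<^sup>2" unfolding x23 by (simp add: Z_def power2_eq_square)
          finally show ?thesis .
        qed
        then have "sqrt (real B * L) \<le> 2 * Z" using Z by (intro real_le_lsqrt) auto
        then have "2 * (2 * b + 2) * sqrt (real B * L) \<le> 2 * (2 * b + 2) * (2 * Z)" using b(1) by (intro mult_left_mono) auto
        then show ?thesis by (simp add: algebra_simps)
      qed
      show ?thesis using e1 e2 e3 e4 unfolding T K1_def by (simp add: algebra_simps)
    qed
    have Tbig: "T \<ge> 3 * L + 1" using Tlow N P1_bound[of x] x unfolding Z_def x_def L_def mult.assoc by linarith
    \<comment> \<open>The divisor pays for the union over switching times and leaves M (B + 1) / exp
      T at most 1/n.\<close>
    define Y where "Y = exp T / ((real B + 1) * x)"
    have Yx: "Y \<ge> 2 * x"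
    proof -
      have "exp (3 * L + 1) = x^3 * exp 1" using x by (simp add: exp_add L_def exp_of_nat_mult[of 3, simplified])
      also have "\<dots> \<ge> x^3 * 1" using x by (intro mult_left_mono) auto
      finally have "x^3 \<le> exp T" using Tbig by (smt (verit) exp_le_cancel_iff)
      moreover have "2 * x * ((real B + 1) * x) \<le> 2 * x * (x / 2 * x)" using Bn x by (intro mult_left_mono mult_right_mono) auto
      ultimately have "2 * x * ((real B + 1) * x) \<le> exp T" by (simp add: power3_eq_cube)
      then show ?thesis unfolding Y_def using B0 x by (simp add: pos_le_divide_eq)
    qed
    define M where "M = nat \<lfloor>Y\<rfloor>"
    have MY: "real M \<le> Y" "Y < real M + 1" unfolding M_def using Yx x by linarith+
    have Mx: "real M \<ge> x" "real M \<ge> Y / 2" using MY Yx x by linarith+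
    have M1: "M \<ge> 1" using Mx x by (cases M) auto
    define \<theta> where "\<theta> = 2 / real M + 2 * real M * ((real B + 1) / exp T)"
    have \<theta>0: "\<theta> \<ge> 0" unfolding \<theta>_def using B0 by (intro add_nonneg_nonneg) auto
    have \<theta>: "\<theta> \<le> 4 / x"
    proof -
      have "2 / real M \<le> 2 / x" using Mx x by (intro divide_left_mono) auto
      moreover have "2 * real M * ((real B + 1) / exp T) \<le> 2 / x"
      proof -
        have cancel: "2 * (e / (d * x)) * (d / e) = 2 / x" if "d \<noteq> 0" "e \<noteq> 0" for d e :: real
          using that by simp
        have "2 * real M * ((real B + 1) / exp T) \<le> 2 * Y * ((real B + 1) / exp T)" using MY B0 by (intro mult_right_mono) auto
        also have "\<dots> = 2 / x" unfolding Y_def using cancel[of "real B + 1" "exp T"] B0 by simp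
        finally show ?thesis .
      qed
      ultimately show ?thesis unfolding \<theta>_def by simp
    qed
    have invx: "1 / x \<le> q"
    proof -
      have "1 / x = x powr (-1)" using x by (simp add: powr_minus_divide)
      also have "\<dots> \<le> q" unfolding q_def using x by (intro powr_mono) auto
      finally show ?thesis .
    qed
    have s\<theta>: "sqrt \<theta> \<le> 2 * q"
    proof -
      have "sqrt \<theta> \<le> sqrt (4 / x)" using \<theta> by simp
      also have "\<dots> = 2 * x powr (-1/2)" using x by (simp add: real_sqrt_divide powr_minus_divide powr_half_sqrt)
      also have "\<dots> \<le> 2 * q" unfolding q_def using x by (simp add: powr_mono)
      finally show ?thesis .
    qed
    have qn1: "real n1 powr (-1/6) \<le> 2 * q"
    proof -
      have "real n1 powr (-1/6) \<le> (x / 2) powr (-1/6)" using n1 x by (intro powr_mono2') auto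
      also have "\<dots> = q * 2 powr (1/6)" using x by (simp add: powr_divide q_def powr_minus_divide)
      also have "2 powr (1/6) \<le> (2::real) powr 1" by (intro powr_mono) auto
      finally show ?thesis using q by (simp add: mult.commute)
    qed
    have "FLF_code_exists W1 W2 n M eps"
    proof (rule S.steering_code[OF _ M1 \<theta>_def[unfolded T_def]])
      show "1 \<le> S.n1" using n10 by (simp add: S.n1_def n1_def)
      have n1S: "S.n1 = n1" by (simp add: S.n1_def n1_def)
      have "t / sqrt (real n1 * V) = - (q0 + A * q)" using n10 V_pos by (simp add: t_def)
      then have "1 - Qfun (t / sqrt (real n1 * V)) = Qfun (q0 + A * q)" using Qfun_minus[of "q0 + A * q"] by (simp only:)
      also have "\<dots> \<le> 2 * eps - a * (A * q)" using A q Aq by (intro a(2)) auto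
      also have "a * (A * q) = (2 * c0 + 20) * q" using a(1) by (simp add: A_def)
      finally have Q: "1 - Qfun (t / sqrt (real n1 * V)) \<le> 2 * eps - (2 * c0 + 20) * q" .
      have "c0 * real n1 powr (-1/6) \<le> c0 * (2 * q)" using qn1 c0 by (intro mult_left_mono) auto
      moreover have "4 / x \<le> 4 * q" using invx by simp
      moreover have "(1 - Qfun (t / sqrt (real n1 * V)) + c0 * real n1 powr (-1/6)) / 2 \<le> eps - 10 * q"
      proof -
        have "1 - Qfun (t / sqrt (real n1 * V)) + c0 * real n1 powr (-1/6) \<le> 2 * (eps - 10 * q)"
          using Q calculation(1) by (simp add: algebra_simps)
        from divide_right_mono[OF this, of 2] show ?thesis by simp
      qed
      ultimately have "(1 - Qfun (t / sqrt (real n1 * V)) + c0 * real n1 powr (-1/6)) / 2 + 4 / x + sqrt \<theta> + \<theta> \<le> eps"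
        using s\<theta> \<theta> by linarith
      then show "(1 - Qfun (t / sqrt (real S.n1 * V)) + (2 + (b ^ 3 / 2 + V\<^sup>2) * (2 * (1 + V) / V) + 1 / sqrt V + 1 / V) * real S.n1 powr (- 1 / 6)) / 2 +
        4 / real n + sqrt \<theta> + \<theta> \<le> eps" unfolding n1S c0_def x_def .
    qed
    moreover have "ln (real M) \<ge> x * C - sqrt (x * V) * q0 - (K1 + 3) * Z"
    proof -
      \<comment> \<open>One L each for the factor B + 1, the factor n and the halving of Y.\<close>
      have "T - 3 * L \<le> ln (Y / 2)"
      proof -
        have "ln (Y / 2) = T - ln (real B + 1) - L - ln 2"
          unfolding Y_def using B0 x by (simp add: ln_div ln_mult L_def)
        moreover have "ln (real B + 1) \<le> L" unfolding L_def using Bn B0 x by simp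
        moreover have "ln 2 \<le> (1::real)" using ln_le_minus_one[of "2::real"] by simp
        ultimately show ?thesis using L by linarith
      qed
      also have "ln (Y / 2) \<le> ln (real M)" using Mx Yx x by simp
      finally have "T - 3 * L \<le> ln (real M)" .
      then show ?thesis using Tlow Z(3) by (simp add: algebra_simps)
    qed
    ultimately show "\<exists>M. FLF_code_exists W1 W2 n M eps \<and>
      ln (real M) \<ge> real n * C - sqrt (real n * V) * Qinv (2 * eps) - (K1 + 3) * real n powr (1/3) * ln (real n)"
      unfolding x_def[symmetric] q0_def[symmetric] L_def[symmetric] Z_def mult.assoc by blast
  qed
qed

theorem second_order_expansion:
  assumes eps: "0 < eps" "eps < 1 / 2"
  shows "\<exists>K n0. \<forall>n\<ge>n0. \<bar>ln (real (Mstar_f W1 W2 n eps)) - real n * C + sqrt (real n * V) * Qinv (2 * eps)\<bar>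
     \<le> K * real n powr (1/3) * ln (real n)"
proof -
  obtain K1 n1 where conv: "\<And>n M. n \<ge> n1 \<Longrightarrow> FLF_code_exists W1 W2 n M eps \<Longrightarrow>
    ln (real M) \<le> real n * C - sqrt (real n * V) * Qinv (2 * eps) + K1 * real n powr (1/3) * ln (real n)"
    using converse[OF eps] by blast
  obtain K2 n2 where ach: "\<And>n. n \<ge> n2 \<Longrightarrow> \<exists>M. FLF_code_exists W1 W2 n M eps \<and>
    ln (real M) \<ge> real n * C - sqrt (real n * V) * Qinv (2 * eps) - K2 * real n powr (1/3) * ln (real n)"
    using achievability[OF eps] by blast
  show ?thesis
  proof (intro exI allI impI)
    fix n assume "n \<ge> max 1 (max n1 n2)"
    then have n: "n \<ge> 1" "n \<ge> n1" "n \<ge> n2" by auto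
    define Z where "Z = real n powr (1/3) * ln (real n)"
    have Z: "Z \<ge> 0" unfolding Z_def using n by simp
    define m where "m = real n * C - sqrt (real n * V) * Qinv (2 * eps)"
    obtain M where M: "FLF_code_exists W1 W2 n M eps" "ln (real M) \<ge> m - K2 * Z"
      using ach[OF n(3)] unfolding m_def Z_def mult.assoc by blast
    have up: "ln (real M') \<le> m + K1 * Z" if "FLF_code_exists W1 W2 n M' eps" for M'
      using conv[OF n(2) that] unfolding m_def Z_def mult.assoc .
    \<comment> \<open>\<open>GREATEST\<close> yields a maximum only for a nonempty bounded set; the
      converse supplies the bound and achievability the element.\<close>
    have bnd: "M' \<le> nat \<lceil>exp (m + K1 * Z)\<rceil>" if code: "FLF_code_exists W1 W2 n M' eps" for M'
    proof -
      have "M' \<ge> 1" using code by (simp add: FLF_code_exists_def)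
      moreover have "exp (ln (real M')) \<le> exp (m + K1 * Z)" using up[OF code] by simp
      ultimately have "real M' \<le> exp (m + K1 * Z)" by simp
      then show ?thesis by linarith
    qed
    have G: "FLF_code_exists W1 W2 n (Mstar_f W1 W2 n eps) eps"
      unfolding Mstar_f_def by (rule GreatestI_nat[where P = "\<lambda>M. FLF_code_exists W1 W2 n M eps", OF M(1) bnd])
    have "M \<le> Mstar_f W1 W2 n eps"
      unfolding Mstar_f_def by (rule Greatest_le_nat[where P = "\<lambda>M. FLF_code_exists W1 W2 n M eps", OF M(1) bnd])
    moreover have "M \<ge> 1" using M(1) by (simp add: FLF_code_exists_def)
    ultimately have "ln (real M) \<le> ln (real (Mstar_f W1 W2 n eps))" by simp
    moreover have "K1 * Z \<le> max K1 K2 * Z" "K2 * Z \<le> max K1 K2 * Z" using Z by (auto intro: mult_right_mono)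
    ultimately have "\<bar>ln (real (Mstar_f W1 W2 n eps)) - m\<bar> \<le> max K1 K2 * Z"
      using up[OF G] M(2) by linarith
    then show "\<bar>ln (real (Mstar_f W1 W2 n eps)) - real n * C + sqrt (real n * V) * Qinv (2 * eps)\<bar>
     \<le> max K1 K2 * real n powr (1/3) * ln (real n)"
      unfolding m_def Z_def by (simp add: algebra_simps)
  qed
qed

end

theorem theorem3:
  fixes W1 W2 :: "'x::finite \<Rightarrow> 'y::finite \<Rightarrow> real"
    and Pstar :: "'x \<Rightarrow> real"
    and eps :: real
  assumes W1: "is_channel W1" and W2: "is_channel W2"
    and Pstar_dist: "is_dist Pstar"
    and Pstar_max: "\<forall>P. is_dist P \<longrightarrow>
          min (mutual_info P W1) (mutual_info P W2) \<le> min (mutual_info Pstar W1) (mutual_info Pstar W2)"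
    and Pstar_unique: "\<forall>P. is_dist P \<and>
          min (mutual_info P W1) (mutual_info P W2) = min (mutual_info Pstar W1) (mutual_info Pstar W2)
          \<longrightarrow> P = Pstar"
    and Pstar_pos: "\<forall>x. Pstar x > 0"
    and V1_pos: "disp Pstar W1 > 0" and V2_pos: "disp Pstar W2 > 0"
    and C1_gt: "single_cap W1 > common_cap W1 W2"
    and C2_gt: "single_cap W2 > common_cap W1 W2"
    and var_const: "\<forall>x. (eta_const W1 W2 Pstar)\<^sup>2 * cond_var Pstar W1 x
          + (1 - eta_const W1 W2 Pstar)\<^sup>2 * cond_var Pstar W2 x
        = (eta_const W1 W2 Pstar)\<^sup>2 * disp Pstar W1 + (1 - eta_const W1 W2 Pstar)\<^sup>2 * disp Pstar W2"
    and eps: "0 < eps" "eps < 1 / 2"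
  shows "\<exists>K n0. \<forall>n\<ge>n0.
     \<bar>ln (real (Mstar_f W1 W2 n eps)) - real n * common_cap W1 W2
        + sqrt (real n * ((eta_const W1 W2 Pstar)\<^sup>2 * disp Pstar W1
                         + (1 - eta_const W1 W2 Pstar)\<^sup>2 * disp Pstar W2)) * Qinv (2 * eps)\<bar>
     \<le> K * real n powr (1/3) * ln (real n)"
proof -
  interpret cm_dmbc W1 W2 Pstar
    by unfold_locales (use assms in auto)
  show ?thesis using second_order_expansion[OF eps] unfolding C_def V_def \<eta>_def .
qed

end
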